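(* Let $\mathbb{F}$ be a field, let $m$, $n$, $r\le\min\{m,n\}$ be positive integers and $d$ a non negative integer. Let $\alpha_1(s)\mid\dots\mid\alpha_r(s)$ be monic polynomials in $\mathbb{F}[s]$ and let $(f_r,\dots,f_1)$, $(k_1,\dots,k_r)$, $(\ell_1,\dots,\ell_r)$ be partitions of non negative integers. Let $g_1\ge\dots\ge g_r$ be the decreasing reordering of $k_r+\ell_1,\,k_{r-1}+\ell_2,\dots,k_1+\ell_r$. Consider the conditions (a) $f_1=0$; (b) $(d-g_r,\dots,d-g_1)\prec(\deg(\alpha_r)+f_r,\dots,\deg(\alpha_1)+f_1)$; (c) $\ell_1=\dots=\ell_r=0$ if $r=n$; (d) $k_1=\dots=k_r=0$ if $r=m$. (Necessity, arbitrary field.) If $A(s)\in\mathbb{F}[s]^{m\times n}$ is a polynomial matrix with $\operatorname{rank}(A(s))=r$, $\deg(A(s))=d$, $\alpha_1(s),\dots,\alpha_r(s)$ as invariant factors, $f_1,\dots,f_r$ as partial multiplicities of $\infty$, $k_1,\dots,k_r$ as col-span minimal indices, and $\ell_1,\dots,\ell_r$ as row-span minimal indices, then (a), (b), (c) and (d) hold. (Sufficiency.) Conversely, if $\mathbb{F}$ is algebraically closed, conditions (a), (b), (c) and (d) are sufficient for the existence of a polynomial matrix $A(s)\in\mathbb{F}[s]^{m\times n}$ with $\operatorname{rank}(A(s))=r$, $\deg(A(s))=d$, $\alpha_1(s),\dots,\alpha_r(s)$ as invariant factors, $f_1,\dots,f_r$ as partial multiplicities of $\infty$, $k_1,\dots,k_r$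 as col-span minimal indices, and $\ell_1,\dots,\ell_r$ as row-span minimal indices.
   Context: $\mathbb{F}[s]$ is the ring of polynomials and $\mathbb{F}(s)$ its field of fractions. The rank of a polynomial matrix is its rank over $\mathbb{F}(s)$. The degree of a polynomial matrix is the highest degree of its entries ($-\infty$ for the zero matrix). Invariant factors: a polynomial matrix $P(s)\in\mathbb{F}[s]^{m\times n}$ of rank $r$ can be written $U(s)P(s)V(s)=\begin{bmatrix}\operatorname{diag}(\alpha_1(s),\dots,\alpha_r(s))&0\\0&0\end{bmatrix}$ (Smith form), with $U,V$ unimodular (square polynomial matrices with polynomial inverse) and $\alpha_1(s)\mid\dots\mid\alpha_r(s)$ monic; the $\alpha_i$ are uniquely determined and are the invariant factors of $P(s)$. Partial multiplicities of $\infty$: if $\deg(P(s))=d$, put $\operatorname{rev}P(t)=t^dP(1/t)$. The partial multiplicities of $\infty$ in $P(s)$ are the integers $0\le f_1\le\dots\le f_r$ where $f_i$ is the exponent of $t$ in the $i$-th invariant factor of $\operatorname{rev}P(t)$ (zero exponents included). For $P(s)\in\mathbb{F}(s)^{m\times n}$, $\mathcal{R}(P(s))\subseteq\mathbb{F}(s)^m$ is the $\mathbb{F}(s)$-subspace spanned by the columns of $P(s)$. A polynomial basis of a subspace $\mathcal{V}$ of $\mathbb{F}(s)^p$ is a basis consisting of polynomial vectors; its order is the sum of the degrees of its vectors (degree of a vector = maximum degree of its entries). A minimal basis of $\mathcal{V}$ is a polynomial basis of least order. The decreasingly ordered list of degrees of the vectors is the same for all minimal bases of $\mathcal{V}$;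 these degrees are the minimal indices of $\mathcal{V}$. The col-span (row-span) minimal indices of $P(s)$ are the minimal indices of $\mathcal{R}(P(s))$ ($\mathcal{R}(P(s)^T)$), ordered decreasingly. A partition is a non-increasing sequence of non negative integers. For sequences of integers $a_1\ge\dots\ge a_r$ and $b_1\ge\dots\ge b_r$, $(a_1,\dots,a_r)\prec(b_1,\dots,b_r)$ (majorization) means $\sum_{i=1}^k a_i\le\sum_{i=1}^k b_i$ for $1\le k\le r-1$ and $\sum_{i=1}^r a_i=\sum_{i=1}^r b_i$. *)

theory Defs
  imports "Jordan_Normal_Form.DL_Rank" "HOL-Computational_Algebra.Polynomial_Factorial"
begin

text \<open>
  Polynomial matrices are of type \<^typ>\<open>'a poly mat\<close> with \<^typ>\<open>'a\<close> a field, and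
  \<^typ>\<open>'a poly fract\<close> is the field of rational functions. Lists hold \<open>x\<^sub>1, \<dots>, x\<^sub>r\<close>
  as \<open>xs ! 0, \<dots>, xs ! (r - 1)\<close>.
\<close>

definition rat_mat :: "'a::field poly mat \<Rightarrow> 'a poly fract mat" where
  "rat_mat A = map_mat to_fract A"

definition pm_rank :: "'a::field poly mat \<Rightarrow> nat" where
  "pm_rank A = vec_space.rank (dim_row A) (rat_mat A)"

text \<open>
  Degrees are natural numbers, so the zero matrix has degree 0 here rather than minus infinity.
  The distinction does not matter for matrices of positive rank. The same holds for members of a
  basis, which are nonzero.
\<close>

definition mat_degree :: "'a::field poly mat \<Rightarrow> nat" where
  "mat_degree A = Max (Polynomial.degree ` elements_mat A)"

definition vec_degree :: "'a::field poly vec \<Rightarrow> nat" where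
  "vec_degree v = Max (Polynomial.degree ` vec_set v)"

definition diag_rect_mat :: "nat \<Rightarrow> nat \<Rightarrow> 'a::zero list \<Rightarrow> 'a mat" where
  "diag_rect_mat m n xs = mat m n (\<lambda>(i, j). if i = j \<and> i < length xs then xs ! i else 0)"

text \<open>
  Over the ring of polynomials, \<^const>\<open>invertible_mat\<close> asks for a polynomial inverse, which is
  unimodularity.
\<close>

definition invariant_factors :: "'a::field poly mat \<Rightarrow> 'a poly list \<Rightarrow> bool" where
  "invariant_factors P \<alpha>s \<longleftrightarrow>
     length \<alpha>s = pm_rank P \<and>
     (\<forall>\<alpha>\<in>set \<alpha>s. lead_coeff \<alpha> = 1) \<and>
     sorted_wrt (dvd) \<alpha>s \<and>
     (\<exists>U\<in>carrier_mat (dim_row P) (dim_row P). \<exists>V\<in>carrier_mat (dim_col P) (dim_col P).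
        invertible_mat U \<and> invertible_mat V \<and>
        U * P * V = diag_rect_mat (dim_row P) (dim_col P) \<alpha>s)"

text \<open>\<open>t\<^sup>d p(1/t)\<close>, for \<open>p\<close> of degree at most \<open>d\<close>.\<close>

definition rev_poly :: "nat \<Rightarrow> 'a::field poly \<Rightarrow> 'a poly" where
  "rev_poly d p = (\<Sum>i\<le>d. monom (Polynomial.coeff p i) (d - i))"

definition rev_mat :: "'a::field poly mat \<Rightarrow> 'a poly mat" where
  "rev_mat P = map_mat (rev_poly (mat_degree P)) P"

text \<open>The order of vanishing at 0 is the exponent of the prime factor \<open>t\<close>.\<close>

definition partial_multiplicities_inf :: "'a::field poly mat \<Rightarrow> nat list \<Rightarrow> bool" where
  "partial_multiplicities_inf P fs \<longleftrightarrow>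
     (\<exists>\<beta>s. invariant_factors (rev_mat P) \<beta>s \<and> fs = map (Polynomial.order 0) \<beta>s)"

text \<open>\<open>W\<close> is meant to be (the carrier of) a subspace of the rational column vectors of length \<open>p\<close>.\<close>

definition polynomial_basis ::
    "nat \<Rightarrow> 'a::field poly fract vec set \<Rightarrow> 'a poly vec list \<Rightarrow> bool" where
  "polynomial_basis p W bs \<longleftrightarrow>
     set bs \<subseteq> carrier_vec p \<and> distinct bs \<and>
     vectorspace.basis class_ring ((module_vec TYPE('a poly fract) p)\<lparr>carrier := W\<rparr>)
       (map_vec to_fract ` set bs)"

definition basis_order :: "'a::field poly vec list \<Rightarrow> nat" where
  "basis_order bs = sum_list (map vec_degree bs)"

definition minimal_basis ::
    "nat \<Rightarrow> 'a::field poly fract vec set \<Rightarrow> 'a poly vec list \<Rightarrow> bool" where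
  "minimal_basis p W bs \<longleftrightarrow>
     polynomial_basis p W bs \<and>
     (\<forall>cs. polynomial_basis p W cs \<longrightarrow> basis_order bs \<le> basis_order cs)"

definition minimal_indices ::
    "nat \<Rightarrow> 'a::field poly fract vec set \<Rightarrow> nat list \<Rightarrow> bool" where
  "minimal_indices p W ks \<longleftrightarrow>
     (\<exists>bs. minimal_basis p W bs \<and> ks = rev (sort (map vec_degree bs)))"

definition col_span_minimal_indices :: "'a::field poly mat \<Rightarrow> nat list \<Rightarrow> bool" where
  "col_span_minimal_indices P ks \<longleftrightarrow>
     minimal_indices (dim_row P) (vec_space.col_space (dim_row P) (rat_mat P)) ks"

definition row_span_minimal_indices :: "'a::field poly mat \<Rightarrow> nat list \<Rightarrow> bool" where
  "row_span_minimal_indices P ls \<longleftrightarrow> col_span_minimal_indices (transpose_mat P) ls"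

definition has_data ::
    "nat \<Rightarrow> nat \<Rightarrow> 'a::field poly list \<Rightarrow> nat list \<Rightarrow> nat list \<Rightarrow> nat list \<Rightarrow> 'a poly mat \<Rightarrow> bool"
  where
  "has_data r d \<alpha>s fs ks ls A \<longleftrightarrow>
     pm_rank A = r \<and>
     mat_degree A = d \<and>
     invariant_factors A \<alpha>s \<and>
     partial_multiplicities_inf A fs \<and>
     col_span_minimal_indices A ks \<and>
     row_span_minimal_indices A ls"

text \<open>Only meant for non-increasing sequences.\<close>

definition majorized :: "int list \<Rightarrow> int list \<Rightarrow> bool" (infix \<open>\<prec>\<^sub>m\<close> 50) where
  "as \<prec>\<^sub>m bs \<longleftrightarrow>
     length as = length bs \<and>
     (\<forall>k. 1 \<le> k \<and> k \<le> length as - 1 \<longrightarrow> sum_list (take k as) \<le> sum_list (take k bs)) \<and>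
     sum_list as = sum_list bs"

definition is_alg_closed :: "'a::field itself \<Rightarrow> bool" where
  "is_alg_closed _ \<longleftrightarrow> (\<forall>p :: 'a poly. Polynomial.degree p > 0 \<longrightarrow> (\<exists>x. poly p x = 0))"

end

theory Submission
  imports Defs
begin

text \<open>
  Let \<open>P\<close> (of size \<open>m \<times> r\<close>) and \<open>Q\<close> (of size \<open>n \<times> r\<close>) have as columns minimal bases of the column space and
  of the row space of \<open>A\<close>, with degrees \<open>k\<close> in decreasing and \<open>l\<close> in increasing order. Then \<open>A = P E Q\<^sup>T\<close> with
  a nonsingular polynomial core \<open>E\<close> of size \<open>r\<close>. Minimal bases have polynomial left inverses
  (\<open>minimal_columns_left_inverse\<close>), so \<open>E\<close> has the invariant factors of \<open>A\<close>. Their leading coefficients are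
  independent (\<open>minimal_columns_lead_injective\<close>), which implies \<open>deg E\<^sub>a\<^sub>b \<le> d - k\<^sub>a - l\<^sub>b\<close>
  (\<open>degree_bound_of_core\<close>) and shows that the core reversed with these formal degrees carries the structure of
  \<open>A\<close> at infinity.

  Necessity of the majorization is a statement about minors of \<open>E\<close>. A minor of size \<open>j\<close> is a multiple of
  \<open>\<alpha>\<^sub>1 \<dots> \<alpha>\<^sub>j\<close>, the order at 0 of its reversal is at least \<open>f\<^sub>1 + \<dots> + f\<^sub>j\<close>, and its degree, this order and
  the indices \<open>k\<close> and \<open>l\<close> of its rows and columns add up to \<open>j d\<close>. For any \<open>j\<close> positions the combinatorial lemma
  \<open>exists_dominated_minor\<close> provides a nonzero minor whose rows come before and whose columns come after these
  positions, and so have at least their indices. The result, \<open>necessary_inequalities\<close>, is the majorization in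
  terms of subsets. That \<open>f\<^sub>1 = 0\<close> expresses that the degree \<open>d\<close> is attained, and the indices of a full space vanish
  because the unit vectors are a basis of it.

  For sufficiency the core is constructed. After a change of variable that moves infinity to a finite point
  and an ordinary point to infinity, all data are contained in one chain of polynomials of degrees
  \<open>deg \<alpha>\<^sub>i + f\<^sub>i\<close>. An induction that splits factors of these polynomials gives a triangular matrix
  with this chain as invariant factors and diagonal degrees \<open>d - k\<^sub>i - l\<^sub>i\<close> (\<open>triangular_realization\<close>). Transported back
  (\<open>moebius_transfer\<close>) and multiplied by explicit minimal bases (\<open>exists_frame\<close>), it becomes the required matrix.
  Its Smith form is identified by comparing orders of vanishing point by point, where minors of two-sided
  multiples give inequalities and the determinant gives equality (\<open>orders_eq_of_diag_factorization\<close>).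
\<close>

section \<open>Minors and divisibility chains\<close>

text \<open>The largest of \<open>j\<close> distinct positions is at least \<open>j - 1\<close>, so its entry is a multiple of \<open>a (j - 1)\<close>.\<close>

lemma prod_initial_dvd_prod:
  fixes a :: "nat \<Rightarrow> 'b::comm_monoid_mult"
  assumes chain: "\<And>i j. i \<le> j \<Longrightarrow> j < r \<Longrightarrow> a i dvd a j" and "S \<subseteq> {..<r}"
  shows "(\<Prod>i<card S. a i) dvd (\<Prod>x\<in>S. a x)"
  using assms(2)
proof (induction "card S" arbitrary: S)
  case 0
  then show ?case by (metis prod.empty lessThan_0 one_dvd)
next
  case (Suc k)
  have fin: "finite S" using Suc.prems finite_subset by blast
  have ne: "S \<noteq> {}" using Suc.hyps by auto
  define x where "x = Max S"
  have x: "x \<in> S" unfolding x_def using fin ne by simp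
  have cardS': "k = card (S - {x})" using Suc.hyps x fin by simp
  have "S - {x} \<subseteq> {..<x}" using fin x_def by (auto simp: less_le)
  hence "k \<le> x" using cardS' card_mono[of "{..<x}" "S - {x}"] by simp
  moreover have "x < r" using x Suc.prems by auto
  ultimately have 1: "a k dvd a x" using chain by blast
  have 2: "(\<Prod>i<k. a i) dvd (\<Prod>y\<in>S - {x}. a y)"
    unfolding cardS' by (rule Suc.hyps(1)[OF cardS']) (use Suc.prems in blast)
  have "(\<Prod>i<card S. a i) = (\<Prod>i<k. a i) * a k" using Suc.hyps(2)[symmetric] by simp
  moreover have "(\<Prod>y\<in>S. a y) = (\<Prod>y\<in>S - {x}. a y) * a x"
    using prod.remove[OF fin x, of a] by (simp add: mult.commute)
  ultimately show ?case using mult_dvd_mono[OF 2 1] by simp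
qed

text \<open>
  Multilinearity in the rows expands the determinant over all maps \<open>f\<close> from rows to diagonal
  positions. A map with a repeated value contributes two equal rows of \<open>Y\<close>, and the others
  contribute a product of entries of the chain at distinct positions.
\<close>

lemma prod_initial_dvd_det:
  fixes a :: "nat \<Rightarrow> 'b::comm_ring_1"
  assumes X: "X \<in> carrier_mat j r" and Y: "Y \<in> carrier_mat r j"
    and chain: "\<And>i k. i \<le> k \<Longrightarrow> k < r \<Longrightarrow> a i dvd a k"
  shows "(\<Prod>i<j. a i) dvd det (X * mat_diag r a * Y)"
proof -
  let ?v = "\<lambda>i k. (X $$ (i,k) * a k) \<cdot>\<^sub>v row Y k"
  have XD: "X * mat_diag r a = mat j r (\<lambda>(i,k). X $$ (i,k) * a k)"
    by (rule mat_diag_mult_right[OF X])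
  have c: "X * mat_diag r a \<in> carrier_mat j r" unfolding XD by simp
  have rows: "X * mat_diag r a * Y = mat\<^sub>r j j (\<lambda>i. finsum_vec TYPE('b) j (?v i) {0..<r})"
  proof (rule eq_matI, goal_cases)
    case (1 i k)
    hence i: "i < j" and k: "k < j" by auto
    have "mat\<^sub>r j j (\<lambda>i. finsum_vec TYPE('b) j (?v i) {0..<r}) $$ (i, k)
        = (\<Sum>l\<in>{0..<r}. ?v i l $ k)"
      using i k Y by (simp del: index_smult_vec) (subst index_finsum_vec, auto)
    also have "\<dots> = (X * mat_diag r a * Y) $$ (i, k)"
      using i k Y c by (simp add: scalar_prod_def XD)
    finally show ?case by simp
  qed (use carrier_matD[OF c] carrier_matD[OF Y] in simp_all)
  have "det (X * mat_diag r a * Y) = (\<Sum>f\<in>{f. (\<forall>i\<in>{0..<j}. f i \<in> {0..<r}) \<and> (\<forall>i. i \<notin> {0..<j} \<longrightarrow> f i = i)}.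
      det (mat\<^sub>r j j (\<lambda>i. ?v i (f i))))"
    unfolding rows by (rule det_linear_rows_sum) (use carrier_matD(2)[OF Y] in \<open>auto intro!: smult_carrier_vec[THEN iffD2]\<close>)
  also have "(\<Prod>i<j. a i) dvd \<dots>"
  proof (rule dvd_sum)
    fix f assume "f \<in> {f. (\<forall>i\<in>{0..<j}. f i \<in> {0..<r}) \<and> (\<forall>i. i \<notin> {0..<j} \<longrightarrow> f i = i)}"
    hence f: "f i < r" if "i < j" for i using that by simp
    have eq: "det (mat\<^sub>r j j (\<lambda>i. ?v i (f i)))
        = (\<Prod>i\<in>{0..<j}. X $$ (i, f i) * a (f i)) * det (mat\<^sub>r j j (\<lambda>i. row Y (f i)))"
      by (rule det_rows_mul) (use Y f in auto)
    show "(\<Prod>i<j. a i) dvd det (mat\<^sub>r j j (\<lambda>i. ?v i (f i)))"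
    proof (cases "inj_on f {..<j}")
      case True
      have "card (f ` {..<j}) = j" using card_image[OF True] by simp
      hence "(\<Prod>i<j. a i) dvd (\<Prod>x\<in>f ` {..<j}. a x)"
        using prod_initial_dvd_prod[OF chain, where S="f ` {..<j}"] f by (simp add: image_subset_iff)
      also have "(\<Prod>x\<in>f ` {..<j}. a x) = (\<Prod>i\<in>{0..<j}. a (f i))"
        using prod.reindex[OF True, of a] by (simp add: atLeast0LessThan)
      finally show ?thesis unfolding eq prod.distrib by simp
    next
      case False
      then obtain p q where pq: "p < j" "q < j" "p \<noteq> q" "f p = f q" by (auto simp: inj_on_def)
      have "det (mat\<^sub>r j j (\<lambda>i. row Y (f i))) = 0"
        by (rule det_identical_rows[OF _ pq(3,1,2)]) (use pq Y f in auto)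
      thus ?thesis unfolding eq by simp
    qed
  qed
  finally show ?thesis .
qed

text \<open>
  Each permutation in the Leibniz formula sends \<open>x + 1\<close> rows to distinct columns, so one of them
  avoids the first \<open>x\<close> columns.
\<close>

lemma nonzero_entry_of_staircase_block:
  fixes F :: "'b::idom mat"
  assumes F: "F \<in> carrier_mat n n" and det: "det F \<noteq> 0" and x: "x < n"
  shows "\<exists>p q. p \<le> x \<and> x \<le> q \<and> q < n \<and> F $$ (p, q) \<noteq> 0"
proof (rule ccontr)
  assume "\<not> ?thesis"
  hence zero: "\<And>p q. p \<le> x \<Longrightarrow> x \<le> q \<Longrightarrow> q < n \<Longrightarrow> F $$ (p, q) = 0" by blast
  have "(\<Prod>i = 0..<n. F $$ (i, \<pi> i)) = 0" if \<pi>: "\<pi> permutes {0..<n}" for \<pi>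
  proof -
    have "\<exists>i\<le>x. x \<le> \<pi> i"
    proof (rule ccontr)
      assume "\<not> ?thesis"
      hence "\<pi> ` {..x} \<subseteq> {..<x}" by force
      hence "card (\<pi> ` {..x}) \<le> x" using card_mono[of "{..<x}" "\<pi> ` {..x}"] by simp
      moreover have "card (\<pi> ` {..x}) = Suc x"
        using card_image[OF inj_on_subset[OF permutes_inj[OF \<pi>] subset_UNIV], of "{..x}"] by simp
      ultimately show False by simp
    qed
    then obtain i where "i \<le> x" "x \<le> \<pi> i" by blast
    moreover have "\<pi> i < n" using permutes_in_image[OF \<pi>, of i] \<open>i \<le> x\<close> x by simp
    ultimately have "F $$ (i, \<pi> i) = 0" "i \<in> {0..<n}" using zero x by auto
    thus ?thesis by (metis finite_atLeastLessThan prod_zero)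
  qed
  hence "det F = 0" unfolding det_def'[OF F] by (intro sum.neutral) auto
  thus False using det by simp
qed

lemma det_permute_rows_cols_nonzero:
  fixes E :: "'b::idom mat"
  assumes E: "E \<in> carrier_mat r r" and det: "det E \<noteq> 0" and p: "p permutes {0..<r}"
  shows "det (mat r r (\<lambda>(a, b). E $$ (p a, p b))) \<noteq> 0"
proof -
  have pr: "\<And>i. i < r \<Longrightarrow> p i < r" using permutes_in_image[OF p] by auto
  define B where "B = (mat r r (\<lambda>(i, j). E $$ (p i, j)))\<^sup>T"
  have Bc: "B \<in> carrier_mat r r" unfolding B_def by simp
  have sg: "(signof p :: 'b) \<noteq> 0" by (simp add: sign_def)
  have B: "det B \<noteq> 0" unfolding B_def
    using det_permute_rows[OF E p] det sg by (subst det_transpose) auto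
  have "mat r r (\<lambda>(a, b). E $$ (p a, p b)) = (mat r r (\<lambda>(i, j). B $$ (p i, j)))\<^sup>T"
    by (rule eq_matI) (auto simp: B_def pr)
  also have "det \<dots> = signof p * det B"
    using det_permute_rows[OF Bc p] by (subst det_transpose) auto
  finally show ?thesis using sg B by simp
qed

lemma inj_self_map_extends_to_permutation:
  assumes "inj_on e {..<r}" "\<And>i. i < r \<Longrightarrow> e i < (r::nat)"
  shows "(\<lambda>i. if i < r then e i else i) permutes {0..<r}"
proof (rule bij_imp_permutes)
  have "bij_betw e {..<r} {..<r}" using assms
    by (intro bij_betw_imageI endo_inj_surj) auto
  thus "bij_betw (\<lambda>i. if i < r then e i else i) {0..<r} {0..<r}"
    unfolding atLeast0LessThan by (subst bij_betw_cong[where g=e]) auto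
qed auto

lemma insert_index_mono2: "i \<le> j \<Longrightarrow> q \<le> p \<Longrightarrow> insert_index p i \<le> insert_index q j"
  unfolding insert_index_def by auto

text \<open>
  A position \<open>x\<close> outside the range of \<open>e\<close> can be disposed of by deleting a row \<open>p \<ge> x\<close> and a column
  \<open>q \<le> x\<close> such that the rest of the matrix stays nonsingular. The deletion moves the remaining
  positions \<open>e i\<close> relative to the rows and to the columns in the two directions that the
  conclusion asks for. Once all positions are in the range of \<open>e\<close>, the minor is the whole
  determinant up to a permutation. The chosen rows and columns need not be listed in order.
\<close>

lemma exists_dominated_minor:
  fixes E :: "'b::idom mat"
  assumes "E \<in> carrier_mat r r" and "det E \<noteq> 0"
    and "inj_on e {..<j}" and "\<And>i. i < j \<Longrightarrow> e i < r"
  shows "\<exists>f g. (\<forall>i<j. f i \<le> e i \<and> e i \<le> g i \<and> g i < r)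
    \<and> det (mat j j (\<lambda>(a, b). E $$ (f a, g b))) \<noteq> 0"
  using assms
proof (induction r arbitrary: E e)
  case 0
  hence "j = 0" by (metis gr0I less_zeroE)
  show ?case unfolding \<open>j = 0\<close> by (simp add: det_def)
next
  case (Suc r)
  show ?case
  proof (cases "{..<Suc r} \<subseteq> e ` {..<j}")
    case True
    have sub: "e ` {..<j} \<subseteq> {..<Suc r}" using Suc.prems(4) by auto
    have j: "j = Suc r" using card_image[OF Suc.prems(3)] True sub by (metis card_lessThan subset_antisym)
    let ?p = "\<lambda>i. if i < Suc r then e i else i"
    have p: "?p permutes {0..<Suc r}"
      by (rule inj_self_map_extends_to_permutation) (use Suc.prems j in auto)
    have "mat (Suc r) (Suc r) (\<lambda>(a, b). E $$ (?p a, ?p b)) = mat j j (\<lambda>(a, b). E $$ (e a, e b))"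
      by (rule eq_matI) (auto simp: j)
    hence "det (mat j j (\<lambda>(a, b). E $$ (e a, e b))) \<noteq> 0"
      using det_permute_rows_cols_nonzero[OF Suc.prems(1,2) p] by simp
    thus ?thesis using Suc.prems(4) by (intro exI[of _ e]) auto
  next
    case False
    then obtain x where x: "x < Suc r" "x \<notin> e ` {..<j}" by auto
    have adj: "adj_mat E \<in> carrier_mat (Suc r) (Suc r)"
      "E * adj_mat E = det E \<cdot>\<^sub>m 1\<^sub>m (Suc r)" using adj_mat[OF Suc.prems(1)] by auto
    have "det (adj_mat E) \<noteq> 0"
    proof
      assume "det (adj_mat E) = 0"
      hence "det (E * adj_mat E) = 0" using det_mult[OF Suc.prems(1) adj(1)] by simp
      thus False unfolding adj(2) using Suc.prems(2) by simp
    qed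
    \<comment> \<open>A row at or below \<open>x\<close> and a column at or before \<open>x\<close> can be deleted together.\<close>
    from nonzero_entry_of_staircase_block[OF adj(1) this x(1)] obtain q p where
      qp: "q \<le> x" "x \<le> p" "p < Suc r" "adj_mat E $$ (q, p) \<noteq> 0" by blast
    have cof: "cofactor E p q \<noteq> 0" using qp x Suc.prems(1) unfolding adj_mat_def by auto
    have D: "mat_delete E p q \<in> carrier_mat r r" using mat_delete_carrier[OF Suc.prems(1)] by simp
    let ?e = "\<lambda>i. delete_index x (e i)"
    have e: "insert_index x (?e i) = e i" if "i < j" for i
      using that x by (intro insert_delete_index) auto
    have er: "?e i < r" if "i < j" for i
    proof -
      have "e i \<noteq> x" "e i < Suc r" using that x(2) Suc.prems(4) by auto
      thus ?thesis using x(1) unfolding delete_index_def by auto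
    qed
    have inj: "inj_on ?e {..<j}"
    proof (rule inj_onI)
      fix i i' assume i: "i \<in> {..<j}" "i' \<in> {..<j}" and eq: "?e i = ?e i'"
      have "e i = insert_index x (?e i)" "e i' = insert_index x (?e i')"
        using e i unfolding lessThan_iff by (rule_tac sym, blast)+
      hence "e i = e i'" unfolding eq by (rule box_equals[OF refl sym sym])
      thus "i = i'" using inj_onD[OF Suc.prems(3)] i by blast
    qed
    have D0: "det (mat_delete E p q) \<noteq> 0" using cof unfolding cofactor_def by simp
    have "\<exists>f g. (\<forall>i<j. f i \<le> ?e i \<and> ?e i \<le> g i \<and> g i < r) \<and>
        det (mat j j (\<lambda>(a, b). mat_delete E p q $$ (f a, g b))) \<noteq> 0"
      by (rule Suc.IH[OF D D0 inj er])
    then obtain f g where fg: "\<forall>i<j. f i \<le> ?e i \<and> ?e i \<le> g i \<and> g i < r"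
      "det (mat j j (\<lambda>(a, b). mat_delete E p q $$ (f a, g b))) \<noteq> 0"
      by (elim exE conjE) (rule that)
    define F where "F = (\<lambda>i. insert_index p (f i))"
    define G where "G = (\<lambda>i. insert_index q (g i))"
    have minor: "mat j j (\<lambda>(a, b). mat_delete E p q $$ (f a, g b)) = mat j j (\<lambda>(a, b). E $$ (F a, G b))"
    proof (rule eq_matI, goal_cases)
      case (1 a b)
      hence a: "a < j" and b: "b < j" by simp_all
      have "f a \<le> ?e a" "?e a < r" "g b < r" using fg(1) er a b by blast+
      hence f: "f a < r" and g: "g b < r" by simp_all
      have q: "q < Suc r" using qp by simp
      have "E $$ (F a, G b) = mat_delete E p q $$ (f a, g b)" unfolding F_def G_def
        by (rule mat_delete_index[OF Suc.prems(1) qp(3) q f g])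
      thus ?case using a b by simp
    qed simp_all
    have bounds: "\<forall>i<j. F i \<le> e i \<and> e i \<le> G i \<and> G i < Suc r"
    proof (intro allI impI)
      fix i assume i: "i < j"
      have fgi: "f i \<le> ?e i" "?e i \<le> g i" "g i < r" using fg(1) i by blast+
      have "F i \<le> e i"
        using insert_index_mono2[OF fgi(1) qp(2)] unfolding F_def e[OF i] .
      moreover have "e i \<le> G i"
        using insert_index_mono2[OF fgi(2) qp(1)] unfolding G_def e[OF i] .
      moreover have "G i < Suc r" using fgi(3) unfolding G_def insert_index_def by simp
      ultimately show "F i \<le> e i \<and> e i \<le> G i \<and> G i < Suc r" by blast
    qed
    have "det (mat j j (\<lambda>(a, b). E $$ (F a, G b))) \<noteq> 0"
      using fg(2) unfolding minor .
    thus ?thesis using bounds by (intro exI[of _ F] exI[of _ G]) simp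
  qed
qed

section \<open>Homogeneous substitution\<close>

alias smult = Polynomial.smult
alias order = Polynomial.order
alias degree = Polynomial.degree
alias coeff = Polynomial.coeff
alias monom = Polynomial.monom

text \<open>
  This is \<open>B\<^sup>n p(A / B)\<close>, the homogenization of \<open>p\<close> in formal degree \<open>n\<close> at the pair \<open>(A, B)\<close>. It is
  multiplicative when formal degrees are added. The pair \<open>(1, t)\<close> gives the reversal.
\<close>

definition moebius :: "nat \<Rightarrow> 'a::field poly \<Rightarrow> 'a poly \<Rightarrow> 'a poly \<Rightarrow> 'a poly" where
  "moebius n A B p = (\<Sum>i\<le>n. smult (coeff p i) (A ^ i * B ^ (n - i)))"

lemma moebius_0 [simp]: "moebius n A B 0 = 0"
  by (simp add: moebius_def)

lemma moebius_add: "moebius n A B (p + q) = moebius n A B p + moebius n A B q"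
  by (simp add: moebius_def smult_add_left sum.distrib)

lemma moebius_sum: "moebius n A B (\<Sum>x\<in>S. p x) = (\<Sum>x\<in>S. moebius n A B (p x))"
  by (induction S rule: infinite_finite_induct) (auto simp: moebius_add)

lemma smult_sum_right: "smult c (\<Sum>x\<in>S. p x) = (\<Sum>x\<in>S. smult c (p x))"
  by (induction S rule: infinite_finite_induct) (auto simp: smult_add_right)

lemma moebius_smult: "moebius n A B (smult c p) = smult c (moebius n A B p)"
  unfolding moebius_def smult_sum_right by (rule sum.cong) simp_all

lemma moebius_monom:
  assumes "i \<le> n" shows "moebius n A B (monom c i) = smult c (A ^ i * B ^ (n - i))"
proof -
  have "moebius n A B (monom c i) = (\<Sum>j\<le>n. if j = i then smult c (A ^ i * B ^ (n - i)) else 0)"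
    unfolding moebius_def by (rule sum.cong) auto
  also have "\<dots> = smult c (A ^ i * B ^ (n - i))" using assms by simp
  finally show ?thesis .
qed

lemma moebius_1: "moebius n A B 1 = B ^ n"
  using moebius_monom[of 0 n A B 1] by (simp add: monom_0 one_pCons)

lemma moebius_mult:
  assumes "degree p \<le> n" "degree q \<le> m"
  shows "moebius (n + m) A B (p * q) = moebius n A B p * moebius m A B q"
proof -
  have p: "p = (\<Sum>i\<le>n. monom (coeff p i) i)" and q: "q = (\<Sum>j\<le>m. monom (coeff q j) j)"
    using assms by (simp_all add: poly_as_sum_of_monoms')
  have "p * q = (\<Sum>i\<le>n. \<Sum>j\<le>m. monom (coeff p i * coeff q j) (i + j))"
    by (subst p, subst q, subst sum_product) (simp add: mult_monom)
  hence "moebius (n + m) A B (p * q)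
      = (\<Sum>i\<le>n. \<Sum>j\<le>m. moebius (n + m) A B (monom (coeff p i * coeff q j) (i + j)))"
    by (simp add: moebius_sum)
  also have "\<dots> = (\<Sum>i\<le>n. \<Sum>j\<le>m. smult (coeff p i) (A ^ i * B ^ (n - i)) *
      smult (coeff q j) (A ^ j * B ^ (m - j)))"
  proof (intro sum.cong refl)
    fix i j assume "i \<in> {..n}" "j \<in> {..m}"
    hence "i + j \<le> n + m" and e: "n + m - (i + j) = (n - i) + (m - j)" by auto
    from this(1) show "moebius (n + m) A B (monom (coeff p i * coeff q j) (i + j)) =
        smult (coeff p i) (A ^ i * B ^ (n - i)) * smult (coeff q j) (A ^ j * B ^ (m - j))"
      by (subst moebius_monom) (simp_all add: e power_add mult_ac)
  qed
  also have "\<dots> = moebius n A B p * moebius m A B q"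
    unfolding moebius_def by (simp add: sum_product)
  finally show ?thesis .
qed

lemma moebius_pad:
  assumes "degree p \<le> n" shows "moebius (n + k) A B p = moebius n A B p * B ^ k"
  using moebius_mult[OF assms, of 1 k A B] by (simp add: moebius_1)

lemma degree_prod_le:
  fixes p :: "'i \<Rightarrow> 'a::field poly"
  shows "(\<And>i. i \<in> S \<Longrightarrow> degree (p i) \<le> n i) \<Longrightarrow> degree (\<Prod>i\<in>S. p i) \<le> (\<Sum>i\<in>S. n i)"
proof (induction S rule: infinite_finite_induct)
  case (insert x S)
  have "degree (p x * (\<Prod>i\<in>S. p i)) \<le> degree (p x) + degree (\<Prod>i\<in>S. p i)" by (rule degree_mult_le)
  also have "\<dots> \<le> n x + (\<Sum>i\<in>S. n i)" using insert by (intro add_mono) auto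
  finally show ?case using insert.hyps by simp
qed auto

lemma moebius_prod:
  "(\<And>i. i \<in> S \<Longrightarrow> degree (p i) \<le> n i) \<Longrightarrow>
    moebius (\<Sum>i\<in>S. n i) A B (\<Prod>i\<in>S. p i) = (\<Prod>i\<in>S. moebius (n i) A B (p i))"
proof (induction S rule: infinite_finite_induct)
  case (insert x S)
  have d: "degree (\<Prod>i\<in>S. p i) \<le> (\<Sum>i\<in>S. n i)" using insert.prems by (intro degree_prod_le) auto
  show ?case using insert moebius_mult[OF _ d, of "p x" "n x" A B] by simp
qed (simp_all add: moebius_1)

lemma moebius_power:
  assumes "degree p \<le> 1" shows "moebius k A B (p ^ k) = (moebius 1 A B p) ^ k"
  using moebius_prod[of "{..<k}" "\<lambda>_. p" "\<lambda>_. 1" A B] assms by simp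

lemma degree_power_le1: "degree p \<le> 1 \<Longrightarrow> degree (p ^ k) \<le> k"
  using degree_power_le[of p k] mult_le_mono1[of "degree p" 1 k] by linarith

text \<open>Moebius substitutions compose like the underlying linear maps of pairs \<open>(A, B)\<close>.\<close>

lemma moebius_moebius:
  assumes "degree A' \<le> 1" "degree B' \<le> 1"
  shows "moebius n A B (moebius n A' B' p) = moebius n (moebius 1 A B A') (moebius 1 A B B') p"
proof -
  have "moebius n A B (A' ^ i * B' ^ (n - i)) = moebius 1 A B A' ^ i * moebius 1 A B B' ^ (n - i)"
    if "i \<le> n" for i
    using moebius_mult[OF degree_power_le1[OF assms(1), of i] degree_power_le1[OF assms(2), of "n - i"], of A B]
      that assms by (simp add: moebius_power)
  thus ?thesis unfolding moebius_def[of n A' B'] moebius_sum moebius_smult moebius_def[of n "moebius 1 A B A'"]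
    by (intro sum.cong) simp_all
qed

lemma moebius_linear: "moebius 1 A B [:b, a:] = smult a A + smult b B"
  by (simp add: moebius_def add.commute)

lemma moebius_identity: "degree p \<le> n \<Longrightarrow> moebius n [:0, 1:] 1 p = p"
  unfolding moebius_def
  by (simp add: monom_altdef[symmetric] poly_as_sum_of_monoms')

lemma rev_poly_moebius: "rev_poly n p = moebius n 1 [:0, 1:] p"
  unfolding moebius_def rev_poly_def by (simp add: monom_altdef)

lemma degree_moebius_le:
  assumes "degree A \<le> 1" "degree B \<le> 1" shows "degree (moebius n A B p) \<le> n"
  unfolding moebius_def
proof (rule degree_sum_le)
  fix i assume "i \<in> {..n}"
  hence "i \<le> n" by simp
  have "degree (A ^ i * B ^ (n - i)) \<le> i + (n - i)"
    by (rule order_trans[OF degree_mult_le]) (intro add_mono degree_power_le1 assms)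
  thus "degree (smult (coeff p i) (A ^ i * B ^ (n - i))) \<le> n"
    using \<open>i \<le> n\<close> degree_smult_le[of "coeff p i" "A ^ i * B ^ (n - i)"] by linarith
qed simp

lemma rev_poly_rev_poly:
  assumes "degree p \<le> n" shows "rev_poly n (rev_poly n p) = p"
proof -
  have e: "moebius 1 1 [:0, 1:] 1 = [:0, 1 :: 'a:]" "moebius 1 1 [:0, 1:] [:0, 1:] = (1 :: 'a poly)"
    using moebius_linear[of 1 "[:0, 1 :: 'a:]" 0 1] by (simp_all add: moebius_1)
  have "rev_poly n (rev_poly n p) = moebius n (moebius 1 1 [:0, 1:] 1) (moebius 1 1 [:0, 1:] [:0, 1:]) p"
    unfolding rev_poly_moebius by (rule moebius_moebius) simp_all
  also have "\<dots> = p" unfolding e by (rule moebius_identity[OF assms])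
  finally show ?thesis .
qed

lemma poly_rev_poly_0: "poly (rev_poly n p) 0 = coeff p n"
proof -
  have "poly (rev_poly n p) 0 = (\<Sum>i\<le>n. if i = n then coeff p n else 0)"
    unfolding rev_poly_def poly_sum by (rule sum.cong) (auto simp: poly_monom)
  thus ?thesis by simp
qed

lemma rev_poly_eq_0_iff: "degree p \<le> n \<Longrightarrow> rev_poly n p = 0 \<longleftrightarrow> p = 0"
  using rev_poly_rev_poly[of p n] by (auto simp: rev_poly_moebius)

text \<open>Degree lost with respect to the formal degree becomes order of vanishing of the reversal.\<close>

lemma order_0_rev_poly:
  assumes "p \<noteq> 0" "degree p \<le> n"
  shows "order 0 (rev_poly n p) = n - degree p"
proof -
  let ?d = "degree p"
  have "rev_poly n p = rev_poly ?d p * [:0, 1:] ^ (n - ?d)"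
    using moebius_pad[of p ?d "n - ?d" 1 "[:0, 1:]"] assms unfolding rev_poly_moebius by simp
  moreover have "rev_poly n p \<noteq> 0" using assms rev_poly_eq_0_iff by blast
  moreover have "order 0 (rev_poly ?d p) = 0"
    by (rule order_0I) (simp add: poly_rev_poly_0 assms)
  moreover have "order 0 ([:0, 1 :: 'a:] ^ (n - ?d)) = n - ?d"
    using order_power_n_n[of "0::'a" "n - ?d"] by simp
  ultimately show ?thesis using order_mult[of "rev_poly ?d p" "[:0, 1:] ^ (n - ?d)" 0] by simp
qed

section \<open>Order of vanishing of invariant factors\<close>

lemma order_prod:
  assumes "finite S" "\<And>i. i \<in> S \<Longrightarrow> p i \<noteq> 0"
  shows "order (a::'a::field) (\<Prod>i\<in>S. p i) = (\<Sum>i\<in>S. order a (p i))"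
  using assms
proof (induction S rule: finite_induct)
  case empty
  show ?case by (simp add: order_0I)
next
  case (insert x S)
  have "p x * prod p S \<noteq> 0" using insert by simp
  thus ?case using insert order_mult[of "p x" "prod p S" a] by simp
qed

lemma order_power_eq: "p \<noteq> 0 \<Longrightarrow> order (a::'a::field) (p ^ n) = n * order a p"
  using order_prod[of "{..<n}" "\<lambda>_. p" a] by simp

lemma dvd_imp_order_le': "p dvd q \<Longrightarrow> q \<noteq> 0 \<Longrightarrow> order (a::'a::field) p \<le> order a q"
  by (auto simp: dvd_def order_mult)

lemma det_mat_diag: "det (mat_diag n a) = (\<Prod>i<n. a i)"
proof -
  have "det (mat_diag n a) = prod_list (diag_mat (mat_diag n a))"
    by (rule det_lower_triangular[where n=n]) (auto simp: mat_diag_def)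
  also have "\<dots> = (\<Prod>i<n. a i)"
    by (simp add: prod_list_diag_prod mat_diag_def atLeast0LessThan)
  finally show ?thesis .
qed

lemma prod_initial_dvd_minor:
  fixes a :: "nat \<Rightarrow> 'b::comm_ring_1"
  assumes X: "X \<in> carrier_mat r r" and Y: "Y \<in> carrier_mat r r"
    and chain: "\<And>i k. i \<le> k \<Longrightarrow> k < r \<Longrightarrow> a i dvd a k"
    and fg: "\<And>i. i < j \<Longrightarrow> f i < r" "\<And>i. i < j \<Longrightarrow> g i < r"
  shows "(\<Prod>i<j. a i) dvd det (mat j j (\<lambda>(i, k). (X * mat_diag r a * Y) $$ (f i, g k)))"
proof -
  let ?X = "mat j r (\<lambda>(i, k). X $$ (f i, k))" and ?Y = "mat r j (\<lambda>(i, k). Y $$ (i, g k))"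
  have XD: "X * mat_diag r a = mat r r (\<lambda>(i,k). X $$ (i,k) * a k)"
    by (rule mat_diag_mult_right[OF X])
  have XD': "?X * mat_diag r a = mat j r (\<lambda>(i,k). ?X $$ (i,k) * a k)"
    by (rule mat_diag_mult_right) simp
  have "mat j j (\<lambda>(i, k). (X * mat_diag r a * Y) $$ (f i, g k)) = ?X * mat_diag r a * ?Y"
    unfolding XD XD' by (rule eq_matI) (use X Y fg in \<open>auto simp: scalar_prod_def\<close>)
  moreover have "(\<Prod>i<j. a i) dvd det (?X * mat_diag r a * ?Y)"
    by (rule prod_initial_dvd_det[OF _ _ chain]) auto
  ultimately show ?thesis by simp
qed

text \<open>The leading minor of size \<open>j\<close> of a diagonal matrix is the product of its first \<open>j\<close> entries.\<close>

lemma sum_order_le_of_diag_factorization: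
  fixes \<alpha> \<gamma> :: "nat \<Rightarrow> 'a::field poly"
  assumes X: "X \<in> carrier_mat r r" and Y: "Y \<in> carrier_mat r r"
    and chain: "\<And>i k. i \<le> k \<Longrightarrow> k < r \<Longrightarrow> \<alpha> i dvd \<alpha> k"
    and nz: "\<And>i. i < r \<Longrightarrow> \<alpha> i \<noteq> 0" "\<And>i. i < r \<Longrightarrow> \<gamma> i \<noteq> 0"
    and eq: "w \<cdot>\<^sub>m mat_diag r \<gamma> = X * mat_diag r \<alpha> * Y"
    and w: "w \<noteq> 0" "order a w = 0" and j: "j \<le> r"
  shows "(\<Sum>i<j. order a (\<alpha> i)) \<le> (\<Sum>i<j. order a (\<gamma> i))"
proof -
  have "(\<Prod>i<j. \<alpha> i) dvd det (mat j j (\<lambda>(i, k). (X * mat_diag r \<alpha> * Y) $$ (i, k)))"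
    using j by (intro prod_initial_dvd_minor[OF X Y chain]) auto
  also have "mat j j (\<lambda>(i, k). (X * mat_diag r \<alpha> * Y) $$ (i, k)) = mat_diag j (\<lambda>i. w * \<gamma> i)"
    unfolding eq[symmetric] by (rule eq_matI) (use j in \<open>auto simp: mat_diag_def\<close>)
  finally have dvd: "(\<Prod>i<j. \<alpha> i) dvd (\<Prod>i<j. w * \<gamma> i)" by (simp add: det_mat_diag)
  have nz': "w * \<gamma> i \<noteq> 0" if "i < j" for i using that nz w j by auto
  hence "(\<Prod>i<j. w * \<gamma> i) \<noteq> 0" using prod_zero_iff[of "{..<j}" "\<lambda>i. w * \<gamma> i"] by blast
  from dvd_imp_order_le'[OF dvd this, of a]
  have "(\<Sum>i<j. order a (\<alpha> i)) \<le> (\<Sum>i<j. order a (w * \<gamma> i))"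
    using nz j nz' by (subst (asm) (1 2) order_prod) auto
  also have "(\<Sum>i<j. order a (w * \<gamma> i)) = (\<Sum>i<j. order a (\<gamma> i))"
    using nz' w by (intro sum.cong) (auto simp: order_mult)
  finally show ?thesis .
qed

lemma mult_smult_one_mat:
  fixes A :: "'b::comm_ring_1 mat"
  assumes "A \<in> carrier_mat n n"
  shows "A * (c \<cdot>\<^sub>m 1\<^sub>m n) = c \<cdot>\<^sub>m A" "(c \<cdot>\<^sub>m 1\<^sub>m n) * A = c \<cdot>\<^sub>m A"
  using assms by (auto simp: mult_smult_distrib[of _ n n] mult_smult_assoc_mat[of _ n n])

text \<open>
  If \<open>M = X D Y\<close> then \<open>adj X M adj Y = det X det Y D\<close>, so that such a relation between square
  matrices can be reversed at the cost of a scalar.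
\<close>

lemma adjugate_reverses_factorization:
  fixes X :: "'b::comm_ring_1 mat"
  assumes c: "X \<in> carrier_mat r r" "D \<in> carrier_mat r r" "Y \<in> carrier_mat r r"
  shows "adj_mat X * (X * D * Y) * adj_mat Y = (det X * det Y) \<cdot>\<^sub>m D"
proof -
  note a = adj_mat[OF c(1)] adj_mat[OF c(3)]
  have "adj_mat X * (X * D * Y) * adj_mat Y = (adj_mat X * X) * (D * (Y * adj_mat Y))"
    using c a(1,4) by (simp add: assoc_mult_mat[of _ r r _ r _ r])
  also have "\<dots> = (det X \<cdot>\<^sub>m 1\<^sub>m r) * (det Y \<cdot>\<^sub>m D)"
    unfolding a(3,5) using mult_smult_one_mat(1)[OF c(2)] by simp
  also have "\<dots> = det X \<cdot>\<^sub>m (det Y \<cdot>\<^sub>m D)"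
    using c(2) by (intro mult_smult_one_mat(2)) simp
  also have "\<dots> = (det X * det Y) \<cdot>\<^sub>m D" by (rule eq_matI) (auto simp: mult.assoc)
  finally show ?thesis .
qed

text \<open>
  One inequality between the partial sums of the orders comes from minors. Equality of the
  totals forces \<open>det X\<close> and \<open>det Y\<close> to have order zero at \<open>a\<close>, so that the relation can be
  reversed by adjugates and yields the other inequality.
\<close>

lemma orders_eq_of_diag_factorization:
  fixes \<alpha> \<gamma> :: "nat \<Rightarrow> 'a::field poly"
  assumes X: "X \<in> carrier_mat r r" and Y: "Y \<in> carrier_mat r r"
    and chain\<alpha>: "\<And>i k. i \<le> k \<Longrightarrow> k < r \<Longrightarrow> \<alpha> i dvd \<alpha> k"
    and chain\<gamma>: "\<And>i k. i \<le> k \<Longrightarrow> k < r \<Longrightarrow> \<gamma> i dvd \<gamma> k"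
    and nz: "\<And>i. i < r \<Longrightarrow> \<alpha> i \<noteq> 0" "\<And>i. i < r \<Longrightarrow> \<gamma> i \<noteq> 0"
    and eq: "w \<cdot>\<^sub>m mat_diag r \<gamma> = X * mat_diag r \<alpha> * Y"
    and w: "w \<noteq> 0" "order a w = 0"
    and total: "(\<Sum>i<r. order a (\<alpha> i)) = (\<Sum>i<r. order a (\<gamma> i))" and i: "i < r"
  shows "order a (\<alpha> i) = order a (\<gamma> i)"
proof -
  have dc: "mat_diag r \<alpha> \<in> carrier_mat r r" "mat_diag r \<gamma> \<in> carrier_mat r r" by (auto simp: mat_diag_def)
  let ?c = "det X * det Y"
  have "det (w \<cdot>\<^sub>m mat_diag r \<gamma>) = det X * (\<Prod>i<r. \<alpha> i) * det Y"
    unfolding eq using X Y dc by (simp add: det_mult[of _ r] det_mat_diag)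
  hence d: "w ^ r * (\<Prod>i<r. \<gamma> i) = ?c * (\<Prod>i<r. \<alpha> i)"
    using dc by (simp add: det_mat_diag mult_ac)
  have n\<gamma>: "(\<Prod>i<r. \<gamma> i) \<noteq> 0" and n\<alpha>: "(\<Prod>i<r. \<alpha> i) \<noteq> 0" using nz by auto
  have c0: "?c \<noteq> 0" using d n\<gamma> w by force
  have "order a (w ^ r) + order a (\<Prod>i<r. \<gamma> i) = order a ?c + order a (\<Prod>i<r. \<alpha> i)"
  proof -
    have 1: "w ^ r * (\<Prod>i<r. \<gamma> i) \<noteq> 0" and 2: "?c * (\<Prod>i<r. \<alpha> i) \<noteq> 0"
      using n\<gamma> n\<alpha> w c0 by simp_all
    show ?thesis using arg_cong[OF d, of "order a"] unfolding order_mult[OF 1] order_mult[OF 2] .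
  qed
  hence oc: "order a ?c = 0"
    using total w order_prod[of "{..<r}" \<gamma> a, OF _ nz(2)] order_prod[of "{..<r}" \<alpha> a, OF _ nz(1)]
    by (simp add: order_power_eq)
  have adj: "adj_mat X \<in> carrier_mat r r" "adj_mat Y \<in> carrier_mat r r" using adj_mat X Y by auto
  have "?c \<cdot>\<^sub>m mat_diag r \<alpha> = adj_mat X * (w \<cdot>\<^sub>m mat_diag r \<gamma>) * adj_mat Y"
    unfolding eq adjugate_reverses_factorization[OF X dc(1) Y] ..
  also have "\<dots> = (w \<cdot>\<^sub>m adj_mat X) * mat_diag r \<gamma> * adj_mat Y"
    using adj dc by (simp add: mult_smult_distrib[of _ r r _ r] mult_smult_assoc_mat[of _ r r _ r])
  finally have rev: "?c \<cdot>\<^sub>m mat_diag r \<alpha> = (w \<cdot>\<^sub>m adj_mat X) * mat_diag r \<gamma> * adj_mat Y" .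
  have partial: "(\<Sum>i<j. order a (\<alpha> i)) = (\<Sum>i<j. order a (\<gamma> i))" if "j \<le> r" for j
  proof (rule antisym)
    show "(\<Sum>i<j. order a (\<alpha> i)) \<le> (\<Sum>i<j. order a (\<gamma> i))"
      by (rule sum_order_le_of_diag_factorization[OF X Y chain\<alpha> nz eq w that])
    show "(\<Sum>i<j. order a (\<gamma> i)) \<le> (\<Sum>i<j. order a (\<alpha> i))"
      by (rule sum_order_le_of_diag_factorization[OF _ adj(2) chain\<gamma> nz(2,1) rev c0 oc that])
        (use adj in auto)
  qed
  show ?thesis using partial[of i] partial[of "Suc i"] i by simp
qed

text \<open>Over an algebraically closed field divisibility is decided root by root.\<close>

lemma dvd_of_order_le:
  fixes p q :: "'a::field poly"
  assumes "is_alg_closed TYPE('a)" and "p \<noteq> 0" "q \<noteq> 0" and "\<And>a. order a p \<le> order a q"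
  shows "p dvd q"
  using assms(2-)
proof (induction "degree p" arbitrary: p q)
  case 0
  hence "is_unit p" by (simp add: is_unit_iff_degree)
  thus ?case by (rule unit_imp_dvd)
next
  case (Suc n)
  from assms(1) Suc.hyps(2) obtain a where "poly p a = 0"
    unfolding is_alg_closed_def by force
  then obtain p' where p: "p = [:-a, 1:] * p'" unfolding poly_eq_0_iff_dvd by (elim dvdE)
  have "order a p \<noteq> 0" using \<open>poly p a = 0\<close> Suc.prems(1) by (simp add: order_root)
  hence "order a q \<noteq> 0" using Suc.prems(3)[of a] by simp
  hence "poly q a = 0" by (simp add: order_root)
  then obtain q' where q: "q = [:-a, 1:] * q'" unfolding poly_eq_0_iff_dvd by (elim dvdE)
  have nz: "p' \<noteq> 0" "q' \<noteq> 0" using p q Suc.prems by auto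
  have "degree p = Suc (degree p')" unfolding p using nz by (subst degree_mult_eq) auto
  hence n: "n = degree p'" using Suc.hyps(2) by simp
  have "order b p' \<le> order b q'" for b
  proof -
    have "order b p = order b [:-a, 1:] + order b p'" "order b q = order b [:-a, 1:] + order b q'"
      unfolding p q by (rule order_mult, use nz in \<open>simp only: mult_eq_0_iff pCons_eq_0_iff, simp\<close>)+
    thus ?thesis using Suc.prems(3)[of b] by simp
  qed
  from Suc.hyps(1)[OF n nz this] show ?case unfolding p q by (rule mult_dvd_mono[OF dvd_refl])
qed

section \<open>The Smith form of a polynomial matrix\<close>

definition unimodular :: "nat \<Rightarrow> 'a::field poly mat \<Rightarrow> bool" where
  "unimodular n U \<longleftrightarrow> U \<in> carrier_mat n n \<and> det U dvd 1"

lemma unimodular_one: "unimodular n (1\<^sub>m n)"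
  by (simp add: unimodular_def)

lemma unimodular_mult: "unimodular n U \<Longrightarrow> unimodular n V \<Longrightarrow> unimodular n (U * V)"
  by (auto simp: unimodular_def det_mult[of _ n])

lemma unimodular_transpose: "unimodular n U \<Longrightarrow> unimodular n U\<^sup>T"
  by (auto simp: unimodular_def det_transpose)

lemma unimodular_inverse:
  assumes "unimodular n U"
  obtains W where "W \<in> carrier_mat n n" "U * W = 1\<^sub>m n" "W * U = 1\<^sub>m n"
proof -
  have U: "U \<in> carrier_mat n n" using assms by (simp add: unimodular_def)
  obtain v where v: "1 = det U * v" using assms unfolding unimodular_def by (elim conjE dvdE)
  note adj = adj_mat[OF U]
  have one: "v \<cdot>\<^sub>m (det U \<cdot>\<^sub>m 1\<^sub>m n) = 1\<^sub>m n"
    by (rule eq_matI) (use v in \<open>auto simp: mult.commute\<close>)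
  show ?thesis
  proof (rule that[of "v \<cdot>\<^sub>m adj_mat U"])
    show "v \<cdot>\<^sub>m adj_mat U \<in> carrier_mat n n" using adj by simp
    show "U * (v \<cdot>\<^sub>m adj_mat U) = 1\<^sub>m n"
      using adj U one by (simp add: mult_smult_distrib[of _ n n _ n])
    show "v \<cdot>\<^sub>m adj_mat U * U = 1\<^sub>m n"
      using adj U one by (simp add: mult_smult_assoc_mat[of _ n n _ n])
  qed
qed

lemma unimodular_imp_invertible_mat: "unimodular n U \<Longrightarrow> invertible_mat U"
proof -
  assume U: "unimodular n U"
  then obtain W where "W \<in> carrier_mat n n" "U * W = 1\<^sub>m n" "W * U = 1\<^sub>m n"
    by (rule unimodular_inverse)
  thus ?thesis using U unfolding invertible_mat_def inverts_mat_def unimodular_def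
    by (auto intro!: exI[of _ W])
qed

lemma invertible_mat_imp_unimodular:
  assumes U: "U \<in> carrier_mat n n" and "invertible_mat U"
  shows "unimodular n U"
proof -
  obtain W where W: "U * W = 1\<^sub>m (dim_row U)" "W * U = 1\<^sub>m (dim_row W)"
    using assms(2) unfolding invertible_mat_def inverts_mat_def by blast
  have "dim_col (U * W) = n" unfolding W(1) using U by simp
  moreover have "dim_row W = n" using arg_cong[OF W(2), of dim_col] U by simp
  ultimately have Wc: "W \<in> carrier_mat n n" by auto
  have "det U * det W = 1" using det_mult[OF U Wc] W(1) U by simp
  thus ?thesis using U unfolding unimodular_def by (metis dvd_triv_left)
qed

lemma unimodular_of_triangular:
  assumes "\<And>i j. i < j \<Longrightarrow> j < n \<Longrightarrow> f i j = 0" "\<And>i. i < n \<Longrightarrow> f i i = 1"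
  shows "unimodular n (mat n n (\<lambda>(i, j). f i j))"
proof -
  have "det (mat n n (\<lambda>(i, j). f i j)) = prod_list (diag_mat (mat n n (\<lambda>(i, j). f i j)))"
    by (rule det_lower_triangular[where n=n]) (use assms in auto)
  also have "\<dots> = 1" using assms(2) by (simp add: prod_list_diag_prod)
  finally show ?thesis by (simp add: unimodular_def)
qed

definition smith_equiv :: "nat \<Rightarrow> nat \<Rightarrow> 'a::field poly mat \<Rightarrow> 'a poly mat \<Rightarrow> bool" where
  "smith_equiv m n A B \<longleftrightarrow> A \<in> carrier_mat m n \<and>
     (\<exists>U V. unimodular m U \<and> unimodular n V \<and> B = U * A * V)"

lemma smith_equiv_carrier: "smith_equiv m n A B \<Longrightarrow> A \<in> carrier_mat m n \<and> B \<in> carrier_mat m n"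
  by (auto simp: smith_equiv_def unimodular_def)

lemma smith_equivI:
  "A \<in> carrier_mat m n \<Longrightarrow> unimodular m U \<Longrightarrow> unimodular n V \<Longrightarrow> B = U * A * V \<Longrightarrow> smith_equiv m n A B"
  unfolding smith_equiv_def by blast

lemma smith_equiv_left: "A \<in> carrier_mat m n \<Longrightarrow> unimodular m U \<Longrightarrow> smith_equiv m n A (U * A)"
  by (rule smith_equivI[OF _ _ unimodular_one]) (auto simp: unimodular_def)

lemma smith_equiv_refl: "A \<in> carrier_mat m n \<Longrightarrow> smith_equiv m n A A"
  using smith_equiv_left[OF _ unimodular_one, of A m n] by simp

lemma smith_equiv_trans:
  assumes "smith_equiv m n A B" "smith_equiv m n B C" shows "smith_equiv m n A C"
proof -
  obtain U V where 1: "A \<in> carrier_mat m n" "unimodular m U" "unimodular n V" "B = U * A * V"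
    using assms(1) unfolding smith_equiv_def by blast
  obtain U' V' where 2: "unimodular m U'" "unimodular n V'" "C = U' * B * V'"
    using assms(2) unfolding smith_equiv_def by blast
  have c: "U \<in> carrier_mat m m" "U' \<in> carrier_mat m m" "V \<in> carrier_mat n n" "V' \<in> carrier_mat n n"
    using 1 2 by (auto simp: unimodular_def)
  have "C = (U' * U) * A * (V * V')" unfolding 2(3) 1(4) using c 1(1)
    by (simp add: assoc_mult_mat[of _ m m _ n _ n] assoc_mult_mat[of _ m m _ m _ n]
        assoc_mult_mat[of _ m n _ n _ n])
  thus ?thesis using smith_equivI[OF 1(1) unimodular_mult[OF 2(1) 1(2)] unimodular_mult[OF 1(3) 2(2)]] by blast
qed

lemma smith_equiv_transpose:
  assumes "smith_equiv m n A B" shows "smith_equiv n m A\<^sup>T B\<^sup>T"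
proof -
  obtain U V where 1: "A \<in> carrier_mat m n" "unimodular m U" "unimodular n V" "B = U * A * V"
    using assms unfolding smith_equiv_def by blast
  have c: "U \<in> carrier_mat m m" "V \<in> carrier_mat n n" using 1 by (auto simp: unimodular_def)
  have "B\<^sup>T = V\<^sup>T * A\<^sup>T * U\<^sup>T" unfolding 1(4) using c 1(1)
    by (simp add: transpose_mult[of _ m n _ n] transpose_mult[of _ m m _ n] assoc_mult_mat[of _ n n _ m _ m])
  thus ?thesis using 1 by (intro smith_equivI[where U="V\<^sup>T" and V="U\<^sup>T"]) (auto intro: unimodular_transpose)
qed

lemma smith_equiv_addrow:
  assumes "A \<in> carrier_mat m n" "k \<noteq> l" "l < m"
  shows "smith_equiv m n A (addrow c k l A)"
  unfolding addrow_mat[OF assms(1,3)]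
  by (rule smith_equiv_left[OF assms(1)]) (simp add: unimodular_def det_addrow_mat[OF assms(2)])

lemma smith_equiv_swaprows:
  assumes A: "A \<in> carrier_mat m n" and "k < m" "l < m"
  shows "smith_equiv m n A (swaprows k l A)"
proof (cases "k = l")
  case True
  have "swaprows k l A = A" by (rule eq_matI) (auto simp: True)
  thus ?thesis using smith_equiv_refl[OF A] by simp
next
  case False
  show ?thesis unfolding swaprows_mat[OF assms]
    by (rule smith_equiv_left[OF A]) (simp add: unimodular_def det_swaprows_mat[OF assms(2,3) False])
qed

lemma smith_equiv_clear_column:
  assumes A: "A \<in> carrier_mat m n" and m: "0 < m"
  shows "smith_equiv m n A (mat m n (\<lambda>(i, j). if i = 0 then A $$ (0, j) else A $$ (i, j) - q i * A $$ (0, j)))"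
proof -
  let ?f = "\<lambda>i j. if i = j then 1 else if j = 0 then - q i else 0"
  let ?U = "mat m m (\<lambda>(i, j). ?f i j)"
  have U: "unimodular m ?U" by (rule unimodular_of_triangular) auto
  have "(?U * A) $$ (i, j) = (if i = 0 then A $$ (0, j) else A $$ (i, j) - q i * A $$ (0, j))"
    if i: "i < m" and j: "j < n" for i j
  proof -
    have "(?U * A) $$ (i, j) = (\<Sum>k\<in>{0..<m}. ?f i k * A $$ (k, j))"
      using i j A by (simp add: scalar_prod_def)
    also have "\<dots> = (\<Sum>k\<in>{0..<m}. (if k = i then A $$ (i, j) else 0) +
        (if k = 0 then (if i = 0 then 0 else - q i * A $$ (0, j)) else 0))"
      by (rule sum.cong) auto
    also have "\<dots> = A $$ (i, j) + (if i = 0 then 0 else - q i * A $$ (0, j))"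
      using i m by (simp add: sum.distrib)
    finally show ?thesis by auto
  qed
  hence "mat m n (\<lambda>(i, j). if i = 0 then A $$ (0, j) else A $$ (i, j) - q i * A $$ (0, j)) = ?U * A"
    using A by (intro eq_matI) auto
  thus ?thesis using smith_equiv_left[OF A U] by simp
qed

text \<open>
  Euclidean division would otherwise create an entry of smaller degree, so a corner of least
  degree divides its column.
\<close>

lemma minimal_corner_dvd_column:
  assumes min: "\<And>B i j. smith_equiv m n A B \<Longrightarrow> i < m \<Longrightarrow> j < n \<Longrightarrow> B $$ (i, j) \<noteq> 0 \<Longrightarrow>
      degree g \<le> degree (B $$ (i, j))"
    and B: "smith_equiv m n A B" and n: "0 < n" and g: "B $$ (0, 0) = g" "g \<noteq> 0" and i: "i < m"
  shows "g dvd B $$ (i, 0)"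
proof (rule ccontr)
  assume nd: "\<not> g dvd B $$ (i, 0)"
  hence i0: "i \<noteq> 0" using g by (cases "i = 0") auto
  have Bc: "B \<in> carrier_mat m n" using smith_equiv_carrier[OF B] by simp
  let ?C = "addrow (- (B $$ (i, 0) div g)) i 0 B"
  have C: "smith_equiv m n A ?C"
    by (rule smith_equiv_trans[OF B smith_equiv_addrow[OF Bc i0]]) (use i in simp)
  have e: "?C $$ (i, 0) = B $$ (i, 0) mod g"
    using Bc i n g by (simp add: minus_div_mult_eq_mod[symmetric])
  have nz: "B $$ (i, 0) mod g \<noteq> 0" using nd by (simp add: mod_eq_0_iff_dvd)
  have "degree g \<le> degree (B $$ (i, 0) mod g)" using min[OF C i n] e nz by simp
  moreover have "degree (B $$ (i, 0) mod g) < degree g" using degree_mod_less[OF g(2), of "B $$ (i, 0)"] nz by blast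
  ultimately show False by simp
qed

lemma minimal_corner_dvd_row:
  assumes min: "\<And>B i j. smith_equiv m n A B \<Longrightarrow> i < m \<Longrightarrow> j < n \<Longrightarrow> B $$ (i, j) \<noteq> 0 \<Longrightarrow>
      degree g \<le> degree (B $$ (i, j))"
    and B: "smith_equiv m n A B" and m: "0 < m" and g: "B $$ (0, 0) = g" "g \<noteq> 0" and j: "j < n"
  shows "g dvd B $$ (0, j)"
proof -
  have c: "B \<in> carrier_mat m n" "A \<in> carrier_mat m n" using smith_equiv_carrier[OF B] by auto
  have "g dvd B\<^sup>T $$ (j, 0)"
  proof (rule minimal_corner_dvd_column[OF _ smith_equiv_transpose[OF B] m _ g(2) j])
    fix B' i j assume B': "smith_equiv n m A\<^sup>T B'" and ij: "i < n" "j < m" "B' $$ (i, j) \<noteq> 0"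
    have c': "B' \<in> carrier_mat n m" using smith_equiv_carrier[OF B'] by simp
    have "smith_equiv m n A B'\<^sup>T" using smith_equiv_transpose[OF B'] c by simp
    from min[OF this ij(2,1)] show "degree g \<le> degree (B' $$ (i, j))" using c' ij by simp
  qed (use c m j g in auto)
  thus ?thesis using c m j by simp
qed

text \<open>
  An entry of least degree among all equivalent matrices is moved to the corner, which divides
  and hence clears its column and row. Adding a later row to the first one produces another
  equivalent matrix with the same corner, so the corner divides all remaining entries as well.
\<close>

lemma smith_reduction_step:
  fixes A :: "'a::field poly mat"
  assumes A: "A \<in> carrier_mat (Suc m) (Suc n)" and nz: "A \<noteq> 0\<^sub>m (Suc m) (Suc n)"
  obtains C g where "smith_equiv (Suc m) (Suc n) A C" "g \<noteq> 0" "C $$ (0, 0) = g"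
    "\<And>i. i < m \<Longrightarrow> C $$ (Suc i, 0) = 0" "\<And>j. j < n \<Longrightarrow> C $$ (0, Suc j) = 0"
    "\<And>i j. i < m \<Longrightarrow> j < n \<Longrightarrow> g dvd C $$ (Suc i, Suc j)"
proof -
  let ?m = "Suc m" and ?n = "Suc n"
  let ?P = "\<lambda>d. \<exists>B i j. smith_equiv ?m ?n A B \<and> i < ?m \<and> j < ?n \<and> B $$ (i, j) \<noteq> 0 \<and> degree (B $$ (i, j)) = d"
  have "\<exists>i j. i < ?m \<and> j < ?n \<and> A $$ (i, j) \<noteq> 0"
  proof (rule ccontr)
    assume "\<not> ?thesis"
    hence "A = 0\<^sub>m ?m ?n" using A by (intro eq_matI) auto
    thus False using nz by simp
  qed
  then obtain i j where ij: "i < ?m" "j < ?n" "A $$ (i, j) \<noteq> 0" by blast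
  have ex: "\<exists>d. ?P d" using ij smith_equiv_refl[OF A] by blast
  define d where "d = (LEAST d. ?P d)"
  have "?P d" unfolding d_def using ex by (rule LeastI_ex)
  then obtain B i j where B: "smith_equiv ?m ?n A B" "i < ?m" "j < ?n" "B $$ (i, j) \<noteq> 0"
    "degree (B $$ (i, j)) = d" by blast
  have min: "d \<le> degree (B $$ (i, j))"
    if "smith_equiv ?m ?n A B" "i < ?m" "j < ?n" "B $$ (i, j) \<noteq> 0" for B i j
    unfolding d_def by (rule Least_le) (use that in blast)
  have Bc: "B \<in> carrier_mat ?m ?n" using smith_equiv_carrier[OF B(1)] by simp
  define B1 where "B1 = swaprows 0 i B"
  have B1: "smith_equiv ?m ?n A B1" "B1 \<in> carrier_mat ?m ?n"
    unfolding B1_def using smith_equiv_trans[OF B(1) smith_equiv_swaprows[OF Bc, of 0 i]] B(2) Bc by auto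
  define B2 where "B2 = (swaprows 0 j B1\<^sup>T)\<^sup>T"
  have "smith_equiv ?n ?m B1\<^sup>T (swaprows 0 j B1\<^sup>T)"
    by (rule smith_equiv_swaprows) (use B1 B(3) in auto)
  from smith_equiv_transpose[OF this] have B2: "smith_equiv ?m ?n A B2" "B2 \<in> carrier_mat ?m ?n"
    unfolding B2_def using smith_equiv_trans[OF B1(1)] B1(2) by auto
  define g where "g = B2 $$ (0, 0)"
  have gB: "g = B $$ (i, j)" unfolding g_def B2_def using B1(2) B(2,3) Bc by (auto simp: B1_def)
  have g0: "g \<noteq> 0" using gB B(4) by simp
  have min': "degree g \<le> degree (B $$ (i, j))"
    if "smith_equiv ?m ?n A B" "i < ?m" "j < ?n" "B $$ (i, j) \<noteq> 0" for B i j
    using min[OF that] gB B(5) by simp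
  define B3 where "B3 = mat ?m ?n (\<lambda>(i, j). if i = 0 then B2 $$ (0, j)
      else B2 $$ (i, j) - (B2 $$ (i, 0) div g) * B2 $$ (0, j))"
  have B3: "smith_equiv ?m ?n A B3" "B3 \<in> carrier_mat ?m ?n"
    using smith_equiv_trans[OF B2(1) smith_equiv_clear_column[OF B2(2)]] unfolding B3_def by auto
  have B3_00: "B3 $$ (0, 0) = g" by (simp add: B3_def g_def)
  have col0: "B3 $$ (i, 0) = 0" if "0 < i" "i < ?m" for i
    using minimal_corner_dvd_column[OF min' B2(1) _ g_def[symmetric] g0 that(2)] that
    by (simp add: B3_def g_def)
  define C where "C = (mat ?n ?m (\<lambda>(i, j). if i = 0 then B3\<^sup>T $$ (0, j)
      else B3\<^sup>T $$ (i, j) - (B3\<^sup>T $$ (i, 0) div g) * B3\<^sup>T $$ (0, j)))\<^sup>T"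
  have "smith_equiv ?n ?m B3\<^sup>T C\<^sup>T"
    unfolding C_def transpose_transpose by (rule smith_equiv_clear_column) (use B3 in auto)
  from smith_equiv_transpose[OF this] have C: "smith_equiv ?m ?n A C"
    using smith_equiv_trans[OF B3(1)] B3(2) by auto
  have Cc: "C \<in> carrier_mat ?m ?n" using smith_equiv_carrier[OF C] by simp
  have C00: "C $$ (0, 0) = g" using B3(2) B3_00 by (simp add: C_def)
  have Ccol: "C $$ (Suc i, 0) = 0" if "i < m" for i
    using that B3(2) col0[of "Suc i"] by (simp add: C_def)
  have Crow: "C $$ (0, Suc j) = 0" if "j < n" for j
    using minimal_corner_dvd_row[OF min' B3(1) _ B3_00 g0, of "Suc j"] that B3(2) B3_00 by (simp add: C_def)
  have "g dvd C $$ (Suc i, Suc j)" if ij: "i < m" "j < n" for i j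
  proof -
    let ?D = "addrow 1 0 (Suc i) C"
    have D: "smith_equiv ?m ?n A ?D"
      by (rule smith_equiv_trans[OF C smith_equiv_addrow[OF Cc]]) (use ij in auto)
    have "g dvd ?D $$ (0, Suc j)"
      by (rule minimal_corner_dvd_row[OF min' D]) (use Cc C00 Ccol ij g0 in auto)
    thus ?thesis using Cc Crow[OF ij(2)] ij by simp
  qed
  from that[OF C g0 C00 Ccol Crow this] show ?thesis by blast
qed

lemma dvd_entries_mult:
  fixes A B :: "'b::comm_semiring_1 mat"
  assumes c: "A \<in> carrier_mat m n" "B \<in> carrier_mat n k"
    and "(\<forall>i<m. \<forall>j<n. g dvd A $$ (i, j)) \<or> (\<forall>i<n. \<forall>j<k. g dvd B $$ (i, j))" and "i < m" "j < k"
  shows "g dvd (A * B) $$ (i, j)"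
proof -
  have "(A * B) $$ (i, j) = (\<Sum>l\<in>{0..<n}. A $$ (i, l) * B $$ (l, j))"
    using assms by (simp add: scalar_prod_def)
  also have "g dvd \<dots>" by (rule dvd_sum) (use assms in auto)
  finally show ?thesis .
qed

definition corner_mat :: "'b::comm_ring_1 \<Rightarrow> 'b mat \<Rightarrow> 'b mat" where
  "corner_mat g M = four_block_mat (mat 1 1 (\<lambda>_. g)) (0\<^sub>m 1 (dim_col M)) (0\<^sub>m (dim_row M) 1) M"

lemma dim_corner_mat [simp]:
  "dim_row (corner_mat g M) = Suc (dim_row M)" "dim_col (corner_mat g M) = Suc (dim_col M)"
  by (simp_all add: corner_mat_def)

lemma index_corner_mat:
  "i < Suc (dim_row M) \<Longrightarrow> j < Suc (dim_col M) \<Longrightarrow> corner_mat g M $$ (i, j) =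
    (case i of 0 \<Rightarrow> (case j of 0 \<Rightarrow> g | Suc _ \<Rightarrow> 0) | Suc i' \<Rightarrow> (case j of 0 \<Rightarrow> 0 | Suc j' \<Rightarrow> M $$ (i', j')))"
  by (auto simp: corner_mat_def split: nat.split)

lemma corner_mat_mult:
  assumes "U \<in> carrier_mat m k" "M \<in> carrier_mat k n"
  shows "corner_mat u U * corner_mat g M = corner_mat (u * g) (U * M)"
proof -
  have "mat 1 1 (\<lambda>_. u) * mat 1 1 (\<lambda>_. g) = mat 1 1 (\<lambda>_. u * g)"
    by (rule eq_matI) (auto simp: scalar_prod_def)
  thus ?thesis using assms unfolding corner_mat_def
    by (subst mult_four_block_mat[of _ 1 1 _ k _ m _ _ 1 _ n]) auto
qed

lemma unimodular_corner_mat: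
  assumes "u dvd 1" "unimodular m U" shows "unimodular (Suc m) (corner_mat u U)"
proof -
  have U: "U \<in> carrier_mat m m" using assms by (simp add: unimodular_def)
  have "det (mat 1 1 (\<lambda>_. u)) = u"
    using det_lower_triangular[of 1 "mat 1 1 (\<lambda>_. u)"] by (simp add: prod_list_diag_prod)
  hence "det (corner_mat u U) = u * det U" unfolding corner_mat_def
    using U by (subst det_four_block_mat_lower_left_zero[of _ 1 _ m]) auto
  thus ?thesis using assms U unfolding unimodular_def
    by (metis carrier_matD carrier_matI dim_corner_mat is_unit_mult_iff)
qed

theorem smith_form_exists:
  fixes A :: "'a::field poly mat"
  assumes "A \<in> carrier_mat m n"
  shows "\<exists>\<gamma>s. length \<gamma>s \<le> min m n \<and> (\<forall>\<gamma>\<in>set \<gamma>s. lead_coeff \<gamma> = 1) \<and> sorted_wrt (dvd) \<gamma>s \<and>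
    smith_equiv m n A (diag_rect_mat m n \<gamma>s)"
  using assms
proof (induction m arbitrary: n A)
  have zero: "\<exists>\<gamma>s. length \<gamma>s \<le> min m n \<and> (\<forall>\<gamma>\<in>set \<gamma>s. lead_coeff \<gamma> = 1) \<and> sorted_wrt (dvd) \<gamma>s \<and>
    smith_equiv m n A (diag_rect_mat m n \<gamma>s)" if "A = 0\<^sub>m m n" for m n and A :: "'a poly mat"
  proof -
    have "diag_rect_mat m n [] = A" unfolding that by (rule eq_matI) (auto simp: diag_rect_mat_def)
    thus ?thesis using smith_equiv_refl[of A m n] that by (intro exI[of _ "[]"]) simp
  qed
  {
    case (0 n A)
    show ?case by (rule zero) (use 0 in auto)
  next
    case (Suc m n A)
    show ?case
    proof (cases "A = 0\<^sub>m (Suc m) n")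
      case True thus ?thesis by (rule zero)
    next
      case False
      obtain n' where n: "n = Suc n'" using False Suc.prems by (cases n) auto
      obtain C g where C: "smith_equiv (Suc m) (Suc n') A C" and g: "g \<noteq> 0" "C $$ (0, 0) = g"
        and Ccol: "\<And>i. i < m \<Longrightarrow> C $$ (Suc i, 0) = 0" and Crow: "\<And>j. j < n' \<Longrightarrow> C $$ (0, Suc j) = 0"
        and Cdvd: "\<And>i j. i < m \<Longrightarrow> j < n' \<Longrightarrow> g dvd C $$ (Suc i, Suc j)"
        using smith_reduction_step[of A m n'] Suc.prems False unfolding n by metis
      have Cc: "C \<in> carrier_mat (Suc m) (Suc n')" using smith_equiv_carrier[OF C] by simp
      define M where "M = mat m n' (\<lambda>(i, j). C $$ (Suc i, Suc j))"
      have Mc: "M \<in> carrier_mat m n'" by (simp add: M_def)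
      obtain \<gamma>s where len: "length \<gamma>s \<le> min m n'" and monic: "\<forall>\<gamma>\<in>set \<gamma>s. lead_coeff \<gamma> = 1"
        and sorted: "sorted_wrt (dvd) \<gamma>s" and eqv: "smith_equiv m n' M (diag_rect_mat m n' \<gamma>s)"
        using Suc.IH[OF Mc] by blast
      obtain U V where UV: "unimodular m U" "unimodular n' V" "diag_rect_mat m n' \<gamma>s = U * M * V"
        using eqv unfolding smith_equiv_def by blast
      have c: "U \<in> carrier_mat m m" "V \<in> carrier_mat n' n'" using UV by (auto simp: unimodular_def)
      define u where "u = [:inverse (lead_coeff g):]"
      have u: "u dvd 1" "lead_coeff (u * g) = 1" using g by (auto simp: u_def is_unit_triv lead_coeff_mult)
      have U': "unimodular (Suc m) (corner_mat u U)" and V': "unimodular (Suc n') (corner_mat 1 V)"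
        using UV(1,2) u(1) by (auto intro: unimodular_corner_mat)
      have Cb: "C = corner_mat g M"
      proof (rule eq_matI, goal_cases)
        case (1 i j)
        thus ?case using Ccol[of "i - 1"] Crow[of "j - 1"] g
          by (cases i; cases j) (simp_all add: M_def index_corner_mat)
      qed (use Cc in \<open>auto simp: M_def\<close>)
      have UM: "U * M \<in> carrier_mat m n'" using c Mc by auto
      have UCV: "corner_mat u U * C * corner_mat 1 V = corner_mat (u * g) (diag_rect_mat m n' \<gamma>s)"
        unfolding Cb UV(3) corner_mat_mult[OF c(1) Mc] corner_mat_mult[OF UM c(2)] by simp
      have "corner_mat u U * C * corner_mat 1 V = diag_rect_mat (Suc m) (Suc n') (u * g # \<gamma>s)"
        unfolding UCV
      proof (rule eq_matI, goal_cases)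
        case (1 i j)
        thus ?case by (cases i; cases j) (auto simp: diag_rect_mat_def index_corner_mat)
      qed (auto simp: diag_rect_mat_def)
      hence "smith_equiv (Suc m) (Suc n') C (diag_rect_mat (Suc m) (Suc n') (u * g # \<gamma>s))"
        using smith_equivI[OF Cc U' V'] by simp
      moreover have "u * g dvd \<gamma>" if "\<gamma> \<in> set \<gamma>s" for \<gamma>
      proof -
        obtain k where k: "k < length \<gamma>s" "\<gamma> = \<gamma>s ! k" using \<open>\<gamma> \<in> set \<gamma>s\<close> by (metis in_set_conv_nth)
        have km: "k < m" "k < n'" using k len by auto
        have "\<forall>i<m. \<forall>j<n'. g dvd (U * M) $$ (i, j)"
          using dvd_entries_mult[OF c(1) Mc, of g] Cdvd by (simp add: M_def)
        hence "g dvd (U * M * V) $$ (k, k)" using km by (intro dvd_entries_mult[OF UM c(2)]) auto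
        also have "(U * M * V) $$ (k, k) = \<gamma>" unfolding UV(3)[symmetric] using k km by (simp add: diag_rect_mat_def)
        finally show ?thesis using u(1) by (simp add: mult_unit_dvd_iff')
      qed
      ultimately show ?thesis using len monic sorted u(2) smith_equiv_trans[OF C] unfolding n
        by (intro exI[of _ "u * g # \<gamma>s"]) auto
    qed
  }
qed

section \<open>Triangular matrices with prescribed invariant factors and diagonal degrees\<close>

lemma exists_factor_of_degree:
  fixes q :: "'a::field poly"
  assumes ac: "is_alg_closed TYPE('a)" and q: "q \<noteq> 0" and k: "k \<le> degree q"
  obtains \<theta> \<theta>' where "q = \<theta> * \<theta>'" "degree \<theta> = k"
proof -
  from k have "\<exists>\<theta> \<theta>'. q = \<theta> * \<theta>' \<and> degree \<theta> = k"
  proof (induction k)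
    case 0
    show ?case by (intro exI[of _ 1] exI[of _ q]) simp
  next
    case (Suc k)
    then obtain \<theta> \<theta>' where 1: "q = \<theta> * \<theta>'" "degree \<theta> = k" by auto
    have nz: "\<theta> \<noteq> 0" "\<theta>' \<noteq> 0" using q 1 by auto
    have "degree q = k + degree \<theta>'" unfolding 1(1) using nz 1(2) by (simp add: degree_mult_eq)
    hence "degree \<theta>' > 0" using Suc.prems by simp
    then obtain a where "poly \<theta>' a = 0" using ac unfolding is_alg_closed_def by blast
    then obtain \<theta>'' where 2: "\<theta>' = [:-a, 1:] * \<theta>''" unfolding poly_eq_0_iff_dvd by (elim dvdE)
    have "degree (\<theta> * [:-a, 1:]) = Suc k" using nz 1(2) by (subst degree_mult_eq) auto
    moreover have "q = \<theta> * [:-a, 1:] * \<theta>''" unfolding 1(1) 2 by (simp only: mult.assoc)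
    ultimately show ?case by blast
  qed
  thus ?thesis using that by blast
qed

lemma sum_split_at:
  fixes f :: "nat \<Rightarrow> 'b::comm_monoid_add"
  assumes "p < n"
  shows "(\<Sum>l<n. f l) = (\<Sum>l<p. f l) + f p + (\<Sum>l\<in>{Suc p..<n}. f l)"
    and "(\<Sum>l<Suc n. f l) = (\<Sum>l<p. f l) + f p + f (Suc p) + (\<Sum>l\<in>{Suc p..<n}. f (Suc l))"
proof -
  have s: "(\<Sum>l<n. f l) = (\<Sum>l<p. f l) + f p + (\<Sum>l\<in>{Suc p..<n}. f l)" if "p < n" for n
  proof -
    have "{..<n} = {..<Suc p} \<union> {Suc p..<n}" "{..<Suc p} \<inter> {Suc p..<n} = {}" using that by auto
    hence "(\<Sum>l<n. f l) = (\<Sum>l<Suc p. f l) + (\<Sum>l\<in>{Suc p..<n}. f l)" by (simp add: sum.union_disjoint)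
    thus ?thesis by simp
  qed
  show "(\<Sum>l<n. f l) = (\<Sum>l<p. f l) + f p + (\<Sum>l\<in>{Suc p..<n}. f l)" by (rule s[OF assms])
  have "(\<Sum>l\<in>{Suc p..<Suc n}. f l) = f (Suc p) + (\<Sum>l\<in>{Suc (Suc p)..<Suc n}. f l)"
    by (rule sum.atLeast_Suc_lessThan) (use assms in simp)
  also have "(\<Sum>l\<in>{Suc (Suc p)..<Suc n}. f l) = (\<Sum>l\<in>{Suc p..<n}. f (Suc l))"
    by (rule sum.shift_bounds_Suc_ivl)
  finally have "(\<Sum>l\<in>{Suc p..<Suc n}. f l) = f (Suc p) + (\<Sum>l\<in>{Suc p..<n}. f (Suc l))" .
  thus "(\<Sum>l<Suc n. f l) = (\<Sum>l<p. f l) + f p + f (Suc p) + (\<Sum>l\<in>{Suc p..<n}. f (Suc l))"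
    using s[of "Suc n"] assms by (simp add: add.assoc del: sum.op_ivl_Suc sum.lessThan_Suc)
qed

lemma exists_crossing_index:
  fixes h :: "nat \<Rightarrow> nat"
  assumes "0 < n" "h 0 \<le> c" "c \<le> h n"
  obtains p where "p < n" "h p \<le> c" "c \<le> h (Suc p)"
proof -
  define q where "q = (LEAST i. 0 < i \<and> c \<le> h i)"
  have q: "0 < q \<and> c \<le> h q" unfolding q_def by (rule LeastI[of _ n]) (use assms in simp)
  have qn: "q \<le> n" unfolding q_def by (rule Least_le) (use assms in simp)
  have "h (q - 1) \<le> c"
  proof (cases "q = 1")
    case False
    have "\<not> (0 < q - 1 \<and> c \<le> h (q - 1))" unfolding q_def by (rule not_less_Least) (use q q_def in linarith)
    thus ?thesis using q False by auto
  qed (use assms in simp)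
  moreover have "q - 1 < n" "Suc (q - 1) = q" using q qn by auto
  ultimately show ?thesis using that[of "q - 1"] q by simp
qed

text \<open>
  This is the step of the construction that uses algebraic closedness: the polynomials \<open>\<phi> i\<close> are
  to be redistributed to a triangular matrix with diagonal degrees \<open>c i\<close>. The induction splits off
  the last row. If \<open>c n\<close> lies between the degrees of \<open>\<phi> p\<close> and \<open>\<phi> (Suc p)\<close>, a factor \<open>\<theta>\<close> of
  \<open>\<phi> (Suc p) / \<phi> p\<close> is chosen with \<open>deg (\<phi> p \<theta>) = c n\<close>; the complementary factor \<open>\<theta>'\<close> goes to
  \<open>\<phi> p\<close>, and the pair \<open>\<phi> p, \<phi> (Suc p)\<close> is replaced by the single polynomial \<open>\<phi> p \<theta>'\<close>. This keeps
  the divisibility chain and the majorization. The bounds on \<open>V\<close> control the degrees in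
  the rows that are added later.
\<close>

theorem triangular_realization:
  fixes \<phi> :: "nat \<Rightarrow> 'a::field poly" and c :: "nat \<Rightarrow> nat"
  assumes ac: "is_alg_closed TYPE('a)"
    and "\<And>i. i < n \<Longrightarrow> \<phi> i \<noteq> 0" and "\<And>i k. i \<le> k \<Longrightarrow> k < n \<Longrightarrow> \<phi> i dvd \<phi> k"
    and "\<And>J. J \<subseteq> {..<n} \<Longrightarrow> (\<Sum>i<card J. degree (\<phi> i)) \<le> (\<Sum>i\<in>J. c i)"
    and "(\<Sum>i<n. degree (\<phi> i)) = (\<Sum>i<n. c i)"
  shows "\<exists>M U V. (\<forall>i<n. \<forall>j<n. M i j = (\<Sum>l<n. U i l * \<phi> l * V l j)) \<and>
    (\<forall>i j. i < j \<longrightarrow> j < n \<longrightarrow> M i j = 0) \<and> (\<Prod>i<n. M i i) = (\<Prod>i<n. \<phi> i) \<and>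
    (\<forall>i<n. \<forall>j\<le>i. degree (M i j) \<le> max (c i) (c j)) \<and>
    (\<forall>i<n. \<forall>j<n. degree (V i j) \<le> c j - degree (\<phi> i))"
  using assms(2-)
proof (induction n arbitrary: \<phi>)
  case 0
  show ?case by simp
next
  case (Suc n)
  let ?h = "\<lambda>i. degree (\<phi> i)"
  note nz = Suc.prems(1) and chain = Suc.prems(2) and maj = Suc.prems(3) and total = Suc.prems(4)
  have h0: "?h 0 \<le> c n" using maj[of "{n}"] by simp
  have hn: "c n \<le> ?h n" using maj[of "{..<n}"] total by auto
  show ?case
  proof (cases "n = 0")
    case True
    have "degree (\<phi> 0) = c 0" using total True by simp
    thus ?thesis using True
      by (intro exI[of _ "\<lambda>i j. if i < j then 0 else \<phi> 0"] exI[of _ "\<lambda>_ _. 1"]) auto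
  next
    case False
    obtain p where p: "p < n" "?h p \<le> c n" "c n \<le> ?h (Suc p)"
      using exists_crossing_index[OF _ h0 hn] False by blast
    have "\<phi> p dvd \<phi> (Suc p)" using chain[of p "Suc p"] p by simp
    then obtain e where e: "\<phi> (Suc p) = \<phi> p * e" by (elim dvdE)
    have nzp: "\<phi> p \<noteq> 0" "e \<noteq> 0" using nz[of p] nz[of "Suc p"] p e by auto
    have de: "?h (Suc p) = ?h p + degree e" unfolding e using nzp by (rule degree_mult_eq)
    have "c n - ?h p \<le> degree e" using p de by simp
    then obtain \<theta> \<theta>' where \<theta>: "e = \<theta> * \<theta>'" "degree \<theta> = c n - ?h p"
      by (rule exists_factor_of_degree[OF ac nzp(2)])
    have nz\<theta>: "\<theta> \<noteq> 0" "\<theta>' \<noteq> 0" using \<theta>(1) nzp by auto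
    have de': "degree e = degree \<theta> + degree \<theta>'" unfolding \<theta>(1) using nz\<theta> by (rule degree_mult_eq)
    define \<psi> where "\<psi> = (\<lambda>i. if i < p then \<phi> i else if i = p then \<phi> p * \<theta>' else \<phi> (Suc i))"
    have \<psi>: "\<And>i. i < p \<Longrightarrow> \<psi> i = \<phi> i" "\<psi> p = \<phi> p * \<theta>'" "\<And>i. p < i \<Longrightarrow> \<psi> i = \<phi> (Suc i)"
      by (auto simp: \<psi>_def)
    have d\<psi>: "degree (\<psi> p) = ?h p + degree \<theta>'" unfolding \<psi>(2) using nzp(1) nz\<theta>(2) by (rule degree_mult_eq)
    have \<psi>_nz: "\<psi> i \<noteq> 0" if "i < n" for i using nz[of i] nz[of "Suc i"] nzp nz\<theta> that by (simp add: \<psi>_def)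
    have \<psi>_chain: "\<psi> i dvd \<psi> k" if "i \<le> k" "k < n" for i k
    proof -
      consider "i < p" "k < p" | "i < p" "k = p" | "i < p" "p < k" | "i = p" "k = p" | "i = p" "p < k" | "p < i" "p < k"
        using \<open>i \<le> k\<close> by (cases i p rule: linorder_cases; cases k p rule: linorder_cases) auto
      thus ?thesis
      proof cases
        case 1 thus ?thesis using chain[of i k] that p by (simp add: \<psi>)
      next
        case 2 thus ?thesis using chain[of i p] that p by (simp add: \<psi>)
      next
        case 3 thus ?thesis using chain[of i "Suc k"] that by (simp add: \<psi>)
      next
        case 5
        have "\<phi> p * \<theta>' dvd \<phi> (Suc p)" unfolding e \<theta>(1) by (intro dvdI[of _ _ \<theta>]) (simp add: mult_ac)
        also have "\<phi> (Suc p) dvd \<phi> (Suc k)" using chain[of "Suc p" "Suc k"] 5 that by simp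
        finally show ?thesis using 5 by (simp add: \<psi>)
      next
        case 6 thus ?thesis using chain[of "Suc i" "Suc k"] that by (simp add: \<psi>)
      qed simp
    qed
    have low: "(\<Sum>i<j. degree (\<psi> i)) = (\<Sum>i<j. ?h i)" if "j \<le> p" for j
      using that by (intro sum.cong) (auto simp: \<psi>)
    have high: "(\<Sum>i<j. degree (\<psi> i)) + c n = (\<Sum>i<Suc j. ?h i)" if "Suc p \<le> j" for j
      using that
    proof (induction j rule: dec_induct)
      case base
      show ?case using low[of p] d\<psi> \<theta>(2) de de' p by simp
    next
      case (step j)
      thus ?case using \<psi>(3)[of j] by simp
    qed
    have \<psi>_prod: "(\<Prod>i<j. \<psi> i) * (\<phi> p * \<theta>) = (\<Prod>i<Suc j. \<phi> i)" if "Suc p \<le> j" for j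
      using that
    proof (induction j rule: dec_induct)
      case base
      have "(\<Prod>i<p. \<psi> i) = (\<Prod>i<p. \<phi> i)" by (intro prod.cong) (auto simp: \<psi>)
      thus ?case using \<psi>(2) e \<theta>(1) by (simp add: mult_ac)
    next
      case (step j)
      have "(\<Prod>i<Suc j. \<psi> i) * (\<phi> p * \<theta>) = ((\<Prod>i<j. \<psi> i) * (\<phi> p * \<theta>)) * \<phi> (Suc j)"
        using \<psi>(3)[of j] step.hyps by (simp add: mult_ac)
      thus ?case using step.IH by simp
    qed
    have \<psi>_maj: "(\<Sum>i<card J. degree (\<psi> i)) \<le> (\<Sum>i\<in>J. c i)" if J: "J \<subseteq> {..<n}" for J
    proof (cases "card J \<le> p")
      case True
      have "J \<subseteq> {..<Suc n}" using J by auto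
      thus ?thesis using low[OF True] maj[of J] by simp
    next
      case False
      have fin: "finite J" using J finite_subset by blast
      have "n \<notin> J" using J by auto
      hence "card (insert n J) = Suc (card J)" "(\<Sum>i\<in>insert n J. c i) = c n + (\<Sum>i\<in>J. c i)" using fin by auto
      moreover have "insert n J \<subseteq> {..<Suc n}" using J by auto
      ultimately show ?thesis using high[of "card J"] False maj[of "insert n J"] by simp
    qed
    have \<psi>_total: "(\<Sum>i<n. degree (\<psi> i)) = (\<Sum>i<n. c i)" using high[of n] p total by simp
    have "\<exists>M U V. (\<forall>i<n. \<forall>j<n. M i j = (\<Sum>l<n. U i l * \<psi> l * V l j)) \<and>
      (\<forall>i j. i < j \<longrightarrow> j < n \<longrightarrow> M i j = 0) \<and> (\<Prod>i<n. M i i) = (\<Prod>i<n. \<psi> i) \<and>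
      (\<forall>i<n. \<forall>j\<le>i. degree (M i j) \<le> max (c i) (c j)) \<and>
      (\<forall>i<n. \<forall>j<n. degree (V i j) \<le> c j - degree (\<psi> i))"
      by (rule Suc.IH[OF \<psi>_nz \<psi>_chain \<psi>_maj \<psi>_total])
    then obtain M U V where "\<forall>i<n. \<forall>j<n. M i j = (\<Sum>l<n. U i l * \<psi> l * V l j)"
      "\<forall>i j. i < j \<longrightarrow> j < n \<longrightarrow> M i j = 0" "(\<Prod>i<n. M i i) = (\<Prod>i<n. \<psi> i)"
      "\<forall>i<n. \<forall>j\<le>i. degree (M i j) \<le> max (c i) (c j)"
      "\<forall>i<n. \<forall>j<n. degree (V i j) \<le> c j - degree (\<psi> i)"
      by (elim exE conjE) (rule that)
    hence IH: "\<And>i j. i < n \<Longrightarrow> j < n \<Longrightarrow> M i j = (\<Sum>l<n. U i l * \<psi> l * V l j)"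
      "\<And>i j. i < j \<Longrightarrow> j < n \<Longrightarrow> M i j = 0" "(\<Prod>i<n. M i i) = (\<Prod>i<n. \<psi> i)"
      "\<And>i j. i < n \<Longrightarrow> j \<le> i \<Longrightarrow> degree (M i j) \<le> max (c i) (c j)"
      "\<And>i j. i < n \<Longrightarrow> j < n \<Longrightarrow> degree (V i j) \<le> c j - degree (\<psi> i)"
      by blast+
    \<comment> \<open>In block form, with \<open>V\<^sub>p\<close> the row \<open>p\<close> of \<open>V\<close>, the new last row of \<open>M\<close> is \<open>(\<phi> p V\<^sub>p, \<phi> p \<theta>)\<close>. Undoing the merger
      turns the column \<open>p\<close> of \<open>U\<close> into two columns and the row \<open>V\<^sub>p\<close> into the rows \<open>(V\<^sub>p, \<theta>)\<close> and \<open>(0, - 1)\<close>.\<close>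
    define M' where "M' = (\<lambda>i j. if i < n then if j < n then M i j else 0
        else if j < n then \<phi> p * V p j else \<phi> p * \<theta>)"
    define V' where "V' = (\<lambda>l j. if l < p then if j < n then V l j else 0
        else if l = p then if j < n then V p j else \<theta>
        else if l = Suc p then if j < n then 0 else - 1 else if j < n then V (l - 1) j else 0)"
    define U' where "U' = (\<lambda>i l. if l < p then if i < n then U i l else 0
        else if l = p then if i < n then U i p * \<theta>' else 1
        else if l = Suc p then if i < n then U i p else 0 else if i < n then U i (l - 1) else 0)"
    have "M' i j = (\<Sum>l<Suc n. U' i l * \<phi> l * V' l j)" if ij: "i < Suc n" "j < Suc n" for i j
    proof -
      have s: "(\<Sum>l<Suc n. U' i l * \<phi> l * V' l j) = (\<Sum>l<p. U' i l * \<phi> l * V' l j) + U' i p * \<phi> p * V' p j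
          + U' i (Suc p) * \<phi> (Suc p) * V' (Suc p) j + (\<Sum>l\<in>{Suc p..<n}. U' i (Suc l) * \<phi> (Suc l) * V' (Suc l) j)"
        by (rule sum_split_at(2)[OF p(1)])
      consider "i < n" "j < n" | "i < n" "j = n" | "i = n" using ij by linarith
      thus ?thesis
      proof cases
        case 1
        have "M i j = (\<Sum>l<p. U i l * \<psi> l * V l j) + U i p * \<psi> p * V p j + (\<Sum>l\<in>{Suc p..<n}. U i l * \<psi> l * V l j)"
          unfolding IH(1)[OF 1] by (rule sum_split_at(1)[OF p(1)])
        moreover have "(\<Sum>l<p. U i l * \<psi> l * V l j) = (\<Sum>l<p. U' i l * \<phi> l * V' l j)"
          using 1 by (intro sum.cong) (auto simp: U'_def V'_def \<psi>)
        moreover have "(\<Sum>l\<in>{Suc p..<n}. U i l * \<psi> l * V l j)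
            = (\<Sum>l\<in>{Suc p..<n}. U' i (Suc l) * \<phi> (Suc l) * V' (Suc l) j)"
          using 1 by (intro sum.cong) (auto simp: U'_def V'_def \<psi>)
        moreover have "U i p * \<psi> p * V p j = U' i p * \<phi> p * V' p j + U' i (Suc p) * \<phi> (Suc p) * V' (Suc p) j"
          using 1 by (simp add: U'_def V'_def \<psi> mult_ac)
        ultimately show ?thesis unfolding s using 1 by (simp add: M'_def add_ac)
      next
        case 2
        have z: "(\<Sum>l<p. U' i l * \<phi> l * V' l j) = 0" "(\<Sum>l\<in>{Suc p..<n}. U' i (Suc l) * \<phi> (Suc l) * V' (Suc l) j) = 0"
          using 2 by (auto intro!: sum.neutral simp: V'_def)
        show ?thesis unfolding s z using 2 by (simp add: M'_def U'_def V'_def e \<theta>(1) mult_ac)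
      next
        case 3
        have z: "(\<Sum>l<p. U' i l * \<phi> l * V' l j) = 0" "(\<Sum>l\<in>{Suc p..<n}. U' i (Suc l) * \<phi> (Suc l) * V' (Suc l) j) = 0"
          using 3 by (auto intro!: sum.neutral simp: U'_def)
        show ?thesis unfolding s z using 3 ij by (simp add: M'_def U'_def V'_def)
      qed
    qed
    moreover have "M' i j = 0" if "i < j" "j < Suc n" for i j using that IH(2)[of i j] by (auto simp: M'_def)
    moreover have "(\<Prod>i<Suc n. M' i i) = (\<Prod>i<Suc n. \<phi> i)"
    proof -
      have "(\<Prod>i<n. M' i i) = (\<Prod>i<n. \<psi> i)" unfolding IH(3)[symmetric] by (intro prod.cong) (auto simp: M'_def)
      moreover have "M' n n = \<phi> p * \<theta>" by (simp add: M'_def)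
      ultimately show ?thesis using \<psi>_prod[of n] p by simp
    qed
    moreover have "degree (M' i j) \<le> max (c i) (c j)" if "i < Suc n" "j \<le> i" for i j
    proof -
      consider "i < n" | "i = n" "j < n" | "i = n" "j = n"
        using \<open>i < Suc n\<close> \<open>j \<le> i\<close> by (cases "i < n"; cases "j < n") auto
      thus ?thesis
      proof cases
        case 1 thus ?thesis using IH(4)[OF 1 that(2)] that by (simp add: M'_def)
      next
        case 2
        have "degree (\<phi> p * V p j) \<le> ?h p + (c j - degree (\<psi> p))"
          using degree_mult_le[of "\<phi> p" "V p j"] IH(5)[OF p(1) 2(2)] by linarith
        also have "\<dots> \<le> max (c n) (c j)" using p d\<psi> by auto
        finally show ?thesis using 2 by (simp add: M'_def)
      next
        case 3
        have "degree (\<phi> p * \<theta>) \<le> ?h p + (c n - ?h p)" using degree_mult_le[of "\<phi> p" \<theta>] \<theta>(2) by simp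
        thus ?thesis using 3 p by (simp add: M'_def)
      qed
    qed
    moreover have "degree (V' i j) \<le> c j - ?h i" if "i < Suc n" "j < Suc n" for i j
    proof -
      consider "i < p" | "i = p" | "i = Suc p" | "Suc p < i" by linarith
      thus ?thesis
      proof cases
        case 1 thus ?thesis using IH(5)[of i j] that p by (auto simp: V'_def \<psi>)
      next
        case 2 thus ?thesis using IH(5)[of p j] that p d\<psi> \<theta>(2)
          by (cases "j = n") (auto simp: V'_def less_Suc_eq)
      next
        case 3 thus ?thesis by (simp add: V'_def)
      next
        case 4 thus ?thesis using IH(5)[of "i - 1" j] that \<psi>(3)[of "i - 1"] by (auto simp: V'_def)
      qed
    qed
    ultimately show ?thesis
      by - (rule exI[of _ M'], rule exI[of _ U'], rule exI[of _ V'], simp)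
  qed
qed

lemma diag_sandwich_index:
  fixes X Y :: "'b::comm_ring_1 mat"
  assumes "X \<in> carrier_mat m r" "Y \<in> carrier_mat r n" "i < m" "j < n"
  shows "(X * mat_diag r a * Y) $$ (i, j) = (\<Sum>l<r. X $$ (i, l) * a l * Y $$ (l, j))"
proof -
  have "X * mat_diag r a = mat m r (\<lambda>(i,k). X $$ (i,k) * a k)"
    by (rule mat_diag_mult_right[OF assms(1)])
  thus ?thesis using assms by (simp add: scalar_prod_def atLeast0LessThan)
qed

lemma nat_bound2:
  fixes f :: "nat \<Rightarrow> nat \<Rightarrow> nat"
  obtains D where "\<And>i j. i < r \<Longrightarrow> j < r \<Longrightarrow> f i j \<le> D"
proof
  fix i j assume ij: "i < r" "j < r"
  have "f i j \<le> (\<Sum>j<r. f i j)" using ij by (intro member_le_sum) auto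
  also have "\<dots> \<le> (\<Sum>i<r. \<Sum>j<r. f i j)" using ij by (intro member_le_sum) auto
  finally show "f i j \<le> (\<Sum>i<r. \<Sum>j<r. f i j)" .
qed

text \<open>
  A relation between polynomials is homogenized entry by entry. The formal degrees on the two
  sides differ, and a power of \<open>B\<close> compensates for this.
\<close>

lemma moebius_transfer:
  fixes \<phi> :: "nat \<Rightarrow> 'a::field poly"
  assumes M: "\<And>i j. i < r \<Longrightarrow> j < r \<Longrightarrow> M i j = (\<Sum>l<r. U i l * \<phi> l * V l j)"
    and bound: "\<And>i j. i < r \<Longrightarrow> j < r \<Longrightarrow> M i j \<noteq> 0 \<Longrightarrow> k i + l j \<le> d \<and> degree (M i j) \<le> d - k i - l j"
    and h: "\<And>i. i < r \<Longrightarrow> degree (\<phi> i) \<le> h i"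
  shows "\<exists>N X Y. X \<in> carrier_mat r r \<and> Y \<in> carrier_mat r r \<and>
    B ^ N \<cdot>\<^sub>m mat r r (\<lambda>(i, j). moebius (d - k i - l j) A B (M i j))
      = X * mat_diag r (\<lambda>i. moebius (h i) A B (\<phi> i)) * Y"
proof -
  obtain D1 where D1: "\<And>i j. i < r \<Longrightarrow> j < r \<Longrightarrow> degree (U i j) + d \<le> D1"
    using nat_bound2[of r "\<lambda>i j. degree (U i j) + d"] by blast
  obtain D2 where D2: "\<And>i j. i < r \<Longrightarrow> j < r \<Longrightarrow> degree (V i j) \<le> D2"
    using nat_bound2[of r "\<lambda>i j. degree (V i j)"] by blast
  obtain H where H: "\<And>i j. i < r \<Longrightarrow> j < r \<Longrightarrow> h i \<le> H" using nat_bound2[of r "\<lambda>i j. h i"] by blast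
  obtain K where K: "\<And>i j. i < r \<Longrightarrow> j < r \<Longrightarrow> k i + l j \<le> K" using nat_bound2[of r "\<lambda>i j. k i + l j"] by blast
  define T where "T = D1 + H + D2"
  \<comment> \<open>The factors \<open>B ^ (K - k i)\<close> and \<open>B ^ (K - l j)\<close> make the total formal degree independent of \<open>i\<close> and \<open>j\<close>.\<close>
  let ?X = "mat r r (\<lambda>(i, a). B ^ (K - k i) * moebius (D1 + (H - h a)) A B (U i a))"
  let ?Y = "mat r r (\<lambda>(a, j). moebius D2 A B (V a j) * B ^ (K - l j))"
  let ?D = "mat_diag r (\<lambda>i. moebius (h i) A B (\<phi> i))"
  have "(?X * ?D * ?Y) $$ (i, j) = B ^ (2 * K + T - d) * moebius (d - k i - l j) A B (M i j)"
    if ij: "i < r" "j < r" for i j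
  proof -
    have "moebius T A B (U i a * \<phi> a * V a j)
        = moebius (D1 + (H - h a)) A B (U i a) * moebius (h a) A B (\<phi> a) * moebius D2 A B (V a j)"
      if a: "a < r" for a
    proof -
      have dU: "degree (U i a) \<le> D1 + (H - h a)" using D1[OF ij(1) a] by simp
      have dUp: "degree (U i a * \<phi> a) \<le> D1 + (H - h a) + h a"
        using degree_mult_le[of "U i a" "\<phi> a"] dU h[OF a] by linarith
      have "T = D1 + (H - h a) + h a + D2" using H[OF a a] by (simp add: T_def)
      thus ?thesis using moebius_mult[OF dUp D2[OF a ij(2)]] moebius_mult[OF dU h[OF a]] by simp
    qed
    hence "moebius T A B (M i j)
        = (\<Sum>a<r. moebius (D1 + (H - h a)) A B (U i a) * moebius (h a) A B (\<phi> a) * moebius D2 A B (V a j))"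
      unfolding M[OF ij] moebius_sum by (intro sum.cong) auto
    moreover have "(?X * ?D * ?Y) $$ (i, j) = (\<Sum>a<r. ?X $$ (i, a) * moebius (h a) A B (\<phi> a) * ?Y $$ (a, j))"
      by (rule diag_sandwich_index[of _ r]) (use ij in auto)
    ultimately have e: "(?X * ?D * ?Y) $$ (i, j) = B ^ (K - k i) * B ^ (K - l j) * moebius T A B (M i j)"
      using ij by (simp add: sum_distrib_left mult_ac)
    show ?thesis
    proof (cases "M i j = 0")
      case True thus ?thesis using e by simp
    next
      case False
      note b = bound[OF ij False]
      have dT: "d \<le> T" using D1[OF ij(1) ij(1)] by (simp add: T_def)
      have "moebius T A B (M i j) = moebius (d - k i - l j) A B (M i j) * B ^ (T - (d - k i - l j))"
        using moebius_pad[of "M i j" "d - k i - l j" "T - (d - k i - l j)" A B] b dT by simp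
      moreover have "(K - k i) + (K - l j) + (T - (d - k i - l j)) = 2 * K + T - d"
        using b dT K[OF ij] by linarith
      hence "B ^ (2 * K + T - d) = B ^ (K - k i) * B ^ (K - l j) * B ^ (T - (d - k i - l j))"
        by (metis power_add)
      ultimately show ?thesis unfolding e by (simp only: mult_ac)
    qed
  qed
  hence "B ^ (2 * K + T - d) \<cdot>\<^sub>m mat r r (\<lambda>(i, j). moebius (d - k i - l j) A B (M i j)) = ?X * ?D * ?Y"
    by (intro eq_matI) (auto simp: mat_diag_def)
  thus ?thesis by (intro exI[of _ "2 * K + T - d"] exI[of _ ?X] exI[of _ ?Y] conjI) auto
qed

section \<open>Polynomial bases of column spaces\<close>

interpretation to_fract: inj_comm_ring_hom "to_fract :: 'a::idom \<Rightarrow> 'a fract"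
  by unfold_locales auto

definition col_injective :: "'b::comm_ring_1 mat \<Rightarrow> bool" where
  "col_injective P \<longleftrightarrow>
     (\<forall>c\<in>carrier_vec (dim_col P). P *\<^sub>v c = 0\<^sub>v (dim_row P) \<longrightarrow> c = 0\<^sub>v (dim_col P))"

lemma col_injectiveD:
  "col_injective P \<Longrightarrow> P \<in> carrier_mat m r \<Longrightarrow> c \<in> carrier_vec r \<Longrightarrow> P *\<^sub>v c = 0\<^sub>v m \<Longrightarrow> c = 0\<^sub>v r"
  unfolding col_injective_def by auto

lemma col_injectiveI:
  "P \<in> carrier_mat m r \<Longrightarrow> (\<And>c. c \<in> carrier_vec r \<Longrightarrow> P *\<^sub>v c = 0\<^sub>v m \<Longrightarrow> c = 0\<^sub>v r) \<Longrightarrow> col_injective P"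
  unfolding col_injective_def by auto

text \<open>The polynomial vectors in the space spanned by the columns over the rational functions.\<close>

definition rational_span :: "'a::field poly mat \<Rightarrow> 'a poly vec set" where
  "rational_span A = {v \<in> carrier_vec (dim_row A).
     \<exists>q x. q \<noteq> 0 \<and> x \<in> carrier_vec (dim_col A) \<and> q \<cdot>\<^sub>v v = A *\<^sub>v x}"

lemma common_denominator:
  fixes y :: "'a::field poly fract vec"
  assumes y: "y \<in> carrier_vec n"
  obtains q x where "q \<noteq> 0" "x \<in> carrier_vec n" "to_fract q \<cdot>\<^sub>v y = map_vec to_fract x"
proof -
  have "\<exists>a b. b \<noteq> 0 \<and> y $ i = Fraction_Field.Fract a b" for i by (metis Fract_cases)
  then obtain a b where ab: "\<And>i. b i \<noteq> 0" "\<And>i. y $ i = Fraction_Field.Fract (a i) (b i)" by metis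
  define q where "q = (\<Prod>i<n. b i)"
  define x where "x = vec n (\<lambda>i. a i * (\<Prod>j\<in>{..<n} - {i}. b j))"
  have "to_fract q * y $ i = to_fract (a i * (\<Prod>j\<in>{..<n} - {i}. b j))" if "i < n" for i
  proof -
    have q: "q = b i * (\<Prod>j\<in>{..<n} - {i}. b j)" unfolding q_def using that by (intro prod.remove) auto
    have "to_fract (b i) * y $ i = to_fract (a i)"
      unfolding ab(2) to_fract_def using ab(1)[of i] by (simp add: eq_fract)
    thus ?thesis unfolding q by (simp add: to_fract.hom_mult mult_ac)
  qed
  hence "to_fract q \<cdot>\<^sub>v y = map_vec to_fract x" using y by (intro eq_vecI) (auto simp: x_def)
  thus ?thesis using that[of q x] ab(1) by (auto simp: q_def x_def)
qed

lemma rat_mat_carrier: "A \<in> carrier_mat m n \<Longrightarrow> rat_mat A \<in> carrier_mat m n"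
  by (simp add: rat_mat_def)

lemma rat_mat_mult_vec:
  "A \<in> carrier_mat m n \<Longrightarrow> x \<in> carrier_vec n \<Longrightarrow> map_vec to_fract (A *\<^sub>v x) = rat_mat A *\<^sub>v map_vec to_fract x"
  unfolding rat_mat_def by (rule to_fract.mult_mat_vec_hom)

lemma map_vec_to_fract_smult: "map_vec to_fract (q \<cdot>\<^sub>v v) = to_fract q \<cdot>\<^sub>v map_vec to_fract v"
  by (rule to_fract.vec_hom_smult)

lemma map_vec_to_fract_inj: "map_vec to_fract v = map_vec to_fract w \<Longrightarrow> v = w"
  by (rule to_fract.vec_hom_inj)

lemma mem_col_space_iff:
  fixes A :: "'b::field mat"
  assumes "A \<in> carrier_mat m n"
  shows "w \<in> vec_space.col_space m A \<longleftrightarrow> (\<exists>y\<in>carrier_vec n. A *\<^sub>v y = w)"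
  using vec_space.col_space_eq[OF assms] assms by auto

lemma smult_inverse_vec:
  fixes w :: "'b::field vec"
  shows "k \<noteq> 0 \<Longrightarrow> inverse k \<cdot>\<^sub>v (k \<cdot>\<^sub>v w) = w"
  by (simp add: smult_smult_assoc)

lemma mem_rational_span_iff:
  fixes A :: "'a::field poly mat"
  assumes A: "A \<in> carrier_mat m n" and v: "v \<in> carrier_vec m"
  shows "v \<in> rational_span A \<longleftrightarrow> map_vec to_fract v \<in> vec_space.col_space m (rat_mat A)"
proof
  assume "v \<in> rational_span A"
  then obtain q x where qx: "q \<noteq> 0" "x \<in> carrier_vec n" "q \<cdot>\<^sub>v v = A *\<^sub>v x"
    using A unfolding rational_span_def by auto
  have "rat_mat A *\<^sub>v (inverse (to_fract q) \<cdot>\<^sub>v map_vec to_fract x)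
      = inverse (to_fract q) \<cdot>\<^sub>v map_vec to_fract (A *\<^sub>v x)"
    using qx by (simp add: mult_mat_vec[OF rat_mat_carrier[OF A]] rat_mat_mult_vec[OF A])
  also have "\<dots> = map_vec to_fract v"
    unfolding qx(3)[symmetric] map_vec_to_fract_smult using qx(1) by (intro smult_inverse_vec) simp
  finally show "map_vec to_fract v \<in> vec_space.col_space m (rat_mat A)"
    unfolding mem_col_space_iff[OF rat_mat_carrier[OF A]] using qx(2) by (intro bexI) auto
next
  assume "map_vec to_fract v \<in> vec_space.col_space m (rat_mat A)"
  then obtain y where y: "y \<in> carrier_vec n" "rat_mat A *\<^sub>v y = map_vec to_fract v"
    unfolding mem_col_space_iff[OF rat_mat_carrier[OF A]] by blast
  obtain q x where qx: "q \<noteq> 0" "x \<in> carrier_vec n" "to_fract q \<cdot>\<^sub>v y = map_vec to_fract x"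
    using common_denominator[OF y(1)] by blast
  have "map_vec to_fract (q \<cdot>\<^sub>v v) = to_fract q \<cdot>\<^sub>v (rat_mat A *\<^sub>v y)"
    unfolding map_vec_to_fract_smult y(2) ..
  also have "\<dots> = rat_mat A *\<^sub>v (to_fract q \<cdot>\<^sub>v y)"
    by (rule mult_mat_vec[symmetric, OF rat_mat_carrier[OF A] y(1)])
  also have "\<dots> = map_vec to_fract (A *\<^sub>v x)" unfolding qx(3) rat_mat_mult_vec[OF A qx(2)] ..
  finally have "q \<cdot>\<^sub>v v = A *\<^sub>v x" by (rule map_vec_to_fract_inj)
  thus "v \<in> rational_span A" using v A qx unfolding rational_span_def by auto
qed

lemma mult_in_rational_span:
  fixes A :: "'a::field poly mat"
  assumes "A \<in> carrier_mat m n" "x \<in> carrier_vec n" shows "A *\<^sub>v x \<in> rational_span A"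
  using assms unfolding rational_span_def by (auto intro!: exI[of _ 1] exI[of _ x])

lemma col_space_subset:
  fixes A B :: "'a::field poly mat"
  assumes A: "A \<in> carrier_mat m n" and B: "B \<in> carrier_mat m k" and sub: "rational_span A \<subseteq> rational_span B"
  shows "vec_space.col_space m (rat_mat A) \<subseteq> vec_space.col_space m (rat_mat B)"
proof
  fix w assume "w \<in> vec_space.col_space m (rat_mat A)"
  then obtain y where y: "y \<in> carrier_vec n" "rat_mat A *\<^sub>v y = w"
    unfolding mem_col_space_iff[OF rat_mat_carrier[OF A]] by blast
  obtain q x where qx: "q \<noteq> 0" "x \<in> carrier_vec n" "to_fract q \<cdot>\<^sub>v y = map_vec to_fract x"
    using common_denominator[OF y(1)] by blast
  have Ax: "A *\<^sub>v x \<in> carrier_vec m" using A qx by simp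
  have "A *\<^sub>v x \<in> rational_span B" using mult_in_rational_span[OF A qx(2)] sub by blast
  hence "map_vec to_fract (A *\<^sub>v x) \<in> vec_space.col_space m (rat_mat B)"
    using mem_rational_span_iff[OF B Ax] by blast
  then obtain z where z: "z \<in> carrier_vec k" "rat_mat B *\<^sub>v z = map_vec to_fract (A *\<^sub>v x)"
    unfolding mem_col_space_iff[OF rat_mat_carrier[OF B]] by blast
  have "map_vec to_fract (A *\<^sub>v x) = to_fract q \<cdot>\<^sub>v w"
    unfolding rat_mat_mult_vec[OF A qx(2)] qx(3)[symmetric] y(2)[symmetric]
    by (rule mult_mat_vec[OF rat_mat_carrier[OF A] y(1)])
  hence "inverse (to_fract q) \<cdot>\<^sub>v (rat_mat B *\<^sub>v z) = w"
    unfolding z(2) using qx(1) smult_inverse_vec[of "to_fract q" w] by simp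
  hence "rat_mat B *\<^sub>v (inverse (to_fract q) \<cdot>\<^sub>v z) = w"
    unfolding mult_mat_vec[OF rat_mat_carrier[OF B] z(1)] .
  thus "w \<in> vec_space.col_space m (rat_mat B)"
    unfolding mem_col_space_iff[OF rat_mat_carrier[OF B]] using z(1)
    by (intro bexI[of _ "inverse (to_fract q) \<cdot>\<^sub>v z"]) auto
qed

lemma col_space_eq_iff:
  fixes A B :: "'a::field poly mat"
  assumes A: "A \<in> carrier_mat m n" and B: "B \<in> carrier_mat m k"
  shows "vec_space.col_space m (rat_mat A) = vec_space.col_space m (rat_mat B) \<longleftrightarrow> rational_span A = rational_span B"
proof
  assume eq: "vec_space.col_space m (rat_mat A) = vec_space.col_space m (rat_mat B)"
  have "rational_span A \<subseteq> carrier_vec m" "rational_span B \<subseteq> carrier_vec m"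
    using A B unfolding rational_span_def by auto
  moreover have "v \<in> rational_span A \<longleftrightarrow> v \<in> rational_span B" if "v \<in> carrier_vec m" for v
    unfolding mem_rational_span_iff[OF A that] mem_rational_span_iff[OF B that] eq ..
  ultimately show "rational_span A = rational_span B" by blast
next
  assume "rational_span A = rational_span B"
  thus "vec_space.col_space m (rat_mat A) = vec_space.col_space m (rat_mat B)"
    by (intro subset_antisym col_space_subset[OF A B] col_space_subset[OF B A]) simp_all
qed

lemma col_injective_rat_mat_iff:
  fixes P :: "'a::field poly mat"
  assumes P: "P \<in> carrier_mat m r"
  shows "col_injective (rat_mat P) \<longleftrightarrow> col_injective P"
proof
  assume inj: "col_injective (rat_mat P)"
  show "col_injective P"
  proof (rule col_injectiveI[OF P])
    fix c assume c: "c \<in> carrier_vec r" "P *\<^sub>v c = 0\<^sub>v m"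
    have "rat_mat P *\<^sub>v map_vec to_fract c = 0\<^sub>v m"
      unfolding rat_mat_mult_vec[OF P c(1), symmetric] c(2) by (rule eq_vecI) auto
    from col_injectiveD[OF inj rat_mat_carrier[OF P] _ this] c
    have "map_vec to_fract c = map_vec to_fract (0\<^sub>v r)" by (auto intro!: eq_vecI)
    thus "c = 0\<^sub>v r" by (rule map_vec_to_fract_inj)
  qed
next
  assume inj: "col_injective P"
  show "col_injective (rat_mat P)"
  proof (rule col_injectiveI[OF rat_mat_carrier[OF P]])
    fix y assume y: "y \<in> carrier_vec r" "rat_mat P *\<^sub>v y = 0\<^sub>v m"
    obtain q x where qx: "q \<noteq> 0" "x \<in> carrier_vec r" "to_fract q \<cdot>\<^sub>v y = map_vec to_fract x"
      using common_denominator[OF y(1)] by blast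
    have "map_vec to_fract (P *\<^sub>v x) = to_fract q \<cdot>\<^sub>v (rat_mat P *\<^sub>v y)"
      unfolding rat_mat_mult_vec[OF P qx(2)] qx(3)[symmetric]
      by (rule mult_mat_vec[OF rat_mat_carrier[OF P] y(1)])
    also have "\<dots> = map_vec to_fract (0\<^sub>v m)" unfolding y(2) by (rule eq_vecI) auto
    finally have "P *\<^sub>v x = 0\<^sub>v m" by (rule map_vec_to_fract_inj)
    hence "x = 0\<^sub>v r" by (rule col_injectiveD[OF inj P qx(2)])
    hence "to_fract q \<cdot>\<^sub>v y = 0\<^sub>v r" using qx(3) by (auto intro!: eq_vecI)
    hence "inverse (to_fract q) \<cdot>\<^sub>v 0\<^sub>v r = y" using smult_inverse_vec[of "to_fract q" y] qx(1) by simp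
    thus "y = 0\<^sub>v r" by (auto intro!: eq_vecI)
  qed
qed

lemma mat_mult_unit_vec:
  fixes P :: "'b::comm_ring_1 mat"
  assumes "P \<in> carrier_mat m r" "j < r" shows "P *\<^sub>v unit_vec r j = col P j"
  by (rule eq_vecI) (use assms in \<open>auto simp: scalar_prod_right_unit\<close>)

lemma col_injective_imp_distinct:
  fixes bs :: "'b::comm_ring_1 vec list"
  assumes bs: "set bs \<subseteq> carrier_vec m" and inj: "col_injective (mat_of_cols m bs)"
  shows "distinct bs"
  unfolding distinct_conv_nth
proof (intro allI impI notI)
  fix i j assume ij: "i < length bs" "j < length bs" "i \<noteq> j" "bs ! i = bs ! j"
  let ?r = "length bs" and ?P = "mat_of_cols m bs"
  have P: "?P \<in> carrier_mat m ?r" by simp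
  have cols: "col ?P i = bs ! i" "col ?P j = bs ! j" using ij bs by (auto simp: subset_iff)
  have "?P *\<^sub>v (unit_vec ?r i - unit_vec ?r j) = ?P *\<^sub>v unit_vec ?r i - ?P *\<^sub>v unit_vec ?r j"
    by (rule mult_minus_distrib_mat_vec[OF P]) auto
  also have "\<dots> = 0\<^sub>v m"
    using mat_mult_unit_vec[OF P ij(1)] mat_mult_unit_vec[OF P ij(2)] cols ij bs
    by (auto simp: subset_iff)
  finally have "unit_vec ?r i - unit_vec ?r j = (0\<^sub>v ?r :: 'b vec)"
    by (intro col_injectiveD[OF inj P]) auto
  hence "(unit_vec ?r i - unit_vec ?r j :: 'b vec) $ i = 0" using ij by simp
  thus False using ij by simp
qed

text \<open>
  Bases over the field of rational functions are traded for polynomial matrices, so that all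
  further arguments take place over the ring of polynomials.
\<close>

lemma polynomial_basis_col_space:
  fixes A :: "'a::field poly mat"
  assumes A: "A \<in> carrier_mat m n"
  shows "polynomial_basis m (vec_space.col_space m (rat_mat A)) bs \<longleftrightarrow>
      set bs \<subseteq> carrier_vec m \<and> col_injective (mat_of_cols m bs) \<and>
      rational_span (mat_of_cols m bs) = rational_span A"
    and "polynomial_basis m (vec_space.col_space m (rat_mat A)) bs \<Longrightarrow> pm_rank A = length bs"
proof -
  interpret V: vec_space "TYPE('a poly fract)" m .
  let ?S = "map_vec to_fract ` set bs" and ?P = "mat_of_cols m bs"
  have P: "?P \<in> carrier_mat m (length bs)" by simp
  note rA = rat_mat_carrier[OF A] and rP = rat_mat_carrier[OF P]
  define W where "W = V.col_space (rat_mat A)"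
  have colsA: "set (cols (rat_mat A)) \<subseteq> carrier_vec m" using rA cols_dim by blast
  have sub: "submodule class_ring W V.V" unfolding W_def V.col_space_def by (rule V.span_is_submodule) (use colsA in simp)
  have vsW: "vectorspace class_ring (V.vs W)"
    by (rule V.subspace_is_vs) (simp add: subspace_def sub vec_vs)
  have aux: "vectorspace.basis class_ring (V.vs W) ?S \<longleftrightarrow> V.lin_indpt ?S \<and> V.span ?S = W"
    if bs: "set bs \<subseteq> carrier_vec m"
  proof -
    have Sc: "?S \<subseteq> carrier_vec m" using bs by auto
    show ?thesis
    proof (cases "?S \<subseteq> W")
      case True
      show ?thesis unfolding vectorspace.basis_def[OF vsW]
        using V.span_li_not_depend[OF True sub] True by simp
    next
      case False
      hence "V.span ?S \<noteq> W" using V.in_own_span[of ?S] Sc by auto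
      thus ?thesis unfolding vectorspace.basis_def[OF vsW] using False by simp
    qed
  qed
  have colsP: "cols (rat_mat ?P) = map (map_vec to_fract) bs" if bs: "set bs \<subseteq> carrier_vec m"
    by (rule nth_equalityI) (use bs in \<open>auto simp: rat_mat_def subset_iff cols_def intro!: eq_vecI\<close>)
  have spanP: "V.span ?S = V.col_space (rat_mat ?P)" if bs: "set bs \<subseteq> carrier_vec m"
    unfolding V.col_space_def colsP[OF bs] by simp
  have spaneq: "V.span ?S = W \<longleftrightarrow> rational_span ?P = rational_span A" if bs: "set bs \<subseteq> carrier_vec m"
    unfolding spanP[OF bs] W_def by (rule col_space_eq_iff[OF P A])
  have dist: "distinct (cols (rat_mat ?P)) \<longleftrightarrow> distinct bs" if bs: "set bs \<subseteq> carrier_vec m"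
    unfolding colsP[OF bs] distinct_map by (auto intro: inj_onI dest: map_vec_to_fract_inj)
  have indpt: "distinct bs \<and> V.lin_indpt ?S \<longleftrightarrow> col_injective ?P" if bs: "set bs \<subseteq> carrier_vec m"
  proof
    assume a: "distinct bs \<and> V.lin_indpt ?S"
    show "col_injective ?P" unfolding col_injective_rat_mat_iff[OF P, symmetric]
    proof (rule col_injectiveI[OF rP], rule ccontr)
      fix c assume c: "c \<in> carrier_vec (length bs)" "rat_mat ?P *\<^sub>v c = 0\<^sub>v m" "c \<noteq> 0\<^sub>v (length bs)"
      have "V.lin_dep (set (cols (rat_mat ?P)))" by (rule V.lin_depI[OF rP c(1,3,2)]) (use a dist[OF bs] in simp)
      thus False using a unfolding colsP[OF bs] by simp
    qed
  next
    assume inj: "col_injective ?P"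
    have d: "distinct bs" by (rule col_injective_imp_distinct[OF bs inj])
    have "V.lin_indpt ?S"
    proof
      assume "V.lin_dep ?S"
      hence ld: "V.lin_dep (set (cols (rat_mat ?P)))" unfolding colsP[OF bs] by simp
      have dc: "distinct (cols (rat_mat ?P))" using d dist[OF bs] by simp
      obtain v where v: "v \<in> carrier_vec (length bs)" "v \<noteq> 0\<^sub>v (length bs)" "rat_mat ?P *\<^sub>v v = 0\<^sub>v m"
        by (rule V.lin_depE[OF rP ld dc])
      have "col_injective (rat_mat ?P)" using inj col_injective_rat_mat_iff[OF P] by simp
      from col_injectiveD[OF this rP v(1,3)] v(2) show False by simp
    qed
    thus "distinct bs \<and> V.lin_indpt ?S" using d by blast
  qed
  show "polynomial_basis m (vec_space.col_space m (rat_mat A)) bs \<longleftrightarrow>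
      set bs \<subseteq> carrier_vec m \<and> col_injective ?P \<and> rational_span ?P = rational_span A"
    unfolding polynomial_basis_def W_def[symmetric] using aux indpt spaneq by blast
  assume "polynomial_basis m (vec_space.col_space m (rat_mat A)) bs"
  hence bs: "set bs \<subseteq> carrier_vec m" and d: "distinct bs" and b: "vectorspace.basis class_ring (V.vs W) ?S"
    unfolding polynomial_basis_def W_def by auto
  have "V.rank (rat_mat A) = vectorspace.dim class_ring (V.vs W)"
    unfolding V.rank_def W_def V.col_space_def ..
  also have "\<dots> = card ?S" by (rule vectorspace.dim_basis[OF vsW _ b]) simp
  also have "\<dots> = length bs"
    using d by (subst card_image) (auto intro: inj_onI dest: map_vec_to_fract_inj simp: distinct_card)
  finally show "pm_rank A = length bs" using A unfolding pm_rank_def by simp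
qed

section \<open>Minimal bases\<close>

definition column_basis :: "'a::field poly mat \<Rightarrow> 'a poly mat \<Rightarrow> bool" where
  "column_basis A P \<longleftrightarrow> P \<in> carrier_mat (dim_row A) (dim_col P) \<and> col_injective P \<and>
     rational_span P = rational_span A"

definition minimal_columns :: "'a::field poly mat \<Rightarrow> 'a poly mat \<Rightarrow> bool" where
  "minimal_columns A P \<longleftrightarrow> column_basis A P \<and>
     (\<forall>C. column_basis A C \<longrightarrow>
       (\<Sum>j<dim_col P. vec_degree (col P j)) \<le> (\<Sum>j<dim_col C. vec_degree (col C j)))"

lemma column_basis_cols:
  assumes A: "A \<in> carrier_mat m n" and "column_basis A P"
  shows "polynomial_basis m (vec_space.col_space m (rat_mat A)) (cols P)" "pm_rank A = dim_col P"
proof -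
  have P: "P \<in> carrier_mat m (dim_col P)" using assms by (simp add: column_basis_def)
  hence id: "mat_of_cols m (cols P) = P" by auto
  have "set (cols P) \<subseteq> carrier_vec m" using P cols_dim by blast
  thus b: "polynomial_basis m (vec_space.col_space m (rat_mat A)) (cols P)"
    using assms(2) unfolding polynomial_basis_col_space(1)[OF A] id column_basis_def by blast
  show "pm_rank A = dim_col P" using polynomial_basis_col_space(2)[OF A b] by simp
qed

lemma basis_order_cols: "basis_order (cols P) = (\<Sum>j<dim_col P. vec_degree (col P j))"
  unfolding basis_order_def by (simp add: sum_list_sum_nth atLeast0LessThan)

lemma minimal_basis_iff:
  assumes A: "A \<in> carrier_mat m n"
  shows "minimal_basis m (vec_space.col_space m (rat_mat A)) bs \<longleftrightarrow>
    set bs \<subseteq> carrier_vec m \<and> minimal_columns A (mat_of_cols m bs)"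
proof -
  have pb: "polynomial_basis m (vec_space.col_space m (rat_mat A)) cs \<longleftrightarrow>
      set cs \<subseteq> carrier_vec m \<and> column_basis A (mat_of_cols m cs)" for cs
    unfolding polynomial_basis_col_space(1)[OF A] column_basis_def using A by auto
  have ord: "basis_order cs = (\<Sum>j<dim_col (mat_of_cols m cs). vec_degree (col (mat_of_cols m cs) j))"
    if "set cs \<subseteq> carrier_vec m" for cs
    using basis_order_cols[of "mat_of_cols m cs"] cols_mat_of_cols[OF that] by simp
  show ?thesis
  proof
    assume L: "minimal_basis m (vec_space.col_space m (rat_mat A)) bs"
    hence bs: "set bs \<subseteq> carrier_vec m" "column_basis A (mat_of_cols m bs)"
      unfolding minimal_basis_def pb by auto
    have "basis_order bs \<le> (\<Sum>j<dim_col C. vec_degree (col C j))" if "column_basis A C" for C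
      using L column_basis_cols(1)[OF A that] basis_order_cols[of C] unfolding minimal_basis_def by metis
    thus "set bs \<subseteq> carrier_vec m \<and> minimal_columns A (mat_of_cols m bs)"
      using bs unfolding minimal_columns_def ord[OF bs(1)] by blast
  next
    assume R: "set bs \<subseteq> carrier_vec m \<and> minimal_columns A (mat_of_cols m bs)"
    hence bs: "set bs \<subseteq> carrier_vec m" by blast
    have "basis_order bs \<le> basis_order cs" if "polynomial_basis m (vec_space.col_space m (rat_mat A)) cs" for cs
    proof -
      have cs: "set cs \<subseteq> carrier_vec m" "column_basis A (mat_of_cols m cs)" using that pb by auto
      thus ?thesis using R unfolding ord[OF bs] ord[OF cs(1)] minimal_columns_def by blast
    qed
    thus "minimal_basis m (vec_space.col_space m (rat_mat A)) bs"
      using R unfolding minimal_basis_def pb minimal_columns_def by blast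
  qed
qed

lemma minimal_basis_permute:
  assumes "mset bs = mset bs'" "minimal_basis p W bs" shows "minimal_basis p W bs'"
proof -
  have "set bs = set bs'" "distinct bs = distinct bs'"
    using assms(1) by (metis set_mset_mset, metis mset_eq_imp_distinct_iff)
  moreover have "basis_order bs = basis_order bs'"
    unfolding basis_order_def using assms(1) by (metis mset_map sum_mset_sum_list)
  ultimately show ?thesis using assms(2) unfolding minimal_basis_def polynomial_basis_def by simp
qed

text \<open>
  The basis vectors can be listed by decreasing or by increasing degree. For the row space the
  second order is the useful one, because large indices of one space are paired with small
  indices of the other.
\<close>

lemma minimal_columns_of_indices:
  fixes A :: "'a::field poly mat"
  assumes A: "A \<in> carrier_mat m n" and ks: "col_span_minimal_indices A ks"
    and ks': "mset ks' = mset ks" "sorted ks' \<or> sorted (rev ks')"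
  obtains P where "P \<in> carrier_mat m (length ks)" "minimal_columns A P"
    "\<And>j. j < length ks \<Longrightarrow> vec_degree (col P j) = ks' ! j"
proof -
  obtain bs where bs: "minimal_basis m (vec_space.col_space m (rat_mat A)) bs"
    "ks = rev (sort (map vec_degree bs))"
    using ks A unfolding col_span_minimal_indices_def minimal_indices_def by auto
  obtain bs' where bs': "mset bs' = mset bs" "map vec_degree bs' = ks'"
  proof -
    have s: "mset ks' = mset (map vec_degree bs)" using ks'(1) bs(2) by simp
    have m: "map vec_degree (sort_key vec_degree bs) = sort (map vec_degree bs)"
      by (rule properties_for_sort[symmetric]) simp_all
    show ?thesis
    proof (cases "sorted ks'")
      case True
      hence "sort (map vec_degree bs) = ks'" using s by (metis properties_for_sort)
      thus ?thesis using m that[of "sort_key vec_degree bs"] by simp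
    next
      case False
      hence "sorted (rev ks')" using ks'(2) by blast
      hence "sort (map vec_degree bs) = rev ks'" using s by (metis mset_rev properties_for_sort)
      thus ?thesis using m that[of "rev (sort_key vec_degree bs)"] by (simp add: rev_map[symmetric])
    qed
  qed
  have len: "length bs' = length ks" using bs'(2) ks'(1) by (metis length_map size_mset)
  have "minimal_basis m (vec_space.col_space m (rat_mat A)) bs'"
    by (rule minimal_basis_permute[OF _ bs(1)]) (simp add: bs'(1))
  hence M: "set bs' \<subseteq> carrier_vec m" "minimal_columns A (mat_of_cols m bs')"
    unfolding minimal_basis_iff[OF A] by auto
  show ?thesis
  proof (rule that[OF _ M(2)])
    show "mat_of_cols m bs' \<in> carrier_mat m (length ks)" unfolding len[symmetric] by simp
    fix j assume "j < length ks"
    thus "vec_degree (col (mat_of_cols m bs') j) = ks' ! j"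
      using len M(1) bs'(2) by (auto simp: subset_iff)
  qed
qed

lemma indices_of_minimal_columns:
  assumes A: "A \<in> carrier_mat m n" and "minimal_columns A P"
    and "mset ks = mset (map (\<lambda>j. vec_degree (col P j)) [0..<dim_col P])" "sorted (rev ks)"
  shows "col_span_minimal_indices A ks"
proof -
  have P: "P \<in> carrier_mat m (dim_col P)" using assms A by (simp add: minimal_columns_def column_basis_def)
  have "minimal_basis m (vec_space.col_space m (rat_mat A)) (cols P)"
    unfolding minimal_basis_iff[OF A] using assms(2) P cols_dim[of P] mat_of_cols_cols[of P] by auto
  moreover have "map vec_degree (cols P) = map (\<lambda>j. vec_degree (col P j)) [0..<dim_col P]"
    by (simp add: cols_def)
  moreover have "sort (map (\<lambda>j. vec_degree (col P j)) [0..<dim_col P]) = rev ks"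
    by (rule properties_for_sort) (use assms in auto)
  ultimately show ?thesis unfolding col_span_minimal_indices_def minimal_indices_def
    using A by (intro exI[of _ "cols P"]) auto
qed

lemma degree_le_vec_degree: "v \<in> carrier_vec m \<Longrightarrow> i < m \<Longrightarrow> degree (v $ i) \<le> vec_degree v"
  unfolding vec_degree_def vec_set_def by (intro Max_ge) auto

lemma vec_degree_attained:
  assumes "v \<in> carrier_vec m" "0 < m" obtains i where "i < m" "degree (v $ i) = vec_degree v"
proof -
  have "vec_degree v \<in> degree ` vec_set v"
    unfolding vec_degree_def vec_set_def using assms by (intro Max_in) auto
  thus ?thesis using that assms unfolding vec_set_def by auto
qed

lemma vec_degree_leI:
  assumes "v \<in> carrier_vec m" "0 < m" "\<And>i. i < m \<Longrightarrow> degree (v $ i) \<le> D" shows "vec_degree v \<le> D"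
  using vec_degree_attained[OF assms(1,2)] assms(3) by metis

lemma mult_mat_vec_index:
  "P \<in> carrier_mat m r \<Longrightarrow> x \<in> carrier_vec r \<Longrightarrow> a < m \<Longrightarrow> (P *\<^sub>v x) $ a = (\<Sum>j<r. P $$ (a, j) * x $ j)"
  by (simp add: scalar_prod_def atLeast0LessThan)

lemma mult_mat_smult_vec:
  fixes P :: "'b::comm_ring_1 mat"
  assumes "P \<in> carrier_mat m r" "x \<in> carrier_vec r"
  shows "P *\<^sub>v (k \<cdot>\<^sub>v x) = k \<cdot>\<^sub>v (P *\<^sub>v x)"
proof (rule eq_vecI)
  fix a assume "a < dim_vec (k \<cdot>\<^sub>v (P *\<^sub>v x))"
  hence a: "a < m" using assms by simp
  have "(P *\<^sub>v (k \<cdot>\<^sub>v x)) $ a = (\<Sum>j<r. P $$ (a, j) * (k * x $ j))"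
    using assms a by (subst mult_mat_vec_index[of _ m r]) auto
  also have "\<dots> = k * (\<Sum>j<r. P $$ (a, j) * x $ j)" by (simp add: sum_distrib_left mult_ac)
  also have "\<dots> = (k \<cdot>\<^sub>v (P *\<^sub>v x)) $ a"
    using assms a mult_mat_vec_index[OF assms a] by simp
  finally show "(P *\<^sub>v (k \<cdot>\<^sub>v x)) $ a = (k \<cdot>\<^sub>v (P *\<^sub>v x)) $ a" .
qed (use assms in simp)

text \<open>
  A column of a minimal basis cannot be exchanged for a vector of smaller degree: the exchange
  of a column with nonzero coefficient \<open>z\<^sub>i\<close> again gives a basis.
\<close>

lemma column_exchange:
  fixes A P :: "'a::field poly mat"
  assumes A: "A \<in> carrier_mat m n" and P: "P \<in> carrier_mat m r" and b: "column_basis A P"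
    and v: "v \<in> carrier_vec m" and q: "q \<noteq> 0" and z: "z \<in> carrier_vec r"
    and eq: "q \<cdot>\<^sub>v v = P *\<^sub>v z" and i: "i < r" "z $ i \<noteq> 0"
  shows "column_basis A (mat m r (\<lambda>(a, j). if j = i then v $ a else P $$ (a, j)))"
proof -
  let ?C = "mat m r (\<lambda>(a, j). if j = i then v $ a else P $$ (a, j))"
  have C: "?C \<in> carrier_mat m r" by simp
  have inj: "col_injective P" and sp: "rational_span P = rational_span A"
    using b by (auto simp: column_basis_def)
  have Cx: "(?C *\<^sub>v x) $ a = (P *\<^sub>v x) $ a + x $ i * (v $ a - P $$ (a, i))"
    if x: "x \<in> carrier_vec r" and a: "a < m" for x a
  proof -
    have "(?C *\<^sub>v x) $ a = (\<Sum>j\<in>{0..<r}. ?C $$ (a, j) * x $ j)"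
      using x a by (simp add: scalar_prod_def)
    also have "\<dots> = (\<Sum>j\<in>{0..<r}. P $$ (a, j) * x $ j + (if j = i then x $ i * (v $ a - P $$ (a, i)) else 0))"
      using a by (intro sum.cong) (auto simp: algebra_simps)
    also have "\<dots> = (\<Sum>j\<in>{0..<r}. P $$ (a, j) * x $ j) + x $ i * (v $ a - P $$ (a, i))"
      using i by (simp add: sum.distrib)
    finally show ?thesis using P x a by (simp add: scalar_prod_def)
  qed
  have Pe: "(P *\<^sub>v unit_vec r i) $ a = P $$ (a, i)" if "a < m" for a
    using mat_mult_unit_vec[OF P i(1)] that P i by simp
  have qv: "q * v $ a = (P *\<^sub>v z) $ a" if "a < m" for a
    using arg_cong[OF eq, of "\<lambda>w. w $ a"] that v by simp
  define y where "y = (\<lambda>x. q \<cdot>\<^sub>v x + (x $ i \<cdot>\<^sub>v z + (- (q * x $ i)) \<cdot>\<^sub>v unit_vec r i))"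
  define w where "w = (\<lambda>x. z $ i \<cdot>\<^sub>v x + ((- (x $ i)) \<cdot>\<^sub>v z + (q * x $ i) \<cdot>\<^sub>v unit_vec r i))"
  have yc: "y x \<in> carrier_vec r" and wc: "w x \<in> carrier_vec r" if "x \<in> carrier_vec r" for x
    using that z by (auto simp: y_def w_def)
  have lin: "(P *\<^sub>v (k \<cdot>\<^sub>v x + (k' \<cdot>\<^sub>v z + k'' \<cdot>\<^sub>v unit_vec r i))) $ a
      = k * (P *\<^sub>v x) $ a + k' * (P *\<^sub>v z) $ a + k'' * P $$ (a, i)"
    if "x \<in> carrier_vec r" "a < m" for k k' k'' x a
    using that z P Pe by (simp add: mult_add_distrib_mat_vec[of _ m r] mult_mat_smult_vec[of _ m r])
  have CP: "q \<cdot>\<^sub>v (?C *\<^sub>v x) = P *\<^sub>v y x" if x: "x \<in> carrier_vec r" for x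
  proof (rule eq_vecI)
    fix a assume "a < dim_vec (P *\<^sub>v y x)"
    hence a: "a < m" using P by simp
    have "(q \<cdot>\<^sub>v (?C *\<^sub>v x)) $ a = q * (?C *\<^sub>v x) $ a" using a by simp
    also have "\<dots> = q * (P *\<^sub>v x) $ a + x $ i * (q * v $ a) - q * x $ i * P $$ (a, i)"
      unfolding Cx[OF x a] by (simp add: algebra_simps)
    also have "\<dots> = (P *\<^sub>v y x) $ a" unfolding y_def lin[OF x a] qv[OF a] by simp
    finally show "(q \<cdot>\<^sub>v (?C *\<^sub>v x)) $ a = (P *\<^sub>v y x) $ a" .
  qed (use P in simp)
  have PC: "z $ i \<cdot>\<^sub>v (P *\<^sub>v x) = ?C *\<^sub>v w x" if x: "x \<in> carrier_vec r" for x
  proof (rule eq_vecI)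
    fix a assume "a < dim_vec (?C *\<^sub>v w x)"
    hence a: "a < m" by simp
    have wi: "w x $ i = q * x $ i" using x z i by (simp add: w_def)
    have "(?C *\<^sub>v w x) $ a = (P *\<^sub>v w x) $ a + q * x $ i * (v $ a - P $$ (a, i))"
      unfolding Cx[OF wc[OF x] a] wi ..
    also have "\<dots> = z $ i * (P *\<^sub>v x) $ a - x $ i * (q * v $ a) + q * x $ i * v $ a"
      unfolding w_def lin[OF x a] qv[OF a] by (simp add: algebra_simps)
    also have "\<dots> = z $ i * (P *\<^sub>v x) $ a" by (simp add: algebra_simps)
    also have "\<dots> = (z $ i \<cdot>\<^sub>v (P *\<^sub>v x)) $ a" using a P by simp
    finally show "(z $ i \<cdot>\<^sub>v (P *\<^sub>v x)) $ a = (?C *\<^sub>v w x) $ a" ..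
  qed (use P in simp)
  have "col_injective ?C"
  proof (rule col_injectiveI[OF C])
    fix x assume x: "x \<in> carrier_vec r" "?C *\<^sub>v x = 0\<^sub>v m"
    have "P *\<^sub>v y x = 0\<^sub>v m" unfolding CP[OF x(1), symmetric] x(2) by (rule eq_vecI) auto
    hence y0: "y x = 0\<^sub>v r" by (rule col_injectiveD[OF inj P yc[OF x(1)]])
    have "y x $ i = x $ i * z $ i" using x z i by (simp add: y_def)
    hence xi: "x $ i = 0" using y0 i by simp
    have "q * x $ j = 0" if "j < r" for j
    proof -
      have "y x $ j = q * x $ j" using x z i that xi by (simp add: y_def)
      thus ?thesis using y0 that by simp
    qed
    thus "x = 0\<^sub>v r" using x q by (intro eq_vecI) auto
  qed
  moreover have "rational_span ?C = rational_span P"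
  proof (intro subset_antisym subsetI)
    fix u assume "u \<in> rational_span ?C"
    then obtain k x where u: "u \<in> carrier_vec m" "k \<noteq> 0" "x \<in> carrier_vec r" "k \<cdot>\<^sub>v u = ?C *\<^sub>v x"
      unfolding rational_span_def by auto
    have "(q * k) \<cdot>\<^sub>v u = P *\<^sub>v y x" unfolding CP[OF u(3), symmetric] u(4)[symmetric] by (simp add: smult_smult_assoc)
    thus "u \<in> rational_span P" using u yc[OF u(3)] q P unfolding rational_span_def
      by (auto intro!: exI[of _ "q * k"])
  next
    fix u assume "u \<in> rational_span P"
    then obtain k x where u: "u \<in> carrier_vec m" "k \<noteq> 0" "x \<in> carrier_vec r" "k \<cdot>\<^sub>v u = P *\<^sub>v x"
      using P unfolding rational_span_def by auto
    have "(z $ i * k) \<cdot>\<^sub>v u = ?C *\<^sub>v w x" unfolding PC[OF u(3), symmetric] u(4)[symmetric] by (simp add: smult_smult_assoc)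
    thus "u \<in> rational_span ?C" using u wc[OF u(3)] i(2) unfolding rational_span_def
      by (auto intro!: exI[of _ "z $ i * k"])
  qed
  ultimately show ?thesis using A sp unfolding column_basis_def by simp
qed

text \<open>
  The degree bound concerns the nonzero entries of \<open>v\<close> only. With degrees in the natural numbers
  this makes it unsatisfiable for a column of degree zero unless \<open>v\<close> vanishes, which the relation
  excludes.
\<close>

lemma minimal_columns_no_smaller:
  fixes A P :: "'a::field poly mat"
  assumes A: "A \<in> carrier_mat m n" and P: "P \<in> carrier_mat m r" and M: "minimal_columns A P"
    and v: "v \<in> carrier_vec m" and q: "q \<noteq> 0" and z: "z \<in> carrier_vec r"
    and eq: "q \<cdot>\<^sub>v v = P *\<^sub>v z" and i: "i < r" "z $ i \<noteq> 0"
    and small: "\<And>a. a < m \<Longrightarrow> v $ a \<noteq> 0 \<Longrightarrow> degree (v $ a) < vec_degree (col P i)"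
  shows False
proof -
  let ?C = "mat m r (\<lambda>(a, j). if j = i then v $ a else P $$ (a, j))"
  have b: "column_basis A P" using M by (simp add: minimal_columns_def)
  have "column_basis A ?C" by (rule column_exchange[OF A P b v q z eq i])
  hence le: "(\<Sum>j<r. vec_degree (col P j)) \<le> (\<Sum>j<r. vec_degree (col ?C j))"
    using M P unfolding minimal_columns_def by auto
  have rem: "(\<Sum>j<r. f j) = f i + (\<Sum>j\<in>{..<r} - {i}. f j)" for f :: "nat \<Rightarrow> nat"
    using i by (intro sum.remove) auto
  have "col ?C j = col P j" if "j \<in> {..<r} - {i}" for j using that P by (intro eq_vecI) auto
  hence "(\<Sum>j\<in>{..<r} - {i}. vec_degree (col ?C j)) = (\<Sum>j\<in>{..<r} - {i}. vec_degree (col P j))"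
    by (intro sum.cong) auto
  moreover have "col ?C i = v" using i v by (intro eq_vecI) auto
  ultimately have deg: "vec_degree (col P i) \<le> vec_degree v"
    using le unfolding rem[of "\<lambda>j. vec_degree (col P j)"] rem[of "\<lambda>j. vec_degree (col ?C j)"] by simp
  have "v \<noteq> 0\<^sub>v m"
  proof
    assume "v = 0\<^sub>v m"
    hence "P *\<^sub>v z = 0\<^sub>v m" unfolding eq[symmetric] by (auto intro!: eq_vecI)
    hence "z = 0\<^sub>v r" using b by (intro col_injectiveD[OF _ P z]) (auto simp: column_basis_def)
    thus False using i by simp
  qed
  then obtain a where a: "a < m" "v $ a \<noteq> 0" using v by (auto simp: vec_eq_iff)
  hence pos: "0 < vec_degree (col P i)" using small[OF a] by simp
  have "0 < m" using a by simp
  then obtain a' where a': "a' < m" "degree (v $ a') = vec_degree v" by (rule vec_degree_attained[OF v])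
  hence "v $ a' \<noteq> 0" using deg pos by auto
  thus False using small[OF a'(1)] a'(2) deg by simp
qed

lemma exists_max_support:
  fixes \<kappa> :: "nat \<Rightarrow> nat"
  assumes z: "z \<in> carrier_vec r" "z \<noteq> 0\<^sub>v r"
  obtains i where "i < r" "z $ i \<noteq> 0" "\<And>j. j < r \<Longrightarrow> z $ j \<noteq> 0 \<Longrightarrow> \<kappa> j \<le> \<kappa> i"
proof -
  let ?S = "{j. j < r \<and> z $ j \<noteq> 0}"
  have ne: "\<kappa> ` ?S \<noteq> {}" using z by (auto simp: vec_eq_iff)
  have fin: "finite (\<kappa> ` ?S)" by simp
  obtain i where i: "i \<in> ?S" "\<kappa> i = Max (\<kappa> ` ?S)" using Max_in[OF fin ne] by (metis (no_types, lifting) imageE)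
  show ?thesis using that[of i] i fin by auto
qed

text \<open>
  A denominator could be lowered by division with remainder, which would create a vector of
  smaller degree.
\<close>

lemma minimal_columns_generate:
  fixes A P :: "'a::field poly mat"
  assumes A: "A \<in> carrier_mat m n" and P: "P \<in> carrier_mat m r" and M: "minimal_columns A P"
    and v: "v \<in> rational_span A"
  obtains x where "x \<in> carrier_vec r" "v = P *\<^sub>v x"
proof -
  have b: "column_basis A P" using M by (simp add: minimal_columns_def)
  hence "v \<in> rational_span P" using v by (simp add: column_basis_def)
  then obtain q x where qx: "v \<in> carrier_vec m" "q \<noteq> 0" "x \<in> carrier_vec r" "q \<cdot>\<^sub>v v = P *\<^sub>v x"
    using P unfolding rational_span_def by auto
  define y where "y = vec r (\<lambda>j. x $ j div q)"
  define z where "z = vec r (\<lambda>j. x $ j mod q)"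
  have yz: "y \<in> carrier_vec r" "z \<in> carrier_vec r" by (auto simp: y_def z_def)
  have x: "x = q \<cdot>\<^sub>v y + z" using qx(3) by (intro eq_vecI) (auto simp: y_def z_def)
  define v' where "v' = v - P *\<^sub>v y"
  have v': "v' \<in> carrier_vec m" unfolding v'_def
    by (rule minus_carrier_vec[OF qx(1) mult_mat_vec_carrier[OF P yz(1)]])
  have Px: "P *\<^sub>v x = q \<cdot>\<^sub>v (P *\<^sub>v y) + P *\<^sub>v z"
  proof -
    have "P *\<^sub>v x = P *\<^sub>v (q \<cdot>\<^sub>v y) + P *\<^sub>v z" unfolding x
      by (rule mult_add_distrib_mat_vec[OF P]) (use yz in auto)
    thus ?thesis unfolding mult_mat_smult_vec[OF P yz(1)] .
  qed
  have eq: "q \<cdot>\<^sub>v v' = P *\<^sub>v z"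
  proof (rule eq_vecI)
    fix a assume "a < dim_vec (P *\<^sub>v z)"
    hence a: "a < m" using P by simp
    have "q * v $ a = q * (P *\<^sub>v y) $ a + (P *\<^sub>v z) $ a"
      using arg_cong[OF qx(4)[unfolded Px], of "\<lambda>w. w $ a"] a qx(1) P by simp
    thus "(q \<cdot>\<^sub>v v') $ a = (P *\<^sub>v z) $ a" using a qx(1) P by (simp add: v'_def algebra_simps)
  qed (use P v' in simp)
  have "z = 0\<^sub>v r"
  proof (rule ccontr)
    assume "z \<noteq> 0\<^sub>v r"
    then obtain i where i: "i < r" "z $ i \<noteq> 0"
      "\<And>j. j < r \<Longrightarrow> z $ j \<noteq> 0 \<Longrightarrow> vec_degree (col P j) \<le> vec_degree (col P i)"
      by (rule exists_max_support[OF yz(2), where \<kappa>="\<lambda>j. vec_degree (col P j)"]) blast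
    have dz: "degree (z $ j) < degree q" if "j < r" "z $ j \<noteq> 0" for j
      using degree_mod_less[OF qx(2), of "x $ j"] that by (auto simp: z_def)
    have "degree (v' $ a) < vec_degree (col P i)" if a: "a < m" "v' $ a \<noteq> 0" for a
    proof -
      have "q * v' $ a = (\<Sum>j<r. P $$ (a, j) * z $ j)"
        using arg_cong[OF eq, of "\<lambda>w. w $ a"] a v' mult_mat_vec_index[OF P yz(2) a(1)] by simp
      moreover have "degree (\<Sum>j<r. P $$ (a, j) * z $ j) \<le> vec_degree (col P i) + (degree q - 1)"
      proof (rule degree_sum_le)
        fix j assume "j \<in> {..<r}"
        hence j: "j < r" by simp
        show "degree (P $$ (a, j) * z $ j) \<le> vec_degree (col P i) + (degree q - 1)"
        proof (cases "z $ j = 0")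
          case False
          have "degree (P $$ (a, j)) \<le> vec_degree (col P j)"
            using degree_le_vec_degree[of "col P j" m a] P a j by simp
          thus ?thesis using degree_mult_le[of "P $$ (a, j)" "z $ j"] i(3)[OF j False] dz[OF j False] by linarith
        qed simp
      qed simp
      moreover have "degree (q * v' $ a) = degree q + degree (v' $ a)"
        using qx(2) a(2) by (rule degree_mult_eq)
      ultimately have "degree q + degree (v' $ a) \<le> vec_degree (col P i) + (degree q - 1)" by simp
      thus ?thesis using dz[OF i(1,2)] by linarith
    qed
    from minimal_columns_no_smaller[OF A P M v' qx(2) yz(2) eq i(1,2) this] show False .
  qed
  hence "q \<cdot>\<^sub>v v = q \<cdot>\<^sub>v (P *\<^sub>v y)" using qx(4) Px P yz(1) by (auto intro!: eq_vecI)
  have "v = P *\<^sub>v y"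
  proof (rule eq_vecI)
    fix a assume a: "a < dim_vec (P *\<^sub>v y)"
    hence "q * v $ a = q * (P *\<^sub>v y) $ a"
      using arg_cong[OF \<open>q \<cdot>\<^sub>v v = q \<cdot>\<^sub>v (P *\<^sub>v y)\<close>, of "\<lambda>w. w $ a"] qx(1) P by simp
    thus "v $ a = (P *\<^sub>v y) $ a" using qx(2) by simp
  qed (use qx(1) P in simp)
  thus ?thesis by (rule that[OF yz(1)])
qed

text \<open>
  The matrix of leading coefficients of the columns, relative to prescribed degrees \<open>k j\<close> that may
  exceed the true ones.
\<close>

definition lead_mat :: "'a::field poly mat \<Rightarrow> (nat \<Rightarrow> nat) \<Rightarrow> 'a mat" where
  "lead_mat P k = mat (dim_row P) (dim_col P) (\<lambda>(a, j). coeff (P $$ (a, j)) (k j))"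

lemma lead_mat_carrier: "P \<in> carrier_mat m r \<Longrightarrow> lead_mat P k \<in> carrier_mat m r"
  by (simp add: lead_mat_def)

lemma coeff_mult_at_bounds:
  assumes "degree p \<le> a" "degree q \<le> b"
  shows "coeff (p * q) (a + b) = coeff p a * coeff (q :: 'a::field poly) b"
  using arg_cong[OF moebius_mult[OF assms, of 1 "[:0, 1:]"], of "\<lambda>p. poly p 0"]
  by (simp add: rev_poly_moebius[symmetric] poly_rev_poly_0)

text \<open>
  A relation between the leading coefficients, multiplied by suitable powers of the variable,
  gives a combination of the columns in which the terms of top degree cancel. It could replace
  the column of largest degree that it involves.
\<close>

lemma minimal_columns_lead_injective:
  fixes A P :: "'a::field poly mat"
  assumes A: "A \<in> carrier_mat m n" and P: "P \<in> carrier_mat m r" and M: "minimal_columns A P"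
  shows "col_injective (lead_mat P (\<lambda>j. vec_degree (col P j)))"
proof (rule col_injectiveI[OF lead_mat_carrier[OF P]], rule ccontr)
  let ?k = "\<lambda>j. vec_degree (col P j)"
  fix c assume c: "c \<in> carrier_vec r" "lead_mat P ?k *\<^sub>v c = 0\<^sub>v m" "c \<noteq> 0\<^sub>v r"
  obtain i where i: "i < r" "c $ i \<noteq> 0" "\<And>j. j < r \<Longrightarrow> c $ j \<noteq> 0 \<Longrightarrow> ?k j \<le> ?k i"
    by (rule exists_max_support[OF c(1,3), where \<kappa>="?k"]) blast
  define z where "z = vec r (\<lambda>j. monom (c $ j) (?k i - ?k j))"
  have z: "z \<in> carrier_vec r" "z $ i \<noteq> 0" using i by (auto simp: z_def)
  have Pd: "degree (P $$ (a, j)) \<le> ?k j" if "a < m" "j < r" for a j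
    using degree_le_vec_degree[of "col P j" m a] P that by simp
  have Pz: "P *\<^sub>v z \<in> carrier_vec m" by (rule mult_mat_vec_carrier[OF P z(1)])
  have "degree ((P *\<^sub>v z) $ a) < ?k i" if a: "a < m" "(P *\<^sub>v z) $ a \<noteq> 0" for a
  proof -
    have e: "(P *\<^sub>v z) $ a = (\<Sum>j<r. P $$ (a, j) * z $ j)" by (rule mult_mat_vec_index[OF P z(1) a(1)])
    have t: "degree (P $$ (a, j) * z $ j) \<le> ?k i \<and> coeff (P $$ (a, j) * z $ j) (?k i) = coeff (P $$ (a, j)) (?k j) * c $ j"
      if j: "j < r" for j
    proof (cases "c $ j = 0")
      case True thus ?thesis using j by (simp add: z_def)
    next
      case False
      have k: "?k j \<le> ?k i" by (rule i(3)[OF j False])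
      have dz: "degree (z $ j) \<le> ?k i - ?k j" using j by (simp add: z_def degree_monom_le)
      have "coeff (P $$ (a, j) * z $ j) (?k j + (?k i - ?k j)) = coeff (P $$ (a, j)) (?k j) * coeff (z $ j) (?k i - ?k j)"
        by (rule coeff_mult_at_bounds[OF Pd[OF a(1) j] dz])
      moreover have "degree (P $$ (a, j) * z $ j) \<le> ?k j + (?k i - ?k j)"
        using degree_mult_le[of "P $$ (a, j)" "z $ j"] Pd[OF a(1) j] dz by linarith
      ultimately show ?thesis using k j by (simp add: z_def)
    qed
    have le: "degree ((P *\<^sub>v z) $ a) \<le> ?k i" unfolding e by (rule degree_sum_le) (use t in auto)
    have "coeff ((P *\<^sub>v z) $ a) (?k i) = (\<Sum>j<r. coeff (P $$ (a, j)) (?k j) * c $ j)"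
      unfolding e coeff_sum using t by (intro sum.cong) auto
    moreover have "(\<Sum>j<r. coeff (P $$ (a, j)) (?k j) * c $ j) = (lead_mat P ?k *\<^sub>v c) $ a"
      unfolding mult_mat_vec_index[OF lead_mat_carrier[OF P] c(1) a(1)]
      using P a by (intro sum.cong) (auto simp: lead_mat_def)
    ultimately have zero: "coeff ((P *\<^sub>v z) $ a) (?k i) = 0" unfolding c(2) using a(1) by simp
    show ?thesis
    proof (rule ccontr)
      assume "\<not> ?thesis"
      hence "degree ((P *\<^sub>v z) $ a) = ?k i" using le by simp
      hence "lead_coeff ((P *\<^sub>v z) $ a) = 0" using zero by simp
      thus False using a(2) by simp
    qed
  qed
  from minimal_columns_no_smaller[OF A P M Pz one_neq_zero z(1) _ i(1) z(2) this] show False by simp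
qed

text \<open>Injectivity of the leading coefficients prevents cancellation of the terms of top degree.\<close>

lemma predictable_degree:
  fixes P :: "'a::field poly mat"
  assumes P: "P \<in> carrier_mat m r" and inj: "col_injective (lead_mat P k)"
    and Pd: "\<And>a j. a < m \<Longrightarrow> j < r \<Longrightarrow> degree (P $$ (a, j)) \<le> k j"
    and x: "x \<in> carrier_vec r" and D: "\<And>a. a < m \<Longrightarrow> degree ((P *\<^sub>v x) $ a) \<le> D"
    and j: "j < r" "x $ j \<noteq> 0"
  shows "k j + degree (x $ j) \<le> D"
proof -
  have "x \<noteq> 0\<^sub>v r" using j by auto
  then obtain i where i: "i < r" "x $ i \<noteq> 0"
    "\<And>j. j < r \<Longrightarrow> x $ j \<noteq> 0 \<Longrightarrow> k j + degree (x $ j) \<le> k i + degree (x $ i)"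
    by (rule exists_max_support[OF x, where \<kappa>="\<lambda>j. k j + degree (x $ j)"]) blast
  let ?N = "k i + degree (x $ i)"
  define c where "c = vec r (\<lambda>j. if x $ j = 0 then 0 else coeff (x $ j) (?N - k j))"
  have c: "c \<in> carrier_vec r" "c $ i \<noteq> 0" using i by (auto simp: c_def)
  have "lead_mat P k *\<^sub>v c \<noteq> 0\<^sub>v m"
    using col_injectiveD[OF inj lead_mat_carrier[OF P] c(1)] c(2) i(1) by auto
  then obtain a where a: "a < m" "(lead_mat P k *\<^sub>v c) $ a \<noteq> 0"
    using lead_mat_carrier[OF P, of k] by (auto simp: vec_eq_iff)
  have t: "coeff (P $$ (a, j) * x $ j) ?N = coeff (P $$ (a, j)) (k j) * c $ j" if j: "j < r" for j
  proof (cases "x $ j = 0")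
    case True thus ?thesis using j by (simp add: c_def)
  next
    case False
    have k: "k j + degree (x $ j) \<le> ?N" by (rule i(3)[OF j False])
    hence "coeff (P $$ (a, j) * x $ j) (k j + (?N - k j)) = coeff (P $$ (a, j)) (k j) * coeff (x $ j) (?N - k j)"
      by (intro coeff_mult_at_bounds Pd[OF a(1) j]) linarith
    thus ?thesis using k j False by (simp add: c_def)
  qed
  have "coeff ((P *\<^sub>v x) $ a) ?N = (\<Sum>j<r. coeff (P $$ (a, j)) (k j) * c $ j)"
    unfolding mult_mat_vec_index[OF P x a(1)] coeff_sum using t by (intro sum.cong) auto
  also have "\<dots> = (lead_mat P k *\<^sub>v c) $ a"
    unfolding mult_mat_vec_index[OF lead_mat_carrier[OF P] c(1) a(1)]
    using P a by (intro sum.cong) (auto simp: lead_mat_def)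
  finally have "?N \<le> degree ((P *\<^sub>v x) $ a)" using a(2) le_degree by metis
  thus ?thesis using D[OF a(1)] i(3)[OF j] by linarith
qed

section \<open>Factorizations through minimal bases\<close>

definition top_rows :: "nat \<Rightarrow> 'b mat \<Rightarrow> 'b mat" where
  "top_rows r A = mat r (dim_col A) (\<lambda>(i, j). A $$ (i, j))"

definition bottom_zero :: "nat \<Rightarrow> 'b::zero mat \<Rightarrow> bool" where
  "bottom_zero r A \<longleftrightarrow> (\<forall>i j. r \<le> i \<longrightarrow> i < dim_row A \<longrightarrow> j < dim_col A \<longrightarrow> A $$ (i, j) = 0)"

lemma top_rows_carrier: "A \<in> carrier_mat m n \<Longrightarrow> top_rows r A \<in> carrier_mat r n"
  by (simp add: top_rows_def)

lemma top_rows_mult: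
  fixes A B :: "'b::comm_ring_1 mat"
  assumes "A \<in> carrier_mat m n" "B \<in> carrier_mat n k" "r \<le> m"
  shows "top_rows r A * B = top_rows r (A * B)"
  by (rule eq_matI) (use assms in \<open>auto simp: top_rows_def scalar_prod_def\<close>)

lemma mult_mat_index:
  fixes A B :: "'b::comm_ring_1 mat"
  assumes "A \<in> carrier_mat m n" "B \<in> carrier_mat n k" "i < m" "j < k"
  shows "(A * B) $$ (i, j) = (\<Sum>l<n. A $$ (i, l) * B $$ (l, j))"
  using assms by (simp add: scalar_prod_def atLeast0LessThan)

lemma bottom_zero_mult_vec:
  fixes X :: "'b::comm_ring_1 mat"
  assumes X: "X \<in> carrier_mat m n" and bz: "bottom_zero r X" and c: "c \<in> carrier_vec n"
    and 0: "top_rows r X *\<^sub>v c = 0\<^sub>v r"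
  shows "X *\<^sub>v c = 0\<^sub>v m"
proof (rule eq_vecI)
  fix i assume "i < dim_vec (0\<^sub>v m :: 'b vec)"
  hence i: "i < m" by simp
  have e: "(X *\<^sub>v c) $ i = (\<Sum>j<n. X $$ (i, j) * c $ j)" by (rule mult_mat_vec_index[OF X c i])
  have "(X *\<^sub>v c) $ i = 0"
  proof (cases "i < r")
    case True
    have "(top_rows r X *\<^sub>v c) $ i = (\<Sum>j<n. top_rows r X $$ (i, j) * c $ j)"
      by (rule mult_mat_vec_index[OF top_rows_carrier[OF X] c True])
    also have "\<dots> = (\<Sum>j<n. X $$ (i, j) * c $ j)" using True X by (intro sum.cong) (auto simp: top_rows_def)
    finally show ?thesis unfolding e 0 using True by simp
  next
    case False
    thus ?thesis unfolding e using bz i X by (intro sum.neutral) (auto simp: bottom_zero_def)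
  qed
  thus "(X *\<^sub>v c) $ i = 0\<^sub>v m $ i" using i by simp
qed (use X in simp)

lemma diag_rect_mult_bottom_zero:
  fixes Z :: "'b::comm_ring_1 mat"
  assumes Z: "Z \<in> carrier_mat n k" and len: "length \<gamma>s \<le> r"
  shows "bottom_zero r (diag_rect_mat m n \<gamma>s * Z)"
  unfolding bottom_zero_def
proof (intro allI impI)
  fix i j assume i: "r \<le> i" "i < dim_row (diag_rect_mat m n \<gamma>s * Z)" and j: "j < dim_col (diag_rect_mat m n \<gamma>s * Z)"
  have "(diag_rect_mat m n \<gamma>s * Z) $$ (i, j) = (\<Sum>l\<in>{0..<n}. diag_rect_mat m n \<gamma>s $$ (i, l) * Z $$ (l, j))"
    using i j Z by (simp add: scalar_prod_def diag_rect_mat_def)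
  also have "\<dots> = 0" using i len by (intro sum.neutral) (auto simp: diag_rect_mat_def)
  finally show "(diag_rect_mat m n \<gamma>s * Z) $$ (i, j) = 0" .
qed

text \<open>The left factor of the Smith form does this, since the right factor does not affect zero rows.\<close>

lemma row_compression:
  fixes P :: "'a::field poly mat"
  assumes P: "P \<in> carrier_mat m r"
  obtains U where "unimodular m U" "bottom_zero r (U * P)"
proof -
  obtain \<gamma>s where g: "length \<gamma>s \<le> min m r" "smith_equiv m r P (diag_rect_mat m r \<gamma>s)"
    using smith_form_exists[OF P] by blast
  then obtain U V where UV: "unimodular m U" "unimodular r V" "diag_rect_mat m r \<gamma>s = U * P * V"
    unfolding smith_equiv_def by blast
  obtain W where W: "W \<in> carrier_mat r r" "V * W = 1\<^sub>m r" using unimodular_inverse[OF UV(2)] by blast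
  have c: "U \<in> carrier_mat m m" "V \<in> carrier_mat r r" using UV by (auto simp: unimodular_def)
  have UP: "U * P \<in> carrier_mat m r" using c P by simp
  have "diag_rect_mat m r \<gamma>s * W = U * P * (V * W)"
    unfolding UV(3) by (rule assoc_mult_mat[OF UP c(2) W(1)])
  also have "\<dots> = U * P" unfolding W(2) by (rule right_mult_one_mat[OF UP])
  finally have "bottom_zero r (U * P)" using diag_rect_mult_bottom_zero[OF W(1), of \<gamma>s r m] g(1) by simp
  thus ?thesis by (rule that[OF UV(1)])
qed

text \<open>
  A unimodular matrix stays invertible after the evaluation at \<open>a\<close>, and only the top rows of the
  compressed matrix carry information.
\<close>

lemma det_top_rows_nonzero_at:
  fixes P :: "'a::field poly mat"
  assumes P: "P \<in> carrier_mat m r" and r: "r \<le> m" and U: "unimodular m U" and bz: "bottom_zero r (U * P)"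
    and inj: "col_injective (map_mat (\<lambda>p. poly p a) P)"
  shows "poly (det (top_rows r (U * P))) a \<noteq> 0"
proof
  interpret ev: comm_ring_hom "\<lambda>p::'a poly. poly p a" by unfold_locales auto
  assume z: "poly (det (top_rows r (U * P))) a = 0"
  obtain W where W: "W \<in> carrier_mat m m" "W * U = 1\<^sub>m m" using unimodular_inverse[OF U] by blast
  have c: "U \<in> carrier_mat m m" using U by (simp add: unimodular_def)
  have UP: "U * P \<in> carrier_mat m r" using c P by simp
  let ?ev = "map_mat (\<lambda>p::'a poly. poly p a)"
  have tc: "?ev (top_rows r (U * P)) \<in> carrier_mat r r" using top_rows_carrier[OF UP] by simp
  have "det (?ev (top_rows r (U * P))) = 0" using z ev.hom_det by simp
  then obtain v where v: "v \<in> carrier_vec r" "v \<noteq> 0\<^sub>v r" "?ev (top_rows r (U * P)) *\<^sub>v v = 0\<^sub>v r"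
    using det_0_iff_vec_prod_zero[OF tc] by blast
  have "?ev (top_rows r (U * P)) = top_rows r (?ev (U * P))"
    by (rule eq_matI) (use UP r in \<open>auto simp: top_rows_def\<close>)
  moreover have "bottom_zero r (?ev (U * P))"
    using bz unfolding bottom_zero_def by auto
  ultimately have "?ev (U * P) *\<^sub>v v = 0\<^sub>v m"
    using v UP by (intro bottom_zero_mult_vec[of _ m r]) auto
  moreover have "?ev (U * P) = ?ev U * ?ev P" by (rule ev.mat_hom_mult[OF c P])
  ultimately have e: "?ev U *\<^sub>v (?ev P *\<^sub>v v) = 0\<^sub>v m"
    using c P v(1) assoc_mult_mat_vec[of "?ev U" m m "?ev P" r v] by simp
  have "?ev W * ?ev U = 1\<^sub>m m"
    unfolding ev.mat_hom_mult[OF W(1) c, symmetric] W(2) by (rule ev.mat_hom_one)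
  hence "?ev P *\<^sub>v v = ?ev W *\<^sub>v (?ev U *\<^sub>v (?ev P *\<^sub>v v))"
    using c P v(1) W(1) by (subst assoc_mult_mat_vec[symmetric, of _ m m _ m]) auto
  also have "\<dots> = 0\<^sub>v m" unfolding e using W(1) by (intro eq_vecI) auto
  finally have "?ev P *\<^sub>v v = 0\<^sub>v m" .
  hence "v = 0\<^sub>v r" using P by (intro col_injectiveD[OF inj _ v(1)]) auto
  thus False using v(2) by simp
qed

lemma det_top_rows_nonzero:
  fixes P :: "'a::field poly mat"
  assumes P: "P \<in> carrier_mat m r" and r: "r \<le> m" and U: "unimodular m U" and bz: "bottom_zero r (U * P)"
    and inj: "col_injective P"
  shows "det (top_rows r (U * P)) \<noteq> 0"
proof
  assume z: "det (top_rows r (U * P)) = 0"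
  obtain W where W: "W \<in> carrier_mat m m" "W * U = 1\<^sub>m m" using unimodular_inverse[OF U] by blast
  have c: "U \<in> carrier_mat m m" using U by (simp add: unimodular_def)
  have UP: "U * P \<in> carrier_mat m r" using c P by simp
  obtain v where v: "v \<in> carrier_vec r" "v \<noteq> 0\<^sub>v r" "top_rows r (U * P) *\<^sub>v v = 0\<^sub>v r"
    using z det_0_iff_vec_prod_zero[OF top_rows_carrier[OF UP]] by blast
  have "U * P *\<^sub>v v = 0\<^sub>v m" by (rule bottom_zero_mult_vec[OF UP bz v(1,3)])
  hence e: "U *\<^sub>v (P *\<^sub>v v) = 0\<^sub>v m" using assoc_mult_mat_vec[OF c P v(1)] by simp
  have Pv: "P *\<^sub>v v \<in> carrier_vec m" by (rule mult_mat_vec_carrier[OF P v(1)])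
  have "P *\<^sub>v v = W *\<^sub>v (U *\<^sub>v (P *\<^sub>v v))"
    unfolding assoc_mult_mat_vec[OF W(1) c Pv, symmetric] W(2) using Pv by simp
  also have "\<dots> = 0\<^sub>v m" unfolding e using W(1) by (intro eq_vecI) auto
  finally have "v = 0\<^sub>v r" by (intro col_injectiveD[OF inj P v(1)])
  thus False using v(2) by simp
qed

lemma quasi_left_inverse:
  fixes P :: "'a::field poly mat"
  assumes P: "P \<in> carrier_mat m r" and r: "r \<le> m" and inj: "col_injective P"
  obtains G p where "G \<in> carrier_mat r m" "p \<noteq> 0" "G * P = p \<cdot>\<^sub>m 1\<^sub>m r"
proof -
  obtain U where U: "unimodular m U" "bottom_zero r (U * P)" by (rule row_compression[OF P])
  have c: "U \<in> carrier_mat m m" using U by (simp add: unimodular_def)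
  have UP: "U * P \<in> carrier_mat m r" using c P by simp
  let ?T = "top_rows r (U * P)"
  have T: "?T \<in> carrier_mat r r" by (rule top_rows_carrier[OF UP])
  have tu: "top_rows r U \<in> carrier_mat r m" by (rule top_rows_carrier[OF c])
  have "adj_mat ?T * top_rows r U * P = adj_mat ?T * (top_rows r U * P)"
    by (rule assoc_mult_mat[OF adj_mat(1)[OF T] tu P])
  also have "\<dots> = det ?T \<cdot>\<^sub>m 1\<^sub>m r" unfolding top_rows_mult[OF c P r] by (rule adj_mat(3)[OF T])
  finally show ?thesis
    using that[of "adj_mat ?T * top_rows r U" "det ?T"] adj_mat(1)[OF T] tu
      det_top_rows_nonzero[OF P r U inj] by auto
qed

lemma left_inverse_imp_injective:
  fixes P :: "'b::idom mat"
  assumes P: "P \<in> carrier_mat m r" and G: "G \<in> carrier_mat r m" "G * P = p \<cdot>\<^sub>m 1\<^sub>m r" and p: "p \<noteq> 0"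
  shows "col_injective P"
proof (rule col_injectiveI[OF P])
  fix c assume c: "c \<in> carrier_vec r" "P *\<^sub>v c = 0\<^sub>v m"
  have "p \<cdot>\<^sub>v c = (p \<cdot>\<^sub>m 1\<^sub>m r) *\<^sub>v c" using c(1) by (intro eq_vecI) (auto simp: smult_scalar_prod_distrib[of _ r])
  also have "\<dots> = G *\<^sub>v (P *\<^sub>v c)" unfolding G(2)[symmetric] by (rule assoc_mult_mat_vec[OF G(1) P c(1)])
  also have "\<dots> = 0\<^sub>v r" unfolding c(2) using G by (intro eq_vecI) auto
  finally have e: "p \<cdot>\<^sub>v c = 0\<^sub>v r" .
  show "c = 0\<^sub>v r"
  proof (rule eq_vecI)
    fix j assume "j < dim_vec (0\<^sub>v r :: 'b vec)"
    thus "c $ j = 0\<^sub>v r $ j" using arg_cong[OF e, of "\<lambda>w. w $ j"] c(1) p by simp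
  qed (use c in simp)
qed

lemma col_mult_mat_vec:
  fixes P :: "'b::comm_ring_1 mat"
  assumes "P \<in> carrier_mat m r" "S \<in> carrier_mat r k" "j < k"
  shows "col (P * S) j = P *\<^sub>v col S j"
  using assms by (intro eq_vecI) auto

lemma mat_eq_by_cols:
  assumes "A \<in> carrier_mat m n" "B \<in> carrier_mat m n" "\<And>j. j < n \<Longrightarrow> col A j = col B j"
  shows "A = B"
proof (rule eq_matI)
  fix i j assume ij: "i < dim_row B" "j < dim_col B"
  have "A $$ (i, j) = col A j $ i" using assms(1,2) ij by simp
  also have "\<dots> = col B j $ i" using assms ij by simp
  finally show "A $$ (i, j) = B $$ (i, j)" using ij by simp
qed (use assms in auto)

lemma cols_in_image:
  fixes P B :: "'b::comm_ring_1 mat"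
  assumes P: "P \<in> carrier_mat m r" and B: "B \<in> carrier_mat m k"
    and ex: "\<And>j. j < k \<Longrightarrow> \<exists>x. x \<in> carrier_vec r \<and> col B j = P *\<^sub>v x"
  obtains S where "S \<in> carrier_mat r k" "B = P * S"
proof -
  obtain x where x: "\<And>j. j < k \<Longrightarrow> x j \<in> carrier_vec r \<and> col B j = P *\<^sub>v x j" using ex by metis
  define S where "S = mat r k (\<lambda>(i, j). x j $ i)"
  have S: "S \<in> carrier_mat r k" by (simp add: S_def)
  have "col S j = x j" if "j < k" for j using x[OF that] that by (intro eq_vecI) (auto simp: S_def)
  hence "B = P * S"
    using x by (intro mat_eq_by_cols[OF B mult_carrier_mat[OF P S]]) (simp add: col_mult_mat_vec[OF P S])
  thus ?thesis by (rule that[OF S])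
qed

lemma right_inverse_imp_left_inverse:
  fixes T S :: "'a::field poly mat"
  assumes T: "T \<in> carrier_mat r r" and S: "S \<in> carrier_mat r r" and TS: "T * S = 1\<^sub>m r"
  shows "S * T = 1\<^sub>m r"
proof -
  have "det T * det S = 1" using det_mult[OF T S] unfolding TS by simp
  hence "unimodular r T" using T unfolding unimodular_def by (metis dvd_triv_left)
  then obtain W where W: "W \<in> carrier_mat r r" "T * W = 1\<^sub>m r" "W * T = 1\<^sub>m r" by (rule unimodular_inverse)
  have "W = W * (T * S)" unfolding TS using right_mult_one_mat[OF W(1)] by simp
  also have "\<dots> = S" unfolding assoc_mult_mat[OF W(1) T S, symmetric] W(3) by (rule left_mult_one_mat[OF S])
  finally show ?thesis using W(3) by simp
qed

text \<open>
  Let \<open>U\<close> compress \<open>P\<close> to a square matrix \<open>T\<close>. The first columns \<open>B\<close> of \<open>U\<^sup>-\<^sup>1\<close> satisfy \<open>P = B T\<close>, hence span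
  the same space, hence are polynomial combinations of the columns of \<open>P\<close> by minimality. So \<open>T\<close>
  has a polynomial inverse.
\<close>

lemma minimal_columns_left_inverse:
  fixes A P :: "'a::field poly mat"
  assumes A: "A \<in> carrier_mat m n" and P: "P \<in> carrier_mat m r" and M: "minimal_columns A P" and r: "r \<le> m"
  obtains G where "G \<in> carrier_mat r m" "G * P = 1\<^sub>m r"
proof -
  have b: "col_injective P" "rational_span P = rational_span A"
    using M by (auto simp: minimal_columns_def column_basis_def)
  obtain U where U: "unimodular m U" "bottom_zero r (U * P)" by (rule row_compression[OF P])
  obtain W where W: "W \<in> carrier_mat m m" "U * W = 1\<^sub>m m" "W * U = 1\<^sub>m m" by (rule unimodular_inverse[OF U(1)])
  have c: "U \<in> carrier_mat m m" using U by (simp add: unimodular_def)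
  have UP: "U * P \<in> carrier_mat m r" using c P by simp
  let ?T = "top_rows r (U * P)"
  have T: "?T \<in> carrier_mat r r" by (rule top_rows_carrier[OF UP])
  have T0: "det ?T \<noteq> 0" by (rule det_top_rows_nonzero[OF P r U b(1)])
  have tu: "top_rows r U \<in> carrier_mat r m" by (rule top_rows_carrier[OF c])
  define B where "B = mat m r (\<lambda>(i, j). W $$ (i, j))"
  have B: "B \<in> carrier_mat m r" by (simp add: B_def)
  have BT: "B * ?T = P"
  proof -
    have "W * (U * P) = W * U * P" by (rule assoc_mult_mat[OF W(1) c P, symmetric])
    also have "\<dots> = P" unfolding W(3) using P by simp
    finally have WUP: "W * (U * P) = P" .
    have "(B * ?T) $$ (i, j) = (W * (U * P)) $$ (i, j)" if ij: "i < m" "j < r" for i j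
    proof -
      let ?X = "U * P"
      have xd: "dim_row ?X = m" "dim_col ?X = r" using UP by auto
      have "(W * ?X) $$ (i, j) = (\<Sum>l<m. W $$ (i, l) * ?X $$ (l, j))"
        by (rule mult_mat_index[OF W(1) UP ij])
      also have "\<dots> = (\<Sum>l<r. W $$ (i, l) * ?X $$ (l, j))"
      proof (rule sum.mono_neutral_right)
        show "\<forall>l\<in>{..<m} - {..<r}. W $$ (i, l) * ?X $$ (l, j) = 0"
        proof
          fix l assume "l \<in> {..<m} - {..<r}"
          hence "?X $$ (l, j) = 0" using U(2) ij(2) xd unfolding bottom_zero_def by simp
          thus "W $$ (i, l) * ?X $$ (l, j) = 0" by simp
        qed
      qed (use r in auto)
      also have "\<dots> = (\<Sum>l<r. B $$ (i, l) * ?T $$ (l, j))"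
      proof (rule sum.cong[OF refl])
        fix l assume "l \<in> {..<r}"
        hence l: "l < r" by simp
        have "?T $$ (l, j) = ?X $$ (l, j)" unfolding top_rows_def using l ij(2) xd(2) by (subst index_mat) auto
        moreover have "B $$ (i, l) = W $$ (i, l)" unfolding B_def using l ij(1) by simp
        ultimately show "W $$ (i, l) * ?X $$ (l, j) = B $$ (i, l) * ?T $$ (l, j)" by simp
      qed
      also have "\<dots> = (B * ?T) $$ (i, j)" by (rule mult_mat_index[OF B T ij, symmetric])
      finally show ?thesis ..
    qed
    hence "B * ?T = W * (U * P)"
      using carrier_matD[OF mult_carrier_mat[OF B T]] carrier_matD[OF mult_carrier_mat[OF W(1) UP]]
      by (intro eq_matI) (simp_all only:)
    thus ?thesis unfolding WUP .
  qed
  have "col B j \<in> rational_span A" if j: "j < r" for j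
  proof -
    have "P * adj_mat ?T = B * (?T * adj_mat ?T)"
      using assoc_mult_mat[OF B T adj_mat(1)[OF T]] unfolding BT .
    also have "\<dots> = det ?T \<cdot>\<^sub>m B" unfolding adj_mat(2)[OF T] mult_smult_distrib[OF B one_carrier_mat]
      right_mult_one_mat[OF B] ..
    finally have PB: "P * adj_mat ?T = det ?T \<cdot>\<^sub>m B" .
    have "P *\<^sub>v col (adj_mat ?T) j = col (det ?T \<cdot>\<^sub>m B) j"
      unfolding PB[symmetric] by (rule col_mult_mat_vec[OF P adj_mat(1)[OF T] j, symmetric])
    also have "\<dots> = det ?T \<cdot>\<^sub>v col B j" by (rule eq_vecI) (use B j in auto)
    finally have e: "det ?T \<cdot>\<^sub>v col B j = P *\<^sub>v col (adj_mat ?T) j" ..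
    have cB: "col B j \<in> carrier_vec (dim_row P)" using col_dim[of B j] B P by simp
    have cT: "col (adj_mat ?T) j \<in> carrier_vec (dim_col P)"
      using col_dim[of "adj_mat ?T" j] carrier_matD[OF adj_mat(1)[OF T]] P by simp
    have "col B j \<in> rational_span P" unfolding rational_span_def mem_Collect_eq
      by (intro conjI exI[of _ "det ?T"] exI[of _ "col (adj_mat ?T) j"] cB T0 cT e)
    thus ?thesis unfolding b(2) .
  qed
  hence "\<exists>x. x \<in> carrier_vec r \<and> col B j = P *\<^sub>v x" if "j < r" for j
    using that by (auto elim!: minimal_columns_generate[OF A P M])
  then obtain S where S: "S \<in> carrier_mat r r" "B = P * S" by (rule cols_in_image[OF P B])
  have "top_rows r U * B = 1\<^sub>m r"
  proof (rule eq_matI)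
    fix i j assume "i < dim_row (1\<^sub>m r :: 'a poly mat)" "j < dim_col (1\<^sub>m r :: 'a poly mat)"
    hence ij: "i < r" "j < r" by simp_all
    have "(top_rows r U * B) $$ (i, j) = (U * W) $$ (i, j)"
      using ij r c W(1) by (simp add: top_rows_def B_def scalar_prod_def)
    thus "(top_rows r U * B) $$ (i, j) = 1\<^sub>m r $$ (i, j)" unfolding W(2) using ij r by simp
  qed (use tu B in auto)
  moreover have "top_rows r U * B = ?T * S"
    unfolding S(2) assoc_mult_mat[OF tu P S(1), symmetric] top_rows_mult[OF c P r] ..
  ultimately have TS: "?T * S = 1\<^sub>m r" by simp
  have ST: "S * ?T = 1\<^sub>m r" by (rule right_inverse_imp_left_inverse[OF T S(1) TS])
  have "S * top_rows r U * P = S * (top_rows r U * P)" by (rule assoc_mult_mat[OF S(1) tu P])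
  also have "\<dots> = 1\<^sub>m r" unfolding top_rows_mult[OF c P r] by (rule ST)
  finally show ?thesis using that[of "S * top_rows r U"] S(1) tu by auto
qed

lemma det_nonzero_permutation:
  fixes X :: "'b::idom mat"
  assumes X: "X \<in> carrier_mat r r" and det: "det X \<noteq> 0"
  obtains \<pi> where "\<pi> permutes {0..<r}" "\<And>i. i < r \<Longrightarrow> X $$ (i, \<pi> i) \<noteq> 0"
proof -
  have "\<exists>\<pi>. \<pi> permutes {0..<r} \<and> (\<Prod>i = 0..<r. X $$ (i, \<pi> i)) \<noteq> 0"
  proof (rule ccontr)
    assume "\<not> ?thesis"
    hence "det X = 0" unfolding det_def'[OF X] by (intro sum.neutral) auto
    thus False using det by simp
  qed
  then obtain \<pi> where p: "\<pi> permutes {0..<r}" "(\<Prod>i = 0..<r. X $$ (i, \<pi> i)) \<noteq> 0" by blast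
  have "X $$ (i, \<pi> i) \<noteq> 0" if "i < r" for i using p(2) that by (auto simp: prod_zero_iff)
  thus ?thesis by (rule that[OF p(1)])
qed

text \<open>
  The left inverse shows that any other basis has the form \<open>P X\<close> with \<open>X\<close> polynomial. A nonzero
  term of \<open>det X\<close> matches the columns of \<open>P\<close> with columns of \<open>P X\<close>, whose degrees are at least as
  large by the predictable degree property.
\<close>

lemma minimal_columns_criterion:
  fixes A P :: "'a::field poly mat"
  assumes A: "A \<in> carrier_mat m n" and m: "0 < m" and P: "P \<in> carrier_mat m r" and b: "column_basis A P"
    and G: "G \<in> carrier_mat r m" "G * P = 1\<^sub>m r"
    and inj: "col_injective (lead_mat P k)" and Pd: "\<And>a j. a < m \<Longrightarrow> j < r \<Longrightarrow> degree (P $$ (a, j)) \<le> k j"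
  shows "minimal_columns A P"
  unfolding minimal_columns_def
proof (intro conjI allI impI)
  show "column_basis A P" by (rule b)
  fix C assume C: "column_basis A C"
  have dim: "dim_col C = r" using column_basis_cols(2)[OF A b] column_basis_cols(2)[OF A C] P by simp
  have Cc: "C \<in> carrier_mat m r" using C A dim by (auto simp: column_basis_def)
  have "\<exists>x. x \<in> carrier_vec r \<and> col C j = P *\<^sub>v x" if j: "j < r" for j
  proof -
    have "col C j = C *\<^sub>v unit_vec r j" using mat_mult_unit_vec[OF Cc j] ..
    hence "col C j \<in> rational_span C" using mult_in_rational_span[OF Cc, of "unit_vec r j"] by simp
    hence "col C j \<in> rational_span P" using b C by (simp add: column_basis_def)
    then obtain q x where qx: "col C j \<in> carrier_vec m" "q \<noteq> 0" "x \<in> carrier_vec r" "q \<cdot>\<^sub>v col C j = P *\<^sub>v x"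
      using P unfolding rational_span_def by auto
    define y where "y = G *\<^sub>v col C j"
    have y: "y \<in> carrier_vec r" unfolding y_def by (rule mult_mat_vec_carrier[OF G(1) qx(1)])
    have "q \<cdot>\<^sub>v y = G *\<^sub>v (P *\<^sub>v x)" unfolding y_def mult_mat_smult_vec[OF G(1) qx(1), symmetric] qx(4) ..
    also have "\<dots> = x" unfolding assoc_mult_mat_vec[OF G(1) P qx(3), symmetric] G(2) using qx(3) by simp
    finally have "q \<cdot>\<^sub>v (P *\<^sub>v y) = q \<cdot>\<^sub>v col C j" unfolding mult_mat_smult_vec[OF P y, symmetric] qx(4) by simp
    hence e: "\<And>i. (q \<cdot>\<^sub>v (P *\<^sub>v y)) $ i = (q \<cdot>\<^sub>v col C j) $ i" by simp
    have "col C j = P *\<^sub>v y"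
    proof (rule eq_vecI)
      fix i assume i: "i < dim_vec (P *\<^sub>v y)"
      have i': "i < dim_vec (col C j)" using i Cc P by simp
      have "q * (P *\<^sub>v y) $ i = q * col C j $ i"
        using e[of i] unfolding index_smult_vec(1)[OF i] index_smult_vec(1)[OF i'] .
      from this[unfolded mult_left_cancel[OF qx(2)]] show "col C j $ i = (P *\<^sub>v y) $ i" ..
    qed (use P Cc in simp)
    with y show ?thesis by (intro exI[of _ y] conjI)
  qed
  then obtain X where X: "X \<in> carrier_mat r r" "C = P * X" by (rule cols_in_image[OF P Cc])
  have "det X \<noteq> 0"
  proof
    assume "det X = 0"
    then obtain v where v: "v \<in> carrier_vec r" "v \<noteq> 0\<^sub>v r" "X *\<^sub>v v = 0\<^sub>v r"
      using det_0_iff_vec_prod_zero[OF X(1)] by blast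
    have "C *\<^sub>v v = P *\<^sub>v (X *\<^sub>v v)" unfolding X(2) by (rule assoc_mult_mat_vec[OF P X(1) v(1)])
    also have "\<dots> = 0\<^sub>v m" unfolding v(3) using P by (intro eq_vecI) auto
    finally have "v = 0\<^sub>v r" using C by (intro col_injectiveD[OF _ Cc v(1)]) (auto simp: column_basis_def)
    thus False using v(2) by simp
  qed
  then obtain \<pi> where \<pi>: "\<pi> permutes {0..<r}" "\<And>i. i < r \<Longrightarrow> X $$ (i, \<pi> i) \<noteq> 0"
    by (rule det_nonzero_permutation[OF X(1)]) blast
  have "k i \<le> vec_degree (col C (\<pi> i))" if i: "i < r" for i
  proof -
    have p: "\<pi> i < r" using permutes_in_image[OF \<pi>(1), of i] i by simp
    have e: "P *\<^sub>v col X (\<pi> i) = col C (\<pi> i)" unfolding X(2) by (rule col_mult_mat_vec[OF P X(1) p, symmetric])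
    have "k i + degree (col X (\<pi> i) $ i) \<le> vec_degree (col C (\<pi> i))"
    proof (rule predictable_degree[OF P inj Pd _ _ i])
      show "col X (\<pi> i) \<in> carrier_vec r" using X(1) p by simp
      fix a assume "a < m"
      thus "degree ((P *\<^sub>v col X (\<pi> i)) $ a) \<le> vec_degree (col C (\<pi> i))"
        unfolding e using Cc p by (intro degree_le_vec_degree[of _ m]) auto
    next
      show "col X (\<pi> i) $ i \<noteq> 0" using X(1) p i \<pi>(2)[OF i] by simp
    qed
    thus ?thesis by simp
  qed
  hence "(\<Sum>i\<in>{0..<r}. k i) \<le> (\<Sum>i\<in>{0..<r}. vec_degree (col C (\<pi> i)))" by (intro sum_mono) auto
  also have "\<dots> = (\<Sum>j\<in>{0..<r}. vec_degree (col C j))"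
    using sum.permute[OF \<pi>(1), of "\<lambda>j. vec_degree (col C j)"] by (simp add: o_def)
  finally have "(\<Sum>j<r. k j) \<le> (\<Sum>j<r. vec_degree (col C j))" by (simp add: atLeast0LessThan)
  moreover have "(\<Sum>j<r. vec_degree (col P j)) \<le> (\<Sum>j<r. k j)"
  proof (rule sum_mono)
    fix j assume "j \<in> {..<r}"
    thus "vec_degree (col P j) \<le> k j" using P Pd by (intro vec_degree_leI[OF _ m]) auto
  qed
  ultimately show "(\<Sum>j<dim_col P. vec_degree (col P j)) \<le> (\<Sum>j<dim_col C. vec_degree (col C j))"
    using dim P by simp
qed

lemma mat_eq_by_entries:
  "A \<in> carrier_mat m n \<Longrightarrow> B \<in> carrier_mat m n \<Longrightarrow>
    (\<And>i j. i < m \<Longrightarrow> j < n \<Longrightarrow> A $$ (i, j) = B $$ (i, j)) \<Longrightarrow> A = B"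
  by (intro eq_matI) (auto simp del: index_mult_mat)

lemma sandwich_index:
  fixes P E Q :: "'b::comm_ring_1 mat"
  assumes P: "P \<in> carrier_mat m r" and E: "E \<in> carrier_mat r s" and Q: "Q \<in> carrier_mat n s" and ij: "i < m" "j < n"
  shows "(P * E * Q\<^sup>T) $$ (i, j) = (\<Sum>a<r. \<Sum>b<s. P $$ (i, a) * E $$ (a, b) * Q $$ (j, b))"
proof -
  have Qt: "Q\<^sup>T \<in> carrier_mat s n" using Q by simp
  have "(P * E * Q\<^sup>T) $$ (i, j) = (\<Sum>b<s. (P * E) $$ (i, b) * Q\<^sup>T $$ (b, j))"
    by (rule mult_mat_index[OF mult_carrier_mat[OF P E] Qt ij])
  also have "\<dots> = (\<Sum>b<s. (\<Sum>a<r. P $$ (i, a) * E $$ (a, b)) * Q $$ (j, b))"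
  proof (rule sum.cong[OF refl])
    fix b assume "b \<in> {..<s}"
    hence b: "b < s" by simp
    show "(P * E) $$ (i, b) * Q\<^sup>T $$ (b, j) = (\<Sum>a<r. P $$ (i, a) * E $$ (a, b)) * Q $$ (j, b)"
      unfolding mult_mat_index[OF P E ij(1) b] using Q b ij by simp
  qed
  also have "\<dots> = (\<Sum>a<r. \<Sum>b<s. P $$ (i, a) * E $$ (a, b) * Q $$ (j, b))"
    unfolding sum_distrib_right by (rule sum.swap)
  finally show ?thesis .
qed

lemma mat_diag_carrier: "mat_diag r a \<in> carrier_mat r r"
  by (simp add: mat_diag_def)

lemma smult_mat_mult_vec:
  fixes P :: "'b::comm_ring_1 mat"
  assumes "P \<in> carrier_mat m r" "x \<in> carrier_vec r"
  shows "(s \<cdot>\<^sub>m P) *\<^sub>v x = s \<cdot>\<^sub>v (P *\<^sub>v x)"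
proof (rule eq_vecI)
  fix a assume "a < dim_vec (s \<cdot>\<^sub>v (P *\<^sub>v x))"
  hence a: "a < m" using assms by simp
  have sP: "s \<cdot>\<^sub>m P \<in> carrier_mat m r" using assms by simp
  have "((s \<cdot>\<^sub>m P) *\<^sub>v x) $ a = (\<Sum>j<r. s * P $$ (a, j) * x $ j)"
    unfolding mult_mat_vec_index[OF sP assms(2) a] using assms a by (intro sum.cong) auto
  also have "\<dots> = s * (P *\<^sub>v x) $ a"
    unfolding mult_mat_vec_index[OF assms a] by (simp add: sum_distrib_left mult_ac)
  also have "\<dots> = (s \<cdot>\<^sub>v (P *\<^sub>v x)) $ a" using assms a by simp
  finally show "((s \<cdot>\<^sub>m P) *\<^sub>v x) $ a = (s \<cdot>\<^sub>v (P *\<^sub>v x)) $ a" .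
qed (use assms in simp)

lemma transpose_scalar_mat: "(c \<cdot>\<^sub>m 1\<^sub>m r)\<^sup>T = c \<cdot>\<^sub>m (1\<^sub>m r :: 'b::comm_ring_1 mat)"
  by (rule eq_matI) auto

text \<open>
  The factors \<open>E\<close> and \<open>Q\<^sup>T\<close> can be undone on the right up to a scalar, so \<open>P\<close> and the product have the
  same rational column space.
\<close>

lemma factorization_right_multiplier:
  fixes P E Q :: "'a::field poly mat"
  assumes P: "P \<in> carrier_mat m r" and E: "E \<in> carrier_mat r r" and Q: "Q \<in> carrier_mat n r"
    and det: "det E \<noteq> 0" and inj: "col_injective Q" and r: "r \<le> n"
  obtains N s where "N \<in> carrier_mat n r" "s \<noteq> 0" "P * E * Q\<^sup>T * N = s \<cdot>\<^sub>m P"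
proof -
  obtain H q where H: "H \<in> carrier_mat r n" "q \<noteq> 0" "H * Q = q \<cdot>\<^sub>m 1\<^sub>m r"
    by (rule quasi_left_inverse[OF Q r inj])
  have Ht: "H\<^sup>T \<in> carrier_mat n r" and Qt: "Q\<^sup>T \<in> carrier_mat r n" using H Q by auto
  have QH: "Q\<^sup>T * H\<^sup>T = q \<cdot>\<^sub>m 1\<^sub>m r"
    unfolding transpose_mult[OF H(1) Q, symmetric] H(3) by (rule transpose_scalar_mat)
  note aE = adj_mat[OF E]
  have PE: "P * E \<in> carrier_mat m r" using P E by simp
  have "P * E * Q\<^sup>T * (H\<^sup>T * adj_mat E) = P * E * (Q\<^sup>T * (H\<^sup>T * adj_mat E))"
    by (rule assoc_mult_mat[OF PE Qt mult_carrier_mat[OF Ht aE(1)]])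
  also have "Q\<^sup>T * (H\<^sup>T * adj_mat E) = q \<cdot>\<^sub>m adj_mat E"
    unfolding assoc_mult_mat[OF Qt Ht aE(1), symmetric] QH by (rule mult_smult_one_mat(2)[OF aE(1)])
  also have "P * E * (q \<cdot>\<^sub>m adj_mat E) = q \<cdot>\<^sub>m (P * E * adj_mat E)"
    by (rule mult_smult_distrib[OF PE aE(1)])
  also have "P * E * adj_mat E = det E \<cdot>\<^sub>m P"
    unfolding assoc_mult_mat[OF P E aE(1)] aE(2) mult_smult_distrib[OF P one_carrier_mat] right_mult_one_mat[OF P] ..
  also have "q \<cdot>\<^sub>m (det E \<cdot>\<^sub>m P) = (q * det E) \<cdot>\<^sub>m P" by (rule eq_matI) (auto simp: mult.assoc)
  finally show ?thesis using that[OF mult_carrier_mat[OF Ht aE(1)], of "q * det E"] H(2) det by simp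
qed

lemma column_basis_of_factorization:
  fixes P E Q :: "'a::field poly mat"
  assumes P: "P \<in> carrier_mat m r" and E: "E \<in> carrier_mat r r" and Q: "Q \<in> carrier_mat n r"
    and det: "det E \<noteq> 0" and injP: "col_injective P" and injQ: "col_injective Q" and r: "r \<le> n"
  shows "column_basis (P * E * Q\<^sup>T) P"
proof -
  let ?R = "P * E * Q\<^sup>T"
  have Qt: "Q\<^sup>T \<in> carrier_mat r n" using Q by auto
  have EQ: "E * Q\<^sup>T \<in> carrier_mat r n" using E Qt by simp
  have R: "?R \<in> carrier_mat m n" using P E Qt by simp
  obtain N s where N: "N \<in> carrier_mat n r" "s \<noteq> 0" "?R * N = s \<cdot>\<^sub>m P"
    by (rule factorization_right_multiplier[OF P E Q det injQ r])
  have "rational_span P = rational_span ?R"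
  proof (intro subset_antisym subsetI)
    fix u assume "u \<in> rational_span ?R"
    then obtain k x where u: "u \<in> carrier_vec m" "k \<noteq> 0" "x \<in> carrier_vec n" "k \<cdot>\<^sub>v u = ?R *\<^sub>v x"
      using R P Q unfolding rational_span_def by auto
    have y: "E * Q\<^sup>T *\<^sub>v x \<in> carrier_vec r" by (rule mult_mat_vec_carrier[OF EQ u(3)])
    have "k \<cdot>\<^sub>v u = P *\<^sub>v (E * Q\<^sup>T *\<^sub>v x)"
      unfolding u(4) assoc_mult_mat[OF P E Qt] by (rule assoc_mult_mat_vec[OF P EQ u(3)])
    thus "u \<in> rational_span P" using u(1,2) y P unfolding rational_span_def
      by (auto intro!: exI[of _ k] exI[of _ "E * Q\<^sup>T *\<^sub>v x"])
  next
    fix u assume "u \<in> rational_span P"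
    then obtain k x where u: "u \<in> carrier_vec m" "k \<noteq> 0" "x \<in> carrier_vec r" "k \<cdot>\<^sub>v u = P *\<^sub>v x"
      using P unfolding rational_span_def by auto
    have y: "N *\<^sub>v x \<in> carrier_vec n" by (rule mult_mat_vec_carrier[OF N(1) u(3)])
    have "?R *\<^sub>v (N *\<^sub>v x) = s \<cdot>\<^sub>v (k \<cdot>\<^sub>v u)"
      unfolding assoc_mult_mat_vec[OF R N(1) u(3), symmetric] N(3) u(4) by (rule smult_mat_mult_vec[OF P u(3)])
    hence e: "(s * k) \<cdot>\<^sub>v u = ?R *\<^sub>v (N *\<^sub>v x)" by (simp add: smult_smult_assoc)
    have "s * k \<noteq> 0" using N(2) u(2) by simp
    moreover have "N *\<^sub>v x \<in> carrier_vec (dim_col ?R)" "u \<in> carrier_vec (dim_row ?R)" using y u(1) carrier_matD[OF R] by auto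
    ultimately show "u \<in> rational_span ?R" unfolding rational_span_def mem_Collect_eq using e by (intro conjI exI)
  qed
  thus ?thesis using P injP R unfolding column_basis_def by auto
qed

lemma smith_thin_factorization:
  fixes A :: "'a::field poly mat"
  assumes A: "A \<in> carrier_mat m n" and U: "unimodular m U" and V: "unimodular n V"
    and eq: "U * A * V = diag_rect_mat m n \<gamma>s" and len: "length \<gamma>s \<le> min m n"
  obtains P Q G H where "P \<in> carrier_mat m (length \<gamma>s)" "Q \<in> carrier_mat n (length \<gamma>s)"
    "A = P * mat_diag (length \<gamma>s) (\<lambda>i. \<gamma>s ! i) * Q\<^sup>T"
    "G \<in> carrier_mat (length \<gamma>s) m" "G * P = 1\<^sub>m (length \<gamma>s)"
    "H \<in> carrier_mat (length \<gamma>s) n" "H * Q = 1\<^sub>m (length \<gamma>s)"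
proof -
  let ?l = "length \<gamma>s" and ?D = "diag_rect_mat m n \<gamma>s"
  have l: "?l \<le> m" "?l \<le> n" using len by auto
  obtain W where W: "W \<in> carrier_mat m m" "U * W = 1\<^sub>m m" "W * U = 1\<^sub>m m" by (rule unimodular_inverse[OF U])
  obtain Z where Z: "Z \<in> carrier_mat n n" "V * Z = 1\<^sub>m n" "Z * V = 1\<^sub>m n" by (rule unimodular_inverse[OF V])
  have c: "U \<in> carrier_mat m m" "V \<in> carrier_mat n n" using U V by (auto simp: unimodular_def)
  have D: "?D \<in> carrier_mat m n" by (simp add: diag_rect_mat_def)
  have UA: "U * A \<in> carrier_mat m n" using c A by simp
  have "W * ?D * Z = W * (U * A * V * Z)"
    unfolding eq[symmetric] by (rule assoc_mult_mat[OF W(1) _ Z(1)]) (use UA c in auto)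
  also have "U * A * V * Z = U * A" unfolding assoc_mult_mat[OF UA c(2) Z(1)] Z(2) by (rule right_mult_one_mat[OF UA])
  also have "W * (U * A) = A" unfolding assoc_mult_mat[OF W(1) c(1) A, symmetric] W(3) by (rule left_mult_one_mat[OF A])
  finally have WDZ: "A = W * ?D * Z" ..
  define P where "P = mat m ?l (\<lambda>(i, a). W $$ (i, a))"
  define Q where "Q = mat n ?l (\<lambda>(j, b). Z $$ (b, j))"
  define G where "G = mat ?l m (\<lambda>(a, i). U $$ (a, i))"
  define H where "H = mat ?l n (\<lambda>(b, j). V $$ (j, b))"
  have P: "P \<in> carrier_mat m ?l" and Q: "Q \<in> carrier_mat n ?l" and G: "G \<in> carrier_mat ?l m" and H: "H \<in> carrier_mat ?l n"
    by (auto simp: P_def Q_def G_def H_def)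
  have Qt: "Q\<^sup>T \<in> carrier_mat ?l n" using Q by simp
  have "A $$ (i, j) = (P * mat_diag ?l (\<lambda>i. \<gamma>s ! i) * Q\<^sup>T) $$ (i, j)" if ij: "i < m" "j < n" for i j
  proof -
    have WD: "(W * ?D) $$ (i, b) = (if b < ?l then W $$ (i, b) * \<gamma>s ! b else 0)" if b: "b < n" for b
    proof -
      have "(W * ?D) $$ (i, b) = (\<Sum>a<m. W $$ (i, a) * ?D $$ (a, b))" by (rule mult_mat_index[OF W(1) D ij(1) b])
      also have "\<dots> = (\<Sum>a<m. if a = b then (if b < ?l then W $$ (i, b) * \<gamma>s ! b else 0) else 0)"
        using b by (intro sum.cong) (auto simp: diag_rect_mat_def)
      also have "\<dots> = (if b < ?l then W $$ (i, b) * \<gamma>s ! b else 0)" using l by auto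
      finally show ?thesis .
    qed
    have "A $$ (i, j) = (\<Sum>b<n. (W * ?D) $$ (i, b) * Z $$ (b, j))"
      unfolding WDZ by (rule mult_mat_index[OF mult_carrier_mat[OF W(1) D] Z(1) ij])
    also have "\<dots> = (\<Sum>b<n. if b < ?l then W $$ (i, b) * \<gamma>s ! b * Z $$ (b, j) else 0)"
      by (intro sum.cong) (auto simp: WD)
    also have "\<dots> = (\<Sum>b<?l. W $$ (i, b) * \<gamma>s ! b * Z $$ (b, j))"
      using l by (intro sum.mono_neutral_cong_right) auto
    also have "\<dots> = (\<Sum>b<?l. P $$ (i, b) * \<gamma>s ! b * Q\<^sup>T $$ (b, j))"
      using ij Q by (intro sum.cong) (auto simp: P_def Q_def)
    also have "\<dots> = (P * mat_diag ?l (\<lambda>i. \<gamma>s ! i) * Q\<^sup>T) $$ (i, j)"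
      by (rule diag_sandwich_index[OF P Qt ij, symmetric])
    finally show ?thesis .
  qed
  hence eqA: "A = P * mat_diag ?l (\<lambda>i. \<gamma>s ! i) * Q\<^sup>T"
    by (rule mat_eq_by_entries[OF A mult_carrier_mat[OF mult_carrier_mat[OF P mat_diag_carrier] Qt]])
  have GP: "G * P = 1\<^sub>m ?l"
  proof (rule eq_matI)
    fix a b assume "a < dim_row (1\<^sub>m ?l :: 'a poly mat)" "b < dim_col (1\<^sub>m ?l :: 'a poly mat)"
    hence ab: "a < ?l" "b < ?l" by simp_all
    have "(G * P) $$ (a, b) = (U * W) $$ (a, b)"
      unfolding mult_mat_index[OF G P ab]
      using ab l by (subst mult_mat_index[OF c(1) W(1)]) (auto simp: G_def P_def)
    thus "(G * P) $$ (a, b) = 1\<^sub>m ?l $$ (a, b)" unfolding W(2) using ab l by simp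
  qed (use G P in auto)
  have HQ: "H * Q = 1\<^sub>m ?l"
  proof (rule eq_matI)
    fix a b assume "a < dim_row (1\<^sub>m ?l :: 'a poly mat)" "b < dim_col (1\<^sub>m ?l :: 'a poly mat)"
    hence ab: "a < ?l" "b < ?l" by simp_all
    have "(H * Q) $$ (a, b) = (Z * V) $$ (b, a)"
      unfolding mult_mat_index[OF H Q ab]
      using ab l by (subst mult_mat_index[OF Z(1) c(2)]) (auto simp: H_def Q_def mult.commute)
    thus "(H * Q) $$ (a, b) = 1\<^sub>m ?l $$ (a, b)" unfolding Z(3) using ab l by auto
  qed (use H Q in auto)
  show ?thesis by (rule that[OF P Q eqA G GP H HQ])
qed

lemma pm_rank_eq_length_smith:
  fixes A :: "'a::field poly mat"
  assumes A: "A \<in> carrier_mat m n" and U: "unimodular m U" and V: "unimodular n V"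
    and eq: "U * A * V = diag_rect_mat m n \<gamma>s" and len: "length \<gamma>s \<le> min m n"
    and nz: "\<And>\<gamma>. \<gamma> \<in> set \<gamma>s \<Longrightarrow> \<gamma> \<noteq> 0"
  shows "pm_rank A = length \<gamma>s"
proof -
  let ?l = "length \<gamma>s"
  obtain P Q G H where f: "P \<in> carrier_mat m ?l" "Q \<in> carrier_mat n ?l"
    "A = P * mat_diag ?l (\<lambda>i. \<gamma>s ! i) * Q\<^sup>T" "G \<in> carrier_mat ?l m" "G * P = 1\<^sub>m ?l"
    "H \<in> carrier_mat ?l n" "H * Q = 1\<^sub>m ?l"
    by (rule smith_thin_factorization[OF A U V eq len])
  have one: "(1\<^sub>m ?l :: 'a poly mat) = 1 \<cdot>\<^sub>m 1\<^sub>m ?l" by (rule eq_matI) auto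
  have inj: "col_injective P" "col_injective Q"
    using left_inverse_imp_injective[OF f(1,4), of 1] left_inverse_imp_injective[OF f(2,6), of 1] f(5,7) one by auto
  have "det (mat_diag ?l (\<lambda>i. \<gamma>s ! i)) \<noteq> 0" unfolding det_mat_diag using nz by simp
  hence "column_basis A P" unfolding f(3) using len
    by (intro column_basis_of_factorization[OF f(1) mat_diag_carrier f(2) _ inj]) auto
  from column_basis_cols(2)[OF A this] show ?thesis using f(1) by simp
qed

text \<open>Since \<open>s P\<close> is a right multiple of the product, \<open>U\<close> kills the same rows of both.\<close>

lemma compressed_factor:
  fixes P E Q :: "'a::field poly mat"
  assumes P: "P \<in> carrier_mat m r" and E: "E \<in> carrier_mat r r" and Q: "Q \<in> carrier_mat n r"
    and det: "det E \<noteq> 0" and inj: "col_injective Q" and r: "r \<le> n"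
    and U: "unimodular m U" and V: "unimodular n V"
    and eq: "U * (P * E * Q\<^sup>T) * V = diag_rect_mat m n \<gamma>s" and len: "length \<gamma>s \<le> r"
  shows "bottom_zero r (U * P)"
proof -
  let ?R = "P * E * Q\<^sup>T" and ?D = "diag_rect_mat m n \<gamma>s"
  have Qt: "Q\<^sup>T \<in> carrier_mat r n" using Q by auto
  have R: "?R \<in> carrier_mat m n" by (rule mult_carrier_mat[OF mult_carrier_mat[OF P E] Qt])
  obtain N s where N: "N \<in> carrier_mat n r" "s \<noteq> 0" "?R * N = s \<cdot>\<^sub>m P"
    by (rule factorization_right_multiplier[OF P E Q det inj r])
  obtain Z where Z: "Z \<in> carrier_mat n n" "V * Z = 1\<^sub>m n" "Z * V = 1\<^sub>m n" by (rule unimodular_inverse[OF V])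
  have c: "U \<in> carrier_mat m m" "V \<in> carrier_mat n n" using U V by (auto simp: unimodular_def)
  have UR: "U * ?R \<in> carrier_mat m n" by (rule mult_carrier_mat[OF c(1) R])
  have D: "?D \<in> carrier_mat m n" by (simp add: diag_rect_mat_def)
  have "?D * Z = U * ?R" unfolding eq[symmetric] assoc_mult_mat[OF UR c(2) Z(1)] Z(2) by (rule right_mult_one_mat[OF UR])
  hence "?D * (Z * N) = U * ?R * N" unfolding assoc_mult_mat[OF D Z(1) N(1), symmetric] by simp
  also have "\<dots> = s \<cdot>\<^sub>m (U * P)" unfolding assoc_mult_mat[OF c(1) R N(1)] N(3) by (rule mult_smult_distrib[OF c(1) P])
  finally have "bottom_zero r (s \<cdot>\<^sub>m (U * P))"
    using diag_rect_mult_bottom_zero[OF mult_carrier_mat[OF Z(1) N(1)] len, of m] by simp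
  thus ?thesis using N(2) unfolding bottom_zero_def by auto
qed

lemma compressed_factor_right:
  fixes P E Q :: "'a::field poly mat"
  assumes P: "P \<in> carrier_mat m r" and E: "E \<in> carrier_mat r r" and Q: "Q \<in> carrier_mat n r"
    and det: "det E \<noteq> 0" and inj: "col_injective P" and r: "r \<le> m"
    and U: "unimodular m U" and V: "unimodular n V"
    and eq: "U * (P * E * Q\<^sup>T) * V = diag_rect_mat m n \<gamma>s" and len: "length \<gamma>s \<le> r"
  shows "bottom_zero r (V\<^sup>T * Q)"
proof (rule compressed_factor[OF Q _ P _ inj r unimodular_transpose[OF V] unimodular_transpose[OF U] _ len])
  have c: "U \<in> carrier_mat m m" "V \<in> carrier_mat n n" using U V by (auto simp: unimodular_def)
  have Vt: "V\<^sup>T \<in> carrier_mat n n" and Qt: "Q\<^sup>T \<in> carrier_mat r n" and Pt: "P\<^sup>T \<in> carrier_mat r m" using c Q P by auto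
  show Et: "E\<^sup>T \<in> carrier_mat r r" using E by simp
  show "det E\<^sup>T \<noteq> 0" using det_transpose[OF E] det by simp
  have Ac: "P * E * Q\<^sup>T \<in> carrier_mat m n" by (rule mult_carrier_mat[OF mult_carrier_mat[OF P E] Qt])
  have "Q * E\<^sup>T * P\<^sup>T = (P * E * Q\<^sup>T)\<^sup>T"
    unfolding transpose_mult[OF mult_carrier_mat[OF P E] Qt] transpose_mult[OF P E]
    by (simp add: assoc_mult_mat[OF Q Et Pt])
  hence "V\<^sup>T * (Q * E\<^sup>T * P\<^sup>T) * U\<^sup>T = V\<^sup>T * ((P * E * Q\<^sup>T)\<^sup>T * U\<^sup>T)"
    using assoc_mult_mat[OF Vt, of "(P * E * Q\<^sup>T)\<^sup>T" m "U\<^sup>T" m] Ac c by simp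
  also have "\<dots> = (U * (P * E * Q\<^sup>T) * V)\<^sup>T"
    unfolding transpose_mult[OF mult_carrier_mat[OF c(1) Ac] c(2)] transpose_mult[OF c(1) Ac] ..
  also have "\<dots> = diag_rect_mat n m \<gamma>s"
    unfolding eq by (rule eq_matI) (auto simp: diag_rect_mat_def)
  finally show "V\<^sup>T * (Q * E\<^sup>T * P\<^sup>T) * U\<^sup>T = diag_rect_mat n m \<gamma>s" .
qed

text \<open>
  The rectangular outer factors are thereby replaced by square ones, and the Smith form of the
  product is compared with the core \<open>E\<close> alone.
\<close>

lemma diag_of_factor:
  fixes P E Q :: "'a::field poly mat"
  assumes P: "P \<in> carrier_mat m r" and E: "E \<in> carrier_mat r r" and Q: "Q \<in> carrier_mat n r"
    and r: "r \<le> m" "r \<le> n" and U: "U \<in> carrier_mat m m" and V: "V \<in> carrier_mat n n"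
    and eq: "U * (P * E * Q\<^sup>T) * V = diag_rect_mat m n \<gamma>s" and len: "length \<gamma>s = r"
  shows "mat_diag r (\<lambda>i. \<gamma>s ! i) = top_rows r (U * P) * E * (top_rows r (V\<^sup>T * Q))\<^sup>T"
proof -
  have Qt: "Q\<^sup>T \<in> carrier_mat r n" and Vt: "V\<^sup>T \<in> carrier_mat n n" using Q V by auto
  have UP: "U * P \<in> carrier_mat m r" and VQ: "V\<^sup>T * Q \<in> carrier_mat n r"
    by (rule mult_carrier_mat[OF U P], rule mult_carrier_mat[OF Vt Q])
  have PE: "P * E \<in> carrier_mat m r" by (rule mult_carrier_mat[OF P E])
  have "(V\<^sup>T * Q)\<^sup>T = Q\<^sup>T * V" unfolding transpose_mult[OF Vt Q] by simp
  hence "U * P * E * (V\<^sup>T * Q)\<^sup>T = U * P * E * (Q\<^sup>T * V)" by simp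
  also have "\<dots> = U * (P * E) * (Q\<^sup>T * V)" unfolding assoc_mult_mat[OF U P E] ..
  also have "\<dots> = U * (P * E) * Q\<^sup>T * V" by (rule assoc_mult_mat[OF mult_carrier_mat[OF U PE] Qt V, symmetric])
  also have "\<dots> = U * (P * E * Q\<^sup>T) * V" unfolding assoc_mult_mat[OF U PE Qt] ..
  finally have D: "U * P * E * (V\<^sup>T * Q)\<^sup>T = diag_rect_mat m n \<gamma>s" unfolding eq .
  let ?T = "top_rows r (U * P)" and ?T' = "top_rows r (V\<^sup>T * Q)"
  have T: "?T \<in> carrier_mat r r" "?T' \<in> carrier_mat r r"
    by (rule top_rows_carrier[OF UP], rule top_rows_carrier[OF VQ])
  have tr: "top_rows r X $$ (i, j) = X $$ (i, j)" if "i < r" "j < dim_col X" for X :: "'a poly mat" and i j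
    using that by (simp add: top_rows_def)
  have "mat_diag r (\<lambda>i. \<gamma>s ! i) $$ (i, j) = (?T * E * ?T'\<^sup>T) $$ (i, j)" if ij: "i < r" "j < r" for i j
  proof -
    have "(?T * E * ?T'\<^sup>T) $$ (i, j) = (\<Sum>a<r. \<Sum>b<r. ?T $$ (i, a) * E $$ (a, b) * ?T' $$ (j, b))"
      by (rule sandwich_index[OF T(1) E T(2) ij])
    also have "\<dots> = (\<Sum>a<r. \<Sum>b<r. (U * P) $$ (i, a) * E $$ (a, b) * (V\<^sup>T * Q) $$ (j, b))"
    proof (intro sum.cong refl)
      fix a b assume "a \<in> {..<r}" "b \<in> {..<r}"
      hence ab: "a < dim_col (U * P)" "b < dim_col (V\<^sup>T * Q)" using UP VQ by auto
      show "?T $$ (i, a) * E $$ (a, b) * ?T' $$ (j, b) = (U * P) $$ (i, a) * E $$ (a, b) * (V\<^sup>T * Q) $$ (j, b)"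
        unfolding tr[OF ij(1) ab(1)] tr[OF ij(2) ab(2)] ..
    qed
    also have "\<dots> = (U * P * E * (V\<^sup>T * Q)\<^sup>T) $$ (i, j)"
      using r ij by (intro sandwich_index[OF UP E VQ, symmetric]) auto
    also have "\<dots> = mat_diag r (\<lambda>i. \<gamma>s ! i) $$ (i, j)"
      unfolding D using ij r len by (auto simp: diag_rect_mat_def mat_diag_def)
    finally show ?thesis ..
  qed
  moreover have "?T * E * ?T'\<^sup>T \<in> carrier_mat r r"
    by (rule mult_carrier_mat[OF mult_carrier_mat[OF T(1) E]]) (use T(2) in simp)
  ultimately show ?thesis by (intro mat_eq_by_entries[OF mat_diag_carrier])
qed

text \<open>The compressed square matrix is nonsingular at the point \<open>a\<close>, hence nonsingular.\<close>

lemma injective_of_injective_at: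
  fixes P :: "'a::field poly mat"
  assumes P: "P \<in> carrier_mat m r" and r: "r \<le> m" and inj: "col_injective (map_mat (\<lambda>p. poly p a) P)"
  shows "col_injective P"
proof -
  obtain U where U: "unimodular m U" "bottom_zero r (U * P)" by (rule row_compression[OF P])
  have c: "U \<in> carrier_mat m m" using U by (simp add: unimodular_def)
  let ?T = "top_rows r (U * P)"
  have T: "?T \<in> carrier_mat r r" by (rule top_rows_carrier[OF mult_carrier_mat[OF c P]])
  have tu: "top_rows r U \<in> carrier_mat r m" by (rule top_rows_carrier[OF c])
  have "poly (det ?T) a \<noteq> 0" by (rule det_top_rows_nonzero_at[OF P r U inj])
  hence T0: "det ?T \<noteq> 0" by auto
  have "adj_mat ?T * top_rows r U * P = det ?T \<cdot>\<^sub>m 1\<^sub>m r"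
    unfolding assoc_mult_mat[OF adj_mat(1)[OF T] tu P] top_rows_mult[OF c P r] by (rule adj_mat(3)[OF T])
  from left_inverse_imp_injective[OF P mult_carrier_mat[OF adj_mat(1)[OF T] tu] this T0] show ?thesis .
qed

section \<open>Reversal\<close>

definition rev_cols :: "(nat \<Rightarrow> nat) \<Rightarrow> 'a::field poly mat \<Rightarrow> 'a poly mat" where
  "rev_cols k P = mat (dim_row P) (dim_col P) (\<lambda>(i, j). rev_poly (k j) (P $$ (i, j)))"

lemma rev_cols_carrier: "P \<in> carrier_mat m r \<Longrightarrow> rev_cols k P \<in> carrier_mat m r"
  by (simp add: rev_cols_def)

lemma rev_cols_at_0: "map_mat (\<lambda>p. poly p 0) (rev_cols k P) = lead_mat P k"
  by (rule eq_matI) (auto simp: rev_cols_def lead_mat_def poly_rev_poly_0)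

text \<open>
  The entry \<open>(a, b)\<close> of the core of a matrix of degree \<open>d\<close> has formal degree \<open>d - k a - l b\<close>, which is
  what the column degrees \<open>k a\<close> and \<open>l b\<close> of the outer factors leave.
\<close>

definition core_rev :: "nat \<Rightarrow> nat \<Rightarrow> (nat \<Rightarrow> nat) \<Rightarrow> (nat \<Rightarrow> nat) \<Rightarrow> 'a::field poly mat \<Rightarrow> 'a poly mat" where
  "core_rev r d k l E = mat r r (\<lambda>(a, b). rev_poly (d - k a - l b) (E $$ (a, b)))"

text \<open>The formal degrees in each term of the matrix product add up to \<open>d\<close>.\<close>

lemma reversed_factorization:
  fixes P E Q :: "'a::field poly mat"
  assumes P: "P \<in> carrier_mat m r" and E: "E \<in> carrier_mat r r" and Q: "Q \<in> carrier_mat n r"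
    and Pd: "\<And>i a. i < m \<Longrightarrow> a < r \<Longrightarrow> degree (P $$ (i, a)) \<le> k a"
    and Qd: "\<And>j b. j < n \<Longrightarrow> b < r \<Longrightarrow> degree (Q $$ (j, b)) \<le> l b"
    and Ed: "\<And>a b. a < r \<Longrightarrow> b < r \<Longrightarrow> E $$ (a, b) \<noteq> 0 \<Longrightarrow> k a + l b \<le> d \<and> degree (E $$ (a, b)) \<le> d - k a - l b"
    and ij: "i < m" "j < n"
  shows "degree ((P * E * Q\<^sup>T) $$ (i, j)) \<le> d"
    and "rev_poly d ((P * E * Q\<^sup>T) $$ (i, j)) = (rev_cols k P * core_rev r d k l E * (rev_cols l Q)\<^sup>T) $$ (i, j)"
proof -
  have t: "degree (P $$ (i, a) * E $$ (a, b) * Q $$ (j, b)) \<le> d \<and>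
    rev_poly d (P $$ (i, a) * E $$ (a, b) * Q $$ (j, b))
      = rev_cols k P $$ (i, a) * core_rev r d k l E $$ (a, b) * rev_cols l Q $$ (j, b)"
    if ab: "a < r" "b < r" for a b
  proof (cases "E $$ (a, b) = 0")
    case True
    thus ?thesis using ab by (simp add: core_rev_def rev_poly_moebius)
  next
    case False
    let ?p = "P $$ (i, a)" and ?e = "E $$ (a, b)" and ?q = "Q $$ (j, b)"
    have d: "degree ?p \<le> k a" "degree ?e \<le> d - k a - l b" "degree ?q \<le> l b" "d = k a + (d - k a - l b) + l b"
      using Pd[OF ij(1) ab(1)] Qd[OF ij(2) ab(2)] Ed[OF ab False] by auto
    have d2: "degree (?p * ?e) \<le> k a + (d - k a - l b)" using degree_mult_le[of ?p ?e] d(1,2) by linarith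
    have "degree (?p * ?e * ?q) \<le> k a + (d - k a - l b) + l b" using degree_mult_le[of "?p * ?e" ?q] d2 d(3) by linarith
    moreover have "rev_poly (k a + (d - k a - l b) + l b) (?p * ?e * ?q) = rev_poly (k a) ?p * rev_poly (d - k a - l b) ?e * rev_poly (l b) ?q"
      unfolding rev_poly_moebius moebius_mult[OF d2 d(3)] moebius_mult[OF d(1,2)] ..
    ultimately show ?thesis using ab ij P Q d(4)[symmetric] by (simp add: rev_cols_def core_rev_def)
  qed
  note s = sandwich_index[OF P E Q ij]
  show "degree ((P * E * Q\<^sup>T) $$ (i, j)) \<le> d"
    unfolding s by (intro degree_sum_le) (use t in auto)
  have c: "core_rev r d k l E \<in> carrier_mat r r" by (simp add: core_rev_def)
  have "rev_poly d ((P * E * Q\<^sup>T) $$ (i, j))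
      = (\<Sum>a<r. \<Sum>b<r. rev_poly d (P $$ (i, a) * E $$ (a, b) * Q $$ (j, b)))"
    unfolding s rev_poly_moebius moebius_sum ..
  also have "\<dots> = (\<Sum>a<r. \<Sum>b<r. rev_cols k P $$ (i, a) * core_rev r d k l E $$ (a, b) * rev_cols l Q $$ (j, b))"
    using t by (intro sum.cong) auto
  also have "\<dots> = (rev_cols k P * core_rev r d k l E * (rev_cols l Q)\<^sup>T) $$ (i, j)"
    by (rule sandwich_index[OF rev_cols_carrier[OF P] c rev_cols_carrier[OF Q] ij, symmetric])
  finally show "rev_poly d ((P * E * Q\<^sup>T) $$ (i, j)) = (rev_cols k P * core_rev r d k l E * (rev_cols l Q)\<^sup>T) $$ (i, j)" .
qed

lemma rev_poly_det:
  fixes M :: "'a::field poly mat"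
  assumes M: "M \<in> carrier_mat j j" and d: "\<And>a b. a < j \<Longrightarrow> b < j \<Longrightarrow> degree (M $$ (a, b)) \<le> d"
  shows "rev_poly (j * d) (det M) = det (map_mat (rev_poly d) M)" and "degree (det M) \<le> j * d"
proof -
  have Mc: "map_mat (rev_poly d) M \<in> carrier_mat j j" using M by simp
  have t: "degree (signof p * (\<Prod>i = 0..<j. M $$ (i, p i))) \<le> j * d \<and>
    rev_poly (j * d) (signof p * (\<Prod>i = 0..<j. M $$ (i, p i))) = signof p * (\<Prod>i = 0..<j. map_mat (rev_poly d) M $$ (i, p i))"
    if p: "p permutes {0..<j}" for p
  proof -
    have pi: "p i < j" if "i < j" for i using permutes_in_image[OF p, of i] that by simp
    let ?x = "\<Prod>i = 0..<j. M $$ (i, p i)"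
    have deg: "degree ?x \<le> j * d"
      using degree_prod_le[of "{0..<j}" "\<lambda>i. M $$ (i, p i)" "\<lambda>_. d"] d pi by simp
    have "rev_poly (j * d) ?x = (\<Prod>i = 0..<j. rev_poly d (M $$ (i, p i)))"
      using moebius_prod[of "{0..<j}" "\<lambda>i. M $$ (i, p i)" "\<lambda>_. d" 1 "[:0, 1:]"] d pi by (simp add: rev_poly_moebius)
    also have "\<dots> = (\<Prod>i = 0..<j. map_mat (rev_poly d) M $$ (i, p i))" using M pi by (intro prod.cong) auto
    finally have r: "rev_poly (j * d) ?x = (\<Prod>i = 0..<j. map_mat (rev_poly d) M $$ (i, p i))" .
    have neg: "rev_poly (j * d) (- ?x) = - rev_poly (j * d) ?x"
      using moebius_smult[of "j * d" 1 "[:0, 1:]" "-1" ?x] by (simp add: rev_poly_moebius)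
    show ?thesis unfolding sign_def using deg r neg by simp
  qed
  have "rev_poly (j * d) (det M) = (\<Sum>p\<in>{p. p permutes {0..<j}}. rev_poly (j * d) (signof p * (\<Prod>i = 0..<j. M $$ (i, p i))))"
    unfolding det_def'[OF M] rev_poly_moebius moebius_sum ..
  also have "\<dots> = det (map_mat (rev_poly d) M)" unfolding det_def'[OF Mc] using t by (intro sum.cong) auto
  finally show "rev_poly (j * d) (det M) = det (map_mat (rev_poly d) M)" .
  show "degree (det M) \<le> j * d" unfolding det_def'[OF M]
    by (intro degree_sum_le finite_permutations) (use t in auto)
qed

lemma det_scale_rows_cols:
  fixes X :: "'b::comm_ring_1 mat"
  assumes X: "X \<in> carrier_mat j j"
  shows "det (mat j j (\<lambda>(a, b). u a * v b * X $$ (a, b))) = (\<Prod>i<j. u i) * (\<Prod>i<j. v i) * det X"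
proof -
  let ?M = "mat j j (\<lambda>(a, b). u a * v b * X $$ (a, b))"
  have M: "?M \<in> carrier_mat j j" by simp
  have "(\<Prod>i = 0..<j. ?M $$ (i, p i)) = (\<Prod>i<j. u i) * (\<Prod>i<j. v i) * (\<Prod>i = 0..<j. X $$ (i, p i))"
    if p: "p permutes {0..<j}" for p
  proof -
    have pi: "p i < j" if "i < j" for i using permutes_in_image[OF p, of i] that by simp
    have "(\<Prod>i = 0..<j. ?M $$ (i, p i)) = (\<Prod>i = 0..<j. u i * v (p i) * X $$ (i, p i))"
      using pi by (intro prod.cong) auto
    also have "\<dots> = (\<Prod>i = 0..<j. u i) * (\<Prod>i = 0..<j. v (p i)) * (\<Prod>i = 0..<j. X $$ (i, p i))"
      by (simp add: prod.distrib)
    also have "(\<Prod>i = 0..<j. v (p i)) = (\<Prod>i = 0..<j. v i)" using prod.permute[OF p, of v] by (simp add: o_def)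
    finally show ?thesis by (simp add: atLeast0LessThan)
  qed
  thus ?thesis unfolding det_def'[OF M] det_def'[OF X] sum_distrib_left
    by (intro sum.cong) (auto simp: mult_ac)
qed

section \<open>Inequalities satisfied by the structural data\<close>

lemma degree_le_mat_degree:
  "A \<in> carrier_mat m n \<Longrightarrow> i < m \<Longrightarrow> j < n \<Longrightarrow> degree (A $$ (i, j)) \<le> mat_degree A"
  unfolding mat_degree_def by (rule Max_ge) (simp add: elements_mat_def, blast intro: elements_matI)

lemma mat_degree_attained:
  assumes "A \<in> carrier_mat m n" "0 < m" "0 < n"
  obtains i j where "i < m" "j < n" "degree (A $$ (i, j)) = mat_degree A"
proof -
  have "A $$ (0, 0) \<in> elements_mat A" using elements_matI[OF assms refl] .
  hence ne: "degree ` elements_mat A \<noteq> {}" by blast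
  have "mat_degree A \<in> degree ` elements_mat A"
    unfolding mat_degree_def by (rule Max_in[OF _ ne]) (simp add: elements_mat_def)
  then obtain x where x: "x \<in> elements_mat A" "mat_degree A = degree x" by blast
  obtain i j where "i < m" "j < n" "x = A $$ (i, j)" using elements_matD[OF x(1)] assms(1) by auto
  thus ?thesis using that[of i j] x(2) by simp
qed

lemma invariant_factorsE:
  fixes A :: "'a::field poly mat"
  assumes A: "A \<in> carrier_mat m n" and inv: "invariant_factors A \<alpha>s" and rk: "pm_rank A = r"
  obtains U V where "unimodular m U" "unimodular n V" "U * A * V = diag_rect_mat m n \<alpha>s" "length \<alpha>s = r"
    "\<forall>i<r. \<alpha>s ! i \<noteq> 0"
    "\<forall>i k. i \<le> k \<longrightarrow> k < r \<longrightarrow> \<alpha>s ! i dvd \<alpha>s ! k"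
proof -
  have len: "length \<alpha>s = r" using inv rk unfolding invariant_factors_def by blast
  obtain U V where UV: "U \<in> carrier_mat m m" "V \<in> carrier_mat n n" "invertible_mat U" "invertible_mat V"
    "U * A * V = diag_rect_mat m n \<alpha>s"
    using inv A unfolding invariant_factors_def by auto
  have lc: "lead_coeff (\<alpha>s ! i) = 1" if "i < r" for i
    using inv that len unfolding invariant_factors_def by auto
  have nz: "\<alpha>s ! i \<noteq> 0" if "i < r" for i using lc[OF that] by auto
  have chain: "\<alpha>s ! i dvd \<alpha>s ! k" if "i \<le> k" "k < r" for i k
  proof (cases "i = k")
    case False
    thus ?thesis using inv that len unfolding invariant_factors_def by (auto intro: sorted_wrt_nth_less)
  qed simp
  have nz': "\<forall>i<r. \<alpha>s ! i \<noteq> 0" using nz by blast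
  have chain': "\<forall>i k. i \<le> k \<longrightarrow> k < r \<longrightarrow> \<alpha>s ! i dvd \<alpha>s ! k" using chain by blast
  from that[OF invertible_mat_imp_unimodular[OF UV(1,3)] invertible_mat_imp_unimodular[OF UV(2,4)] UV(5) len nz' chain']
  show ?thesis .
qed

text \<open>The predictable degree property is applied to the columns of \<open>E Q\<^sup>T\<close> and then to the rows of \<open>E\<close>.\<close>

lemma degree_bound_of_core:
  fixes P E Q :: "'a::field poly mat"
  assumes P: "P \<in> carrier_mat m r" and E: "E \<in> carrier_mat r r" and Q: "Q \<in> carrier_mat n r"
    and Pd: "\<And>i a. i < m \<Longrightarrow> a < r \<Longrightarrow> degree (P $$ (i, a)) \<le> k a"
    and Qd: "\<And>j b. j < n \<Longrightarrow> b < r \<Longrightarrow> degree (Q $$ (j, b)) \<le> l b"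
    and leadP: "col_injective (lead_mat P k)" and leadQ: "col_injective (lead_mat Q l)"
    and injQ: "col_injective Q"
    and d: "\<And>i j. i < m \<Longrightarrow> j < n \<Longrightarrow> degree ((P * E * Q\<^sup>T) $$ (i, j)) \<le> d"
    and ab: "a < r" "b < r" "E $$ (a, b) \<noteq> 0"
  shows "k a + l b \<le> d \<and> degree (E $$ (a, b)) \<le> d - k a - l b"
proof -
  have Qt: "Q\<^sup>T \<in> carrier_mat r n" and Et: "E\<^sup>T \<in> carrier_mat r r" using Q E by auto
  let ?F = "E * Q\<^sup>T"
  have F: "?F \<in> carrier_mat r n" by (rule mult_carrier_mat[OF E Qt])
  have bF: "k a + degree (?F $$ (a, j)) \<le> d" if j: "j < n" "?F $$ (a, j) \<noteq> 0" for j
  proof -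
    have cF: "col ?F j \<in> carrier_vec r" using col_dim[of ?F j] carrier_matD(1)[OF F] by simp
    have ci: "col ?F j $ a = ?F $$ (a, j)" using carrier_matD[OF F] ab(1) j(1) by (intro index_col) auto
    have "k a + degree (col ?F j $ a) \<le> d"
    proof (rule predictable_degree[OF P leadP Pd cF _ ab(1)])
      fix i assume i: "i < m"
      have "P *\<^sub>v col ?F j = col (P * E * Q\<^sup>T) j"
        unfolding assoc_mult_mat[OF P E Qt] by (rule col_mult_mat_vec[OF P F j(1), symmetric])
      moreover have "col (P * E * Q\<^sup>T) j $ i = (P * E * Q\<^sup>T) $$ (i, j)"
        using carrier_matD[OF mult_carrier_mat[OF mult_carrier_mat[OF P E] Qt]] i j(1) by (intro index_col) auto
      ultimately show "degree ((P *\<^sub>v col ?F j) $ i) \<le> d" using d[OF i j(1)] by simp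
    next
      show "col ?F j $ a \<noteq> 0" unfolding ci by (rule j(2))
    qed
    thus ?thesis unfolding ci .
  qed
  have re: "row E a \<in> carrier_vec r" using E ab by auto
  have Qrow: "(Q *\<^sub>v row E a) $ j = ?F $$ (a, j)" if j: "j < n" for j
    unfolding mult_mat_vec_index[OF Q re j] mult_mat_index[OF E Qt ab(1) j]
    using E Q ab j by (intro sum.cong) (auto simp: mult.commute)
  have "\<exists>j<n. ?F $$ (a, j) \<noteq> 0"
  proof (rule ccontr)
    assume "\<not> ?thesis"
    hence z: "\<And>j. j < n \<Longrightarrow> ?F $$ (a, j) = 0" by blast
    have "Q *\<^sub>v row E a = 0\<^sub>v n"
    proof (rule eq_vecI)
      fix j assume "j < dim_vec (0\<^sub>v n :: 'a poly vec)"
      hence j: "j < n" by simp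
      show "(Q *\<^sub>v row E a) $ j = 0\<^sub>v n $ j" unfolding Qrow[OF j] z[OF j] using j by simp
    qed (use Q in simp)
    hence "row E a = 0\<^sub>v r" by (rule col_injectiveD[OF injQ Q re])
    hence "row E a $ b = 0" using ab by simp
    thus False using E ab by simp
  qed
  then obtain j where j: "j < n" "?F $$ (a, j) \<noteq> 0" by blast
  have ka: "k a \<le> d" using bF[OF j] by simp
  have "l b + degree (row E a $ b) \<le> d - k a"
  proof (rule predictable_degree[OF Q leadQ Qd re _ ab(2)])
    fix j assume j: "j < n"
    show "degree ((Q *\<^sub>v row E a) $ j) \<le> d - k a"
      unfolding Qrow[OF j] using bF[OF j] by (cases "?F $$ (a, j) = 0") auto
  next
    show "row E a $ b \<noteq> 0" using E ab by simp
  qed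
  hence "l b + degree (E $$ (a, b)) \<le> d - k a" using E ab by simp
  thus ?thesis using ka by linarith
qed

lemma factor_through_generators:
  fixes A P :: "'a::field poly mat"
  assumes A: "A \<in> carrier_mat m n" and P: "P \<in> carrier_mat m r" and M: "minimal_columns A P"
    and G: "G \<in> carrier_mat r m" "G * P = 1\<^sub>m r"
  shows "P * (G * A) = A"
proof -
  have "\<exists>x. x \<in> carrier_vec r \<and> col A j = P *\<^sub>v x" if j: "j < n" for j
  proof -
    have "col A j = A *\<^sub>v unit_vec n j" using mat_mult_unit_vec[OF A j] ..
    hence "col A j \<in> rational_span A" using mult_in_rational_span[OF A, of "unit_vec n j"] by simp
    then obtain x where "x \<in> carrier_vec r" "col A j = P *\<^sub>v x" by (rule minimal_columns_generate[OF A P M])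
    thus ?thesis by blast
  qed
  then obtain X where X: "X \<in> carrier_mat r n" "A = P * X" by (rule cols_in_image[OF P A])
  have "G * A = X" unfolding X(2) assoc_mult_mat[OF G(1) P X(1), symmetric] G(2) by (rule left_mult_one_mat[OF X(1)])
  thus ?thesis using X(2) by simp
qed

text \<open>
  The reversal in formal degree \<open>j d\<close> of a minor of \<open>E\<close> is the minor of the reversed core times
  powers of \<open>t\<close> that come from the column degrees. Comparing orders at \<open>t = 0\<close> turns the defect
  \<open>j d\<close> minus the degree of the minor into a sum of three contributions.
\<close>

lemma core_rev_minor:
  fixes E :: "'a::field poly mat"
  assumes E: "E \<in> carrier_mat r r"
    and Ed: "\<And>a b. a < r \<Longrightarrow> b < r \<Longrightarrow> E $$ (a, b) \<noteq> 0 \<Longrightarrow> k a + l b \<le> d \<and> degree (E $$ (a, b)) \<le> d - k a - l b"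
    and fg: "\<And>i. i < j \<Longrightarrow> f i < r" "\<And>i. i < j \<Longrightarrow> g i < r"
    and nz: "det (mat j j (\<lambda>(a, b). E $$ (f a, g b))) \<noteq> 0"
  shows "det (mat j j (\<lambda>(a, b). core_rev r d k l E $$ (f a, g b))) \<noteq> 0"
    and "degree (det (mat j j (\<lambda>(a, b). E $$ (f a, g b))))
      + ((\<Sum>i<j. k (f i)) + (\<Sum>i<j. l (g i)))
      + order 0 (det (mat j j (\<lambda>(a, b). core_rev r d k l E $$ (f a, g b)))) = j * d"
proof -
  let ?M = "mat j j (\<lambda>(a, b). E $$ (f a, g b))"
  let ?N = "mat j j (\<lambda>(a, b). core_rev r d k l E $$ (f a, g b))"
  let ?t = "[:0, 1:] :: 'a poly"
  have M: "?M \<in> carrier_mat j j" and N: "?N \<in> carrier_mat j j" by auto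
  have dM: "degree (?M $$ (a, b)) \<le> d" if "a < j" "b < j" for a b
    using Ed[OF fg(1)[OF that(1)] fg(2)[OF that(2)]] that by (cases "E $$ (f a, g b) = 0") auto
  have e: "rev_poly d (E $$ (f a, g b)) = ?t ^ k (f a) * ?t ^ l (g b) * core_rev r d k l E $$ (f a, g b)"
    if ab: "a < j" "b < j" for a b
  proof (cases "E $$ (f a, g b) = 0")
    case True thus ?thesis using fg ab by (simp add: core_rev_def rev_poly_moebius)
  next
    case False
    note b = Ed[OF fg(1)[OF ab(1)] fg(2)[OF ab(2)] False]
    let ?e = "d - k (f a) - l (g b)"
    have "rev_poly (?e + (k (f a) + l (g b))) (E $$ (f a, g b)) = rev_poly ?e (E $$ (f a, g b)) * ?t ^ (k (f a) + l (g b))"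
      unfolding rev_poly_moebius using b by (intro moebius_pad) simp
    moreover have "?e + (k (f a) + l (g b)) = d" using b by linarith
    ultimately show ?thesis using fg ab by (simp add: core_rev_def power_add mult_ac)
  qed
  have "map_mat (rev_poly d) ?M = mat j j (\<lambda>(a, b). ?t ^ k (f a) * ?t ^ l (g b) * ?N $$ (a, b))"
    by (rule eq_matI) (auto simp: e)
  hence "rev_poly (j * d) (det ?M) = (\<Prod>i<j. ?t ^ k (f i)) * (\<Prod>i<j. ?t ^ l (g i)) * det ?N"
    using rev_poly_det(1)[OF M dM] det_scale_rows_cols[OF N] by simp
  hence rv: "rev_poly (j * d) (det ?M) = ?t ^ ((\<Sum>i<j. k (f i)) + (\<Sum>i<j. l (g i))) * det ?N"
    by (simp add: power_add power_sum)
  have dd: "degree (det ?M) \<le> j * d" by (rule rev_poly_det(2)[OF M dM])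
  have nz': "rev_poly (j * d) (det ?M) \<noteq> 0" using rev_poly_eq_0_iff[OF dd] nz by blast
  show N0: "det ?N \<noteq> 0" using nz' rv by auto
  have "j * d - degree (det ?M) = order 0 (?t ^ ((\<Sum>i<j. k (f i)) + (\<Sum>i<j. l (g i)))) + order 0 (det ?N)"
    unfolding order_0_rev_poly[OF nz dd, symmetric] rv using nz' rv by (intro order_mult) simp
  moreover have "order 0 (?t ^ n) = n" for n using order_power_n_n[of "0::'a" n] by simp
  ultimately have "j * d - degree (det ?M) = ((\<Sum>i<j. k (f i)) + (\<Sum>i<j. l (g i))) + order 0 (det ?N)" by simp
  thus "degree (det ?M) + ((\<Sum>i<j. k (f i)) + (\<Sum>i<j. l (g i))) + order 0 (det ?N) = j * d" using dd by linarith
qed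

lemma rev_mat_carrier: "A \<in> carrier_mat m n \<Longrightarrow> rev_mat A \<in> carrier_mat m n"
  by (simp add: rev_mat_def)

lemma minimal_columns_injective: "minimal_columns A P \<Longrightarrow> col_injective P"
  by (simp add: minimal_columns_def column_basis_def)

text \<open>
  For positions \<open>e 0, \<dots>, e (j - 1)\<close> the core \<open>E\<close> has a nonzero minor whose rows come before, and
  whose columns come after, these positions. Its degree is at least that of
  \<open>\<alpha>\<^sub>1 \<dots> \<alpha>\<^sub>j\<close>, the order at 0 of its reversal is at least \<open>f\<^sub>1 + \<dots> + f\<^sub>j\<close>, and the indices of its rows
  and columns are at least those at the given positions, because \<open>k\<close> decreases and the reversed list
  \<open>l\<close> increases. All of this adds up to \<open>j d\<close>. The full determinant gives equality.
\<close>

lemma necessary_inequalities: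
  fixes A :: "'a::field poly mat"
  assumes A: "A \<in> carrier_mat m n" and pos: "0 < m" "0 < n" and r: "r \<le> m" "r \<le> n"
    and data: "has_data r d \<alpha>s fs ks ls A"
    and len: "length ks = r" "length ls = r" and mono: "sorted_wrt (\<ge>) ks" "sorted_wrt (\<ge>) ls"
  shows "\<And>j e. inj_on e {..<j} \<Longrightarrow> (\<And>i. i < j \<Longrightarrow> e i < r) \<Longrightarrow>
      (\<Sum>i<j. degree (\<alpha>s ! i) + fs ! i) + (\<Sum>i<j. ks ! e i + rev ls ! e i) \<le> j * d"
    and "(\<Sum>i<r. degree (\<alpha>s ! i) + fs ! i) + (\<Sum>i<r. ks ! i + rev ls ! i) = r * d"
proof -
  define k where "k = (\<lambda>i. ks ! i)"
  define l where "l = (\<lambda>i. rev ls ! i)"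
  have rk: "pm_rank A = r" and dA: "mat_degree A = d" and inv: "invariant_factors A \<alpha>s"
    and pmi: "partial_multiplicities_inf A fs" and ck: "col_span_minimal_indices A ks"
    and cl: "col_span_minimal_indices A\<^sup>T ls"
    using data unfolding has_data_def row_span_minimal_indices_def by auto
  have At: "A\<^sup>T \<in> carrier_mat n m" using A by simp
  have sk: "sorted (rev ks)" "sorted (rev ls)" using mono by (simp_all add: sorted_wrt_rev)
  have kmono: "k j \<le> k i" if "i \<le> j" "j < r" for i j
    using mono(1) that len(1) sorted_wrt_nth_less[OF mono(1), of i j] unfolding k_def by (cases "i = j") auto
  have lmono: "l i \<le> l j" if "i \<le> j" "j < r" for i j
    unfolding l_def using sorted_nth_mono[OF sk(2) that(1)] that len(2) by simp
  obtain P where P: "P \<in> carrier_mat m r" "minimal_columns A P" "\<And>j. j < r \<Longrightarrow> vec_degree (col P j) = k j"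
    using minimal_columns_of_indices[OF A ck, of ks] sk unfolding len k_def by blast
  obtain Q where Q: "Q \<in> carrier_mat n r" "minimal_columns A\<^sup>T Q" "\<And>j. j < r \<Longrightarrow> vec_degree (col Q j) = l j"
    using minimal_columns_of_indices[OF At cl, of "rev ls"] sk unfolding len l_def by auto
  obtain G where G: "G \<in> carrier_mat r m" "G * P = 1\<^sub>m r" by (rule minimal_columns_left_inverse[OF A P(1,2) r(1)])
  obtain H where H: "H \<in> carrier_mat r n" "H * Q = 1\<^sub>m r" by (rule minimal_columns_left_inverse[OF At Q(1,2) r(2)])
  have Ht: "H\<^sup>T \<in> carrier_mat n r" and Qt: "Q\<^sup>T \<in> carrier_mat r n" using H Q by auto
  have GA: "G * A \<in> carrier_mat r n" by (rule mult_carrier_mat[OF G(1) A])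
  define E where "E = G * A * H\<^sup>T"
  have E: "E \<in> carrier_mat r r" unfolding E_def by (rule mult_carrier_mat[OF GA Ht])
  have PGA: "P * (G * A) = A" by (rule factor_through_generators[OF A P(1,2) G])
  have "Q * (H * A\<^sup>T) = A\<^sup>T" by (rule factor_through_generators[OF At Q(1,2) H])
  hence "(Q * (H * A\<^sup>T))\<^sup>T = A" by simp
  hence AHQ: "A * H\<^sup>T * Q\<^sup>T = A"
    unfolding transpose_mult[OF Q(1) mult_carrier_mat[OF H(1) At]] transpose_mult[OF H(1) At] by simp
  have fact: "A = P * E * Q\<^sup>T"
  proof -
    have "P * E = A * H\<^sup>T" unfolding E_def assoc_mult_mat[OF P(1) GA Ht, symmetric] PGA ..
    thus ?thesis using AHQ by simp
  qed
  have colcong: "lead_mat X (\<lambda>j. vec_degree (col X j)) = lead_mat X c"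
    if "X \<in> carrier_mat p r" "\<And>j. j < r \<Longrightarrow> vec_degree (col X j) = c j" for X :: "'a poly mat" and p c
    using that by (intro eq_matI) (auto simp: lead_mat_def)
  have lP: "lead_mat P (\<lambda>j. vec_degree (col P j)) = lead_mat P k" by (rule colcong[OF P(1)]) (rule P(3))
  have lQ: "lead_mat Q (\<lambda>j. vec_degree (col Q j)) = lead_mat Q l" by (rule colcong[OF Q(1)]) (rule Q(3))
  have leadP: "col_injective (lead_mat P k)" using minimal_columns_lead_injective[OF A P(1,2)] unfolding lP .
  have leadQ: "col_injective (lead_mat Q l)" using minimal_columns_lead_injective[OF At Q(1,2)] unfolding lQ .
  have Pd: "degree (P $$ (i, a)) \<le> k a" if "i < m" "a < r" for i a
    using degree_le_vec_degree[of "col P a" m i] P(1) P(3)[OF that(2)] that by simp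
  have Qd: "degree (Q $$ (j, b)) \<le> l b" if "j < n" "b < r" for j b
    using degree_le_vec_degree[of "col Q b" n j] Q(1) Q(3)[OF that(2)] that by simp
  have injP: "col_injective P" by (rule minimal_columns_injective[OF P(2)])
  have injQ: "col_injective Q" by (rule minimal_columns_injective[OF Q(2)])
  have Ed: "k a + l b \<le> d \<and> degree (E $$ (a, b)) \<le> d - k a - l b" if "a < r" "b < r" "E $$ (a, b) \<noteq> 0" for a b
  proof (rule degree_bound_of_core[OF P(1) E Q(1) Pd Qd leadP leadQ injQ _ that])
    fix i j assume "i < m" "j < n"
    thus "degree ((P * E * Q\<^sup>T) $$ (i, j)) \<le> d" unfolding fact[symmetric] dA[symmetric] by (rule degree_le_mat_degree[OF A])
  qed
  \<comment> \<open>\<open>E\<close> and the Smith form of \<open>A\<close> are two-sided multiples of each other.\<close>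
  obtain U V where UV: "unimodular m U" "unimodular n V" "U * A * V = diag_rect_mat m n \<alpha>s" and la: "length \<alpha>s = r"
    and \<alpha>nz': "\<forall>i<r. \<alpha>s ! i \<noteq> 0" and \<alpha>ch': "\<forall>i k. i \<le> k \<longrightarrow> k < r \<longrightarrow> \<alpha>s ! i dvd \<alpha>s ! k"
    by (rule invariant_factorsE[OF A inv rk])
  have \<alpha>nz: "\<alpha>s ! i \<noteq> 0" if "i < r" for i using \<alpha>nz' that by blast
  have \<alpha>ch: "\<alpha>s ! i dvd \<alpha>s ! k" if "i \<le> k" "k < r" for i k using \<alpha>ch' that by blast
  have c: "U \<in> carrier_mat m m" "V \<in> carrier_mat n n" using UV by (auto simp: unimodular_def)
  let ?Da = "mat_diag r (\<lambda>i. \<alpha>s ! i)"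
  have lam: "length \<alpha>s \<le> min m n" using r la by simp
  obtain P0 Q0 G0 H0 where f: "P0 \<in> carrier_mat m r" "Q0 \<in> carrier_mat n r" "A = P0 * ?Da * Q0\<^sup>T"
    by (rule smith_thin_factorization[OF A UV lam, unfolded la]) (rule that, assumption+)
  have Q0t: "Q0\<^sup>T \<in> carrier_mat r n" using f(2) by simp
  let ?X = "G * P0" and ?Y = "Q0\<^sup>T * H\<^sup>T"
  have X: "?X \<in> carrier_mat r r" by (rule mult_carrier_mat[OF G(1) f(1)])
  have Y: "?Y \<in> carrier_mat r r" by (rule mult_carrier_mat[OF Q0t Ht])
  have EXY: "E = ?X * ?Da * ?Y"
  proof -
    have PD: "P0 * ?Da \<in> carrier_mat m r" by (rule mult_carrier_mat[OF f(1) mat_diag_carrier])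
    have "E = G * (P0 * ?Da) * Q0\<^sup>T * H\<^sup>T" unfolding E_def
      by (subst f(3)) (simp only: assoc_mult_mat[OF G(1) PD Q0t])
    also have "\<dots> = ?X * ?Da * Q0\<^sup>T * H\<^sup>T" unfolding assoc_mult_mat[OF G(1) f(1) mat_diag_carrier] ..
    also have "\<dots> = ?X * ?Da * ?Y" by (rule assoc_mult_mat[OF mult_carrier_mat[OF X mat_diag_carrier] Q0t Ht])
    finally show ?thesis .
  qed
  have VQ: "V\<^sup>T * Q \<in> carrier_mat n r" using c Q(1) by simp
  let ?T = "top_rows r (U * P)" and ?T' = "(top_rows r (V\<^sup>T * Q))\<^sup>T"
  have T: "?T \<in> carrier_mat r r" by (rule top_rows_carrier[OF mult_carrier_mat[OF c(1) P(1)]])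
  have T': "?T' \<in> carrier_mat r r" using top_rows_carrier[OF VQ, of r] by simp
  have DTE: "?Da = ?T * E * ?T'"
    by (rule diag_of_factor[OF P(1) E Q(1) r c UV(3)[unfolded fact] la])
  have pa: "(\<Prod>i<r. \<alpha>s ! i) \<noteq> 0" using \<alpha>nz by simp
  have d1: "det E dvd (\<Prod>i<r. \<alpha>s ! i)"
  proof -
    have "(\<Prod>i<r. \<alpha>s ! i) = det ?T * det E * det ?T'"
      unfolding det_mat_diag[symmetric] by (subst DTE) (simp add: det_mult[OF mult_carrier_mat[OF T E] T'] det_mult[OF T E])
    thus ?thesis by simp
  qed
  have d2: "(\<Prod>i<r. \<alpha>s ! i) dvd det E"
    by (subst EXY) (simp add: det_mult[OF mult_carrier_mat[OF X mat_diag_carrier] Y] det_mult[OF X mat_diag_carrier] det_mat_diag)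
  have detE: "det E \<noteq> 0" using d1 pa by auto
  have degE: "degree (det E) = (\<Sum>i<r. degree (\<alpha>s ! i))"
  proof -
    have "degree (det E) = degree (\<Prod>i<r. \<alpha>s ! i)"
      using dvd_imp_degree_le[OF d1 pa] dvd_imp_degree_le[OF d2 detE] by simp
    also have "\<dots> = (\<Sum>i<r. degree (\<alpha>s ! i))" using \<alpha>nz by (intro degree_prod_eq_sum_degree) auto
    finally show ?thesis .
  qed
  \<comment> \<open>At \<open>t = 0\<close> the reversed outer factors are the injective matrices of leading coefficients.\<close>
  define Er where "Er = core_rev r d k l E"
  have Er: "Er \<in> carrier_mat r r" by (simp add: Er_def core_rev_def)
  let ?P = "rev_cols k P" and ?Q = "rev_cols l Q"
  have Pr: "?P \<in> carrier_mat m r" and Qr: "?Q \<in> carrier_mat n r" using P(1) Q(1) by (auto intro: rev_cols_carrier)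
  have Qrt: "?Q\<^sup>T \<in> carrier_mat r n" using Qr by simp
  have R: "rev_mat A = ?P * Er * ?Q\<^sup>T"
  proof (rule mat_eq_by_entries[OF rev_mat_carrier[OF A] mult_carrier_mat[OF mult_carrier_mat[OF Pr Er] Qrt]])
    fix i j assume ij: "i < m" "j < n"
    have "rev_mat A $$ (i, j) = rev_poly d (A $$ (i, j))" using A ij by (simp add: rev_mat_def dA)
    also have "\<dots> = rev_poly d ((P * E * Q\<^sup>T) $$ (i, j))" unfolding fact[symmetric] ..
    also have "\<dots> = (?P * Er * ?Q\<^sup>T) $$ (i, j)"
      unfolding Er_def by (rule reversed_factorization(2)[OF P(1) E Q(1) Pd Qd Ed ij])
    finally show "rev_mat A $$ (i, j) = (?P * Er * ?Q\<^sup>T) $$ (i, j)" .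
  qed
  have atP: "col_injective (map_mat (\<lambda>p. poly p 0) ?P)" and atQ: "col_injective (map_mat (\<lambda>p. poly p 0) ?Q)"
    unfolding rev_cols_at_0 by (rule leadP, rule leadQ)
  have injPr: "col_injective ?P" and injQr: "col_injective ?Q"
    by (rule injective_of_injective_at[OF Pr r(1) atP], rule injective_of_injective_at[OF Qr r(2) atQ])
  have id: "mat r r (\<lambda>(a, b). Z $$ (a, b)) = Z" if "Z \<in> carrier_mat r r" for Z :: "'a poly mat"
    using that by (intro eq_matI) auto
  have full: "det (mat r r (\<lambda>(a, b). E $$ (a, b))) \<noteq> 0" unfolding id[OF E] by (rule detE)
  have detEr: "det Er \<noteq> 0"
  proof -
    have "det (mat r r (\<lambda>(a, b). Er $$ (a, b))) \<noteq> 0"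
      unfolding Er_def by (rule core_rev_minor(1)[OF E Ed, where f = "\<lambda>i. i" and g = "\<lambda>i. i"]) (assumption | rule full)+
    thus ?thesis unfolding id[OF Er] .
  qed
  have tot: "degree (det E) + ((\<Sum>i<r. k i) + (\<Sum>i<r. l i)) + order 0 (det Er) = r * d"
  proof -
    have "degree (det (mat r r (\<lambda>(a, b). E $$ (a, b)))) + ((\<Sum>i<r. k i) + (\<Sum>i<r. l i))
        + order 0 (det (mat r r (\<lambda>(a, b). Er $$ (a, b)))) = r * d"
      unfolding Er_def by (rule core_rev_minor(2)[OF E Ed, where f = "\<lambda>i. i" and g = "\<lambda>i. i"]) (assumption | rule full)+
    thus ?thesis unfolding id[OF E] id[OF Er] .
  qed
  obtain \<beta>s where \<beta>: "invariant_factors (rev_mat A) \<beta>s" "fs = map (order 0) \<beta>s"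
    using pmi unfolding partial_multiplicities_inf_def by blast
  have "column_basis (rev_mat A) ?P"
    unfolding R by (rule column_basis_of_factorization[OF Pr Er Qr detEr injPr injQr r(2)])
  from column_basis_cols(2)[OF rev_mat_carrier[OF A] this] have rkR: "pm_rank (rev_mat A) = r" using Pr by simp
  obtain U2 V2 where UV2: "unimodular m U2" "unimodular n V2" "U2 * rev_mat A * V2 = diag_rect_mat m n \<beta>s"
    and lb: "length \<beta>s = r"
    and \<beta>nz': "\<forall>i<r. \<beta>s ! i \<noteq> 0" and \<beta>ch': "\<forall>i k. i \<le> k \<longrightarrow> k < r \<longrightarrow> \<beta>s ! i dvd \<beta>s ! k"
    by (rule invariant_factorsE[OF rev_mat_carrier[OF A] \<beta>(1) rkR])
  have \<beta>nz: "\<beta>s ! i \<noteq> 0" if "i < r" for i using \<beta>nz' that by blast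
  have \<beta>ch: "\<beta>s ! i dvd \<beta>s ! k" if "i \<le> k" "k < r" for i k using \<beta>ch' that by blast
  have c2: "U2 \<in> carrier_mat m m" "V2 \<in> carrier_mat n n" using UV2 by (auto simp: unimodular_def)
  have V2t: "unimodular n V2\<^sup>T" by (rule unimodular_transpose[OF UV2(2)])
  have V2tc: "V2\<^sup>T \<in> carrier_mat n n" using c2 by simp
  have bz1: "bottom_zero r (U2 * ?P)"
    by (rule compressed_factor[OF Pr Er Qr detEr injQr r(2) UV2(1,2) UV2(3)[unfolded R]]) (simp add: lb)
  have bz2: "bottom_zero r (V2\<^sup>T * ?Q)"
    by (rule compressed_factor_right[OF Pr Er Qr detEr injPr r(1) UV2(1,2) UV2(3)[unfolded R]]) (simp add: lb)
  let ?S = "top_rows r (U2 * ?P)" and ?S' = "top_rows r (V2\<^sup>T * ?Q)"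
  have S: "?S \<in> carrier_mat r r" by (rule top_rows_carrier[OF mult_carrier_mat[OF c2(1) Pr]])
  have S': "?S' \<in> carrier_mat r r" by (rule top_rows_carrier[OF mult_carrier_mat[OF V2tc Qr]])
  have S't: "?S'\<^sup>T \<in> carrier_mat r r" using S' by simp
  have S0: "poly (det ?S) 0 \<noteq> 0" by (rule det_top_rows_nonzero_at[OF Pr r(1) UV2(1) bz1 atP])
  have S'0: "poly (det ?S'\<^sup>T) 0 \<noteq> 0"
    unfolding det_transpose[OF S'] by (rule det_top_rows_nonzero_at[OF Qr r(2) V2t bz2 atQ])
  let ?Db = "mat_diag r (\<lambda>i. \<beta>s ! i)"
  have DSE: "?Db = ?S * Er * ?S'\<^sup>T"
    by (rule diag_of_factor[OF Pr Er Qr r c2 UV2(3)[unfolded R] lb])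
  define w where "w = det ?S * det ?S'\<^sup>T"
  have w: "w \<noteq> 0" "order 0 w = 0" using S0 S'0 by (auto simp: w_def intro!: order_0I)
  have fsi: "fs ! i = order 0 (\<beta>s ! i)" if "i < r" for i using \<beta>(2) that lb by simp
  have wEr: "w \<cdot>\<^sub>m Er = adj_mat ?S * ?Db * adj_mat ?S'\<^sup>T"
    unfolding DSE w_def by (rule adjugate_reverses_factorization[OF S Er S't, symmetric])
  have ord_total: "order 0 (det Er) = (\<Sum>i<r. fs ! i)"
  proof -
    have "(\<Prod>i<r. \<beta>s ! i) = w * det Er"
      unfolding det_mat_diag[symmetric] w_def
      by (subst DSE) (simp add: det_mult[OF mult_carrier_mat[OF S Er] S't] det_mult[OF S Er] mult_ac)
    hence "(\<Sum>i<r. order 0 (\<beta>s ! i)) = order 0 (w * det Er)"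
      using order_prod[of "{..<r}" "\<lambda>i. \<beta>s ! i" 0] \<beta>nz by simp
    also have "\<dots> = order 0 (det Er)" using order_mult[of w "det Er" 0] w detEr by simp
    finally show ?thesis using fsi by simp
  qed
  show "(\<Sum>i<r. degree (\<alpha>s ! i) + fs ! i) + (\<Sum>i<r. ks ! i + rev ls ! i) = r * d"
    using tot unfolding degE ord_total k_def l_def by (simp add: sum.distrib)
  fix j and e :: "nat \<Rightarrow> nat"
  assume e: "inj_on e {..<j}" "\<And>i. i < j \<Longrightarrow> e i < r"
  have "\<exists>f g. (\<forall>i<j. f i \<le> e i \<and> e i \<le> g i \<and> g i < r) \<and> det (mat j j (\<lambda>(a, b). E $$ (f a, g b))) \<noteq> 0"
    by (rule exists_dominated_minor[OF E detE e(1)]) (rule e(2))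
  then obtain f g where fg: "\<forall>i<j. f i \<le> e i \<and> e i \<le> g i \<and> g i < r"
    "det (mat j j (\<lambda>(a, b). E $$ (f a, g b))) \<noteq> 0"
    by (elim exE conjE) (rule that)
  have fr: "f i < r" "g i < r" if "i < j" for i using fg(1) e(2)[OF that] that by (auto intro: le_less_trans)
  have jr: "j \<le> r" using card_inj_on_le[OF e(1), of "{..<r}"] e(2) by auto
  let ?mE = "det (mat j j (\<lambda>(a, b). E $$ (f a, g b)))" and ?mR = "det (mat j j (\<lambda>(a, b). Er $$ (f a, g b)))"
  have cr1: "?mR \<noteq> 0"
    unfolding Er_def by (rule core_rev_minor(1)[OF E Ed]) (assumption | rule fg(2) fr)+
  have cr2: "degree ?mE + ((\<Sum>i<j. k (f i)) + (\<Sum>i<j. l (g i))) + order 0 ?mR = j * d"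
    unfolding Er_def by (rule core_rev_minor(2)[OF E Ed]) (assumption | rule fg(2) fr)+
  have "(\<Prod>i<j. \<alpha>s ! i) dvd ?mE"
    unfolding EXY by (rule prod_initial_dvd_minor[OF X Y]) (assumption | rule fr \<alpha>ch)+
  from dvd_imp_degree_le[OF this fg(2)] have degm: "(\<Sum>i<j. degree (\<alpha>s ! i)) \<le> degree ?mE"
    using \<alpha>nz jr by (subst (asm) degree_prod_eq_sum_degree) auto
  have "(\<Prod>i<j. \<beta>s ! i) dvd det (mat j j (\<lambda>(a, b). (w \<cdot>\<^sub>m Er) $$ (f a, g b)))"
    unfolding wEr by (rule prod_initial_dvd_minor[OF adj_mat(1)[OF S] adj_mat(1)[OF S't]]) (assumption | rule fr \<beta>ch)+
  also have "mat j j (\<lambda>(a, b). (w \<cdot>\<^sub>m Er) $$ (f a, g b)) = w \<cdot>\<^sub>m mat j j (\<lambda>(a, b). Er $$ (f a, g b))"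
    by (rule eq_matI) (use Er fr in auto)
  finally have dv: "(\<Prod>i<j. \<beta>s ! i) dvd w ^ j * ?mR" by simp
  have nzR: "w ^ j * ?mR \<noteq> 0" using w cr1 by simp
  have "(\<Sum>i<j. fs ! i) = order 0 (\<Prod>i<j. \<beta>s ! i)"
    using order_prod[of "{..<j}" "\<lambda>i. \<beta>s ! i" 0] \<beta>nz jr fsi by simp
  also have "\<dots> \<le> order 0 (w ^ j * ?mR)" by (rule dvd_imp_order_le'[OF dv nzR])
  also have "\<dots> = order 0 ?mR" using order_mult[OF nzR] w order_power_eq[OF w(1)] by simp
  finally have ordm: "(\<Sum>i<j. fs ! i) \<le> order 0 ?mR" .
  have "(\<Sum>i<j. k (e i)) \<le> (\<Sum>i<j. k (f i))" using fg(1) e(2) by (intro sum_mono kmono) auto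
  moreover have "(\<Sum>i<j. l (e i)) \<le> (\<Sum>i<j. l (g i))" using fg(1) by (intro sum_mono lmono) auto
  ultimately show "(\<Sum>i<j. degree (\<alpha>s ! i) + fs ! i) + (\<Sum>i<j. ks ! e i + rev ls ! e i) \<le> j * d"
    using cr2 degm ordm unfolding k_def l_def sum.distrib by linarith
qed

text \<open>
  Otherwise \<open>t\<close> would divide all invariant factors of the reversal, hence all its entries, whereas
  the value of the reversal at 0 is the nonzero coefficient matrix of the top degree.
\<close>

lemma smallest_multiplicity_zero:
  fixes A :: "'a::field poly mat"
  assumes A: "A \<in> carrier_mat m n" and pos: "0 < m" "0 < n" "0 < r" and "pm_rank (rev_mat A) = r"
    and "partial_multiplicities_inf A fs" and "length fs = r"
  shows "fs ! 0 = 0"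
proof (rule ccontr)
  assume f0: "fs ! 0 \<noteq> 0"
  obtain \<beta>s where \<beta>: "invariant_factors (rev_mat A) \<beta>s" "fs = map (order 0) \<beta>s"
    using assms(6) unfolding partial_multiplicities_inf_def by blast
  have R: "rev_mat A \<in> carrier_mat m n" by (rule rev_mat_carrier[OF A])
  have lb: "length \<beta>s = r" using \<beta>(2) assms(7) by simp
  obtain U V where UV: "unimodular m U" "unimodular n V" "U * rev_mat A * V = diag_rect_mat m n \<beta>s"
    and "length \<beta>s = r" and nz': "\<forall>i<r. \<beta>s ! i \<noteq> 0"
    and ch': "\<forall>i k. i \<le> k \<longrightarrow> k < r \<longrightarrow> \<beta>s ! i dvd \<beta>s ! k"
    by (rule invariant_factorsE[OF R \<beta>(1) assms(5)])
  have nz: "\<beta>s ! i \<noteq> 0" if "i < r" for i using nz' that by blast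
  have ch: "\<beta>s ! i dvd \<beta>s ! k" if "i \<le> k" "k < r" for i k using ch' that by blast
  let ?t = "[:0, 1:] :: 'a poly"
  have "poly (\<beta>s ! 0) 0 = 0" using f0 \<beta>(2) lb pos nz[of 0] by (simp add: order_root)
  hence t0: "?t dvd \<beta>s ! 0" using poly_eq_0_iff_dvd[of "\<beta>s ! 0" 0] by simp
  have t: "?t dvd \<beta>s ! i" if "i < r" for i using dvd_trans[OF t0 ch[of 0 i]] that lb by simp
  obtain W where W: "W \<in> carrier_mat m m" "U * W = 1\<^sub>m m" "W * U = 1\<^sub>m m" by (rule unimodular_inverse[OF UV(1)])
  obtain Z where Z: "Z \<in> carrier_mat n n" "V * Z = 1\<^sub>m n" "Z * V = 1\<^sub>m n" by (rule unimodular_inverse[OF UV(2)])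
  have c: "U \<in> carrier_mat m m" "V \<in> carrier_mat n n" using UV by (auto simp: unimodular_def)
  have UR: "U * rev_mat A \<in> carrier_mat m n" by (rule mult_carrier_mat[OF c(1) R])
  let ?D = "diag_rect_mat m n \<beta>s"
  have D: "?D \<in> carrier_mat m n" by (simp add: diag_rect_mat_def)
  have "?D * Z = U * rev_mat A" unfolding UV(3)[symmetric] assoc_mult_mat[OF UR c(2) Z(1)] Z(2) by (rule right_mult_one_mat[OF UR])
  hence "W * (?D * Z) = rev_mat A"
    using assoc_mult_mat[OF W(1) c(1) R] left_mult_one_mat[OF R] unfolding W(3) by simp
  moreover have "?t dvd (W * (?D * Z)) $$ (i, j)" if ij: "i < m" "j < n" for i j
  proof (rule dvd_entries_mult[OF W(1) mult_carrier_mat[OF D Z(1)] disjI2 ij], intro allI impI)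
    fix a b assume ab: "a < m" "b < n"
    show "?t dvd (?D * Z) $$ (a, b)"
      by (rule dvd_entries_mult[OF D Z(1) disjI1 ab]) (auto simp: diag_rect_mat_def t lb)
  qed
  ultimately have tR: "?t dvd rev_mat A $$ (i, j)" if "i < m" "j < n" for i j using that by simp
  obtain i j where ij: "i < m" "j < n" "degree (A $$ (i, j)) = mat_degree A" by (rule mat_degree_attained[OF A pos(1,2)])
  have "poly (rev_mat A $$ (i, j)) 0 = 0" using tR[OF ij(1,2)] poly_eq_0_iff_dvd[of "rev_mat A $$ (i, j)" 0] by simp
  hence "lead_coeff (A $$ (i, j)) = 0" using carrier_matD[OF A] ij by (simp add: rev_mat_def poly_rev_poly_0)
  hence "A $$ (i, j) = 0" by (rule leading_coeff_0_iff[THEN iffD1])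
  hence d0: "mat_degree A = 0" using ij(3) by simp
  have all0: "A $$ (a, b) = 0" if "a < m" "b < n" for a b
  proof -
    have "poly (rev_mat A $$ (a, b)) 0 = 0" using tR[OF that] poly_eq_0_iff_dvd[of "rev_mat A $$ (a, b)" 0] by simp
    hence "coeff (A $$ (a, b)) 0 = 0" using carrier_matD[OF A] that d0 by (simp add: rev_mat_def poly_rev_poly_0)
    moreover have "degree (A $$ (a, b)) = 0" using degree_le_mat_degree[OF A that] d0 by simp
    ultimately show ?thesis by (metis leading_coeff_0_iff)
  qed
  hence "rev_mat A = 0\<^sub>m m n" using A by (intro eq_matI) (auto simp: rev_mat_def rev_poly_moebius)
  hence "?D = 0\<^sub>m m n" unfolding UV(3)[symmetric] using c by simp
  hence "?D $$ (0, 0) = 0" using pos by simp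
  thus False using pos lb nz[of 0] by (simp add: diag_rect_mat_def)
qed

section \<open>Invariant factors of a product through a square core\<close>

lemma invariant_factors_exist:
  fixes A :: "'a::field poly mat"
  assumes A: "A \<in> carrier_mat m n"
  shows "\<exists>\<gamma>s. invariant_factors A \<gamma>s"
proof -
  obtain \<gamma>s where g: "length \<gamma>s \<le> min m n" "\<forall>\<gamma>\<in>set \<gamma>s. lead_coeff \<gamma> = 1" "sorted_wrt (dvd) \<gamma>s"
    "smith_equiv m n A (diag_rect_mat m n \<gamma>s)"
    using smith_form_exists[OF A] by blast
  then obtain U V where UV: "unimodular m U" "unimodular n V" "U * A * V = diag_rect_mat m n \<gamma>s"
    unfolding smith_equiv_def by metis
  have "pm_rank A = length \<gamma>s"
    by (rule pm_rank_eq_length_smith[OF A UV g(1)]) (use g(2) in auto)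
  moreover have "U \<in> carrier_mat m m" "V \<in> carrier_mat n n" using UV by (auto simp: unimodular_def)
  moreover have "invertible_mat U" "invertible_mat V" using UV by (auto intro: unimodular_imp_invertible_mat)
  ultimately have "invariant_factors A \<gamma>s"
    unfolding invariant_factors_def carrier_matD[OF A] using g(2,3) UV(3) by auto
  thus ?thesis ..
qed

text \<open>
  At a point where the outer factors are injective they contribute nothing to the orders of the
  invariant factors, which are then determined by the core.
\<close>

lemma orders_of_factorization:
  fixes P E Q :: "'a::field poly mat"
  assumes P: "P \<in> carrier_mat m r" and E: "E \<in> carrier_mat r r" and Q: "Q \<in> carrier_mat n r"
    and r: "r \<le> m" "r \<le> n" and det: "det E \<noteq> 0"
    and atP: "col_injective (map_mat (\<lambda>p. poly p a) P)" and atQ: "col_injective (map_mat (\<lambda>p. poly p a) Q)"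
    and inv: "invariant_factors (P * E * Q\<^sup>T) \<gamma>s"
  shows "(\<Sum>i<r. order a (\<gamma>s ! i)) = order a (det E)"
    and "X \<in> carrier_mat r r \<Longrightarrow> Y \<in> carrier_mat r r \<Longrightarrow> w \<cdot>\<^sub>m E = X * mat_diag r \<alpha> * Y \<Longrightarrow> w \<noteq> 0 \<Longrightarrow> order a w = 0 \<Longrightarrow>
      (\<forall>i<r. \<alpha> i \<noteq> 0) \<Longrightarrow> (\<forall>i k. i \<le> k \<longrightarrow> k < r \<longrightarrow> \<alpha> i dvd \<alpha> k) \<Longrightarrow> (\<Sum>i<r. order a (\<alpha> i)) = order a (det E) \<Longrightarrow>
      i < r \<Longrightarrow> order a (\<gamma>s ! i) = order a (\<alpha> i)"
proof -
  have Qt: "Q\<^sup>T \<in> carrier_mat r n" using Q by simp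
  have injP: "col_injective P" by (rule injective_of_injective_at[OF P r(1) atP])
  have injQ: "col_injective Q" by (rule injective_of_injective_at[OF Q r(2) atQ])
  have A: "P * E * Q\<^sup>T \<in> carrier_mat m n" by (rule mult_carrier_mat[OF mult_carrier_mat[OF P E] Qt])
  have cb: "column_basis (P * E * Q\<^sup>T) P" by (rule column_basis_of_factorization[OF P E Q det injP injQ r(2)])
  have rk: "pm_rank (P * E * Q\<^sup>T) = r" using column_basis_cols(2)[OF A cb] P by simp
  obtain U V where UV: "unimodular m U" "unimodular n V" "U * (P * E * Q\<^sup>T) * V = diag_rect_mat m n \<gamma>s"
    and lg: "length \<gamma>s = r"
    and nz: "\<forall>i<r. \<gamma>s ! i \<noteq> 0" and ch: "\<forall>i k. i \<le> k \<longrightarrow> k < r \<longrightarrow> \<gamma>s ! i dvd \<gamma>s ! k"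
    by (rule invariant_factorsE[OF A inv rk])
  have c: "U \<in> carrier_mat m m" "V \<in> carrier_mat n n" using UV by (auto simp: unimodular_def)
  have bz1: "bottom_zero r (U * P)" by (rule compressed_factor[OF P E Q det injQ r(2) UV]) (simp add: lg)
  have bz2: "bottom_zero r (V\<^sup>T * Q)" by (rule compressed_factor_right[OF P E Q det injP r(1) UV]) (simp add: lg)
  let ?S = "top_rows r (U * P)" and ?S' = "top_rows r (V\<^sup>T * Q)"
  have Vt: "V\<^sup>T \<in> carrier_mat n n" using c by simp
  have S: "?S \<in> carrier_mat r r" by (rule top_rows_carrier[OF mult_carrier_mat[OF c(1) P]])
  have S': "?S' \<in> carrier_mat r r" by (rule top_rows_carrier[OF mult_carrier_mat[OF Vt Q]])
  have S't: "?S'\<^sup>T \<in> carrier_mat r r" using S' by simp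
  have S0: "poly (det ?S) a \<noteq> 0" by (rule det_top_rows_nonzero_at[OF P r(1) UV(1) bz1 atP])
  have S'0: "poly (det ?S'\<^sup>T) a \<noteq> 0"
    unfolding det_transpose[OF S'] by (rule det_top_rows_nonzero_at[OF Q r(2) unimodular_transpose[OF UV(2)] bz2 atQ])
  let ?D = "mat_diag r (\<lambda>i. \<gamma>s ! i)"
  have D: "?D = ?S * E * ?S'\<^sup>T" by (rule diag_of_factor[OF P E Q r c UV(3) lg])
  let ?v = "det ?S * det ?S'\<^sup>T"
  have v: "?v \<noteq> 0" "order a ?v = 0" using S0 S'0 by (auto intro!: order_0I)
  have "(\<Prod>i<r. \<gamma>s ! i) = ?v * det E"
    unfolding det_mat_diag[symmetric]
    by (subst D) (simp add: det_mult[OF mult_carrier_mat[OF S E] S't] det_mult[OF S E] mult_ac)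
  hence "(\<Sum>i<r. order a (\<gamma>s ! i)) = order a (?v * det E)"
    using order_prod[of "{..<r}" "\<lambda>i. \<gamma>s ! i" a] nz by simp
  also have "\<dots> = order a (det E)" using order_mult[of ?v "det E" a] v det by simp
  finally show tot: "(\<Sum>i<r. order a (\<gamma>s ! i)) = order a (det E)" .
  assume X: "X \<in> carrier_mat r r" and Y: "Y \<in> carrier_mat r r" and eq: "w \<cdot>\<^sub>m E = X * mat_diag r \<alpha> * Y"
    and w: "w \<noteq> 0" "order a w = 0" and an: "\<forall>i<r. \<alpha> i \<noteq> 0"
    and ac: "\<forall>i k. i \<le> k \<longrightarrow> k < r \<longrightarrow> \<alpha> i dvd \<alpha> k" and at: "(\<Sum>i<r. order a (\<alpha> i)) = order a (det E)" and i: "i < r"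
  have SX: "?S * X \<in> carrier_mat r r" by (rule mult_carrier_mat[OF S X])
  have XD: "X * mat_diag r \<alpha> \<in> carrier_mat r r" by (rule mult_carrier_mat[OF X mat_diag_carrier])
  have "w \<cdot>\<^sub>m ?D = ?S * (w \<cdot>\<^sub>m E) * ?S'\<^sup>T"
    unfolding D mult_smult_distrib[OF S E] mult_smult_assoc_mat[OF mult_carrier_mat[OF S E] S't] ..
  also have "\<dots> = (?S * X) * mat_diag r \<alpha> * Y * ?S'\<^sup>T"
    unfolding eq assoc_mult_mat[OF S XD Y, symmetric] assoc_mult_mat[OF S X mat_diag_carrier, symmetric] ..
  also have "\<dots> = (?S * X) * mat_diag r \<alpha> * (Y * ?S'\<^sup>T)"
    by (rule assoc_mult_mat[OF mult_carrier_mat[OF SX mat_diag_carrier] Y S't])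
  finally have eq': "w \<cdot>\<^sub>m ?D = (?S * X) * mat_diag r \<alpha> * (Y * ?S'\<^sup>T)" .
  have tt: "(\<Sum>i<r. order a (\<alpha> i)) = (\<Sum>i<r. order a (\<gamma>s ! i))" unfolding at tot ..
  have "order a (\<alpha> i) = order a (\<gamma>s ! i)"
    by (rule orders_eq_of_diag_factorization[OF SX mult_carrier_mat[OF Y S't] _ _ _ _ eq' w tt i]) (use an ac nz ch in blast)+
  thus "order a (\<gamma>s ! i) = order a (\<alpha> i)" ..
qed

section \<open>Minimal bases with prescribed degrees\<close>

lemma left_inverse_imp_injective_at:
  fixes P :: "'a::field poly mat"
  assumes P: "P \<in> carrier_mat m r" and G: "G \<in> carrier_mat r m" "G * P = 1\<^sub>m r"
  shows "col_injective (map_mat (\<lambda>p. poly p a) P)"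
proof -
  let ?P = "map_mat (\<lambda>p. poly p a) P" and ?G = "map_mat (\<lambda>p. poly p a) G"
  have c: "?P \<in> carrier_mat m r" "?G \<in> carrier_mat r m" using P G by auto
  have "?G * ?P = 1 \<cdot>\<^sub>m 1\<^sub>m r"
  proof (rule mat_eq_by_entries[OF mult_carrier_mat[OF c(2,1)]])
    fix i j assume ij: "i < r" "j < r"
    have "(?G * ?P) $$ (i, j) = (\<Sum>l<m. poly (G $$ (i, l) * P $$ (l, j)) a)"
      unfolding mult_mat_index[OF c(2,1) ij] using carrier_matD[OF P] carrier_matD[OF G(1)] ij by (intro sum.cong) auto
    also have "\<dots> = poly ((G * P) $$ (i, j)) a"
      unfolding mult_mat_index[OF G(1) P ij] by (rule poly_sum[symmetric])
    finally show "(?G * ?P) $$ (i, j) = (1 \<cdot>\<^sub>m 1\<^sub>m r) $$ (i, j)" unfolding G(2) using ij by simp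
  qed simp
  thus ?thesis by (rule left_inverse_imp_injective[OF c]) simp
qed

text \<open>
  The columns are \<open>e\<^sub>j + s\<^bsup>k j\<^esup> e\<^sub>j\<^sub>+\<^sub>1\<close>. They extend to a unimodular triangular matrix, and the second
  entry makes the matrix of leading coefficients injective. Without a further row, that is for
  \<open>r = m\<close>, the degrees vanish and the identity matrix serves.
\<close>

lemma exists_frame:
  fixes k :: "nat \<Rightarrow> nat"
  assumes m: "0 < m" and r: "r \<le> m" and k0: "r = m \<longrightarrow> (\<forall>j<r. k j = 0)"
  shows "\<exists>(P :: 'a::field poly mat) G. P \<in> carrier_mat m r \<and> G \<in> carrier_mat r m \<and> G * P = 1\<^sub>m r \<and>
    (\<forall>i<m. \<forall>j<r. degree (P $$ (i, j)) \<le> k j) \<and> col_injective (lead_mat P k) \<and>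
    (\<forall>j<r. vec_degree (col P j) = k j)"
proof -
  define F :: "nat \<Rightarrow> nat \<Rightarrow> 'a poly" where
    "F = (\<lambda>i j. if i = j then 1 else if i = Suc j \<and> j < r \<and> r < m then monom 1 (k j) else 0)"
  define P where "P = mat m r (\<lambda>(i, j). F i j)"
  have P: "P \<in> carrier_mat m r" by (simp add: P_def)
  have Pi: "P $$ (i, j) = F i j" if "i < m" "j < r" for i j using that by (simp add: P_def)
  let ?F = "mat m m (\<lambda>(i, j). F i j)"
  have Fc: "?F \<in> carrier_mat m m" by simp
  have "unimodular m ?F" by (rule unimodular_of_triangular) (auto simp: F_def)
  then obtain W where W: "W \<in> carrier_mat m m" "?F * W = 1\<^sub>m m" "W * ?F = 1\<^sub>m m" by (rule unimodular_inverse)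
  have G: "top_rows r W \<in> carrier_mat r m" by (rule top_rows_carrier[OF W(1)])
  have GP: "top_rows r W * P = 1\<^sub>m r"
  proof (rule mat_eq_by_entries[OF mult_carrier_mat[OF G P] one_carrier_mat])
    fix i j assume ij: "i < r" "j < r"
    hence ij': "i < m" "j < m" using r by auto
    have "(top_rows r W * P) $$ (i, j) = (\<Sum>l<m. W $$ (i, l) * ?F $$ (l, j))"
      unfolding mult_mat_index[OF G P ij] using W ij ij' Pi by (intro sum.cong) (auto simp: top_rows_def)
    also have "\<dots> = 1\<^sub>m m $$ (i, j)" unfolding W(3)[symmetric] by (rule mult_mat_index[OF W(1) Fc ij', symmetric])
    finally show "(top_rows r W * P) $$ (i, j) = 1\<^sub>m r $$ (i, j)" using ij ij' by simp
  qed
  have dF: "degree (F i j) \<le> k j" for i j by (auto simp: F_def degree_monom_le)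
  have L: "lead_mat P k \<in> carrier_mat m r" by (rule lead_mat_carrier[OF P])
  have Li: "lead_mat P k $$ (i, j) = coeff (F i j) (k j)" if "i < m" "j < r" for i j
    using that P Pi by (simp add: lead_mat_def)
  have inj: "col_injective (lead_mat P k)"
  proof (rule col_injectiveI[OF L])
    fix c :: "'a vec" assume c: "c \<in> carrier_vec r" and z: "lead_mat P k *\<^sub>v c = 0\<^sub>v m"
    have row: "(\<Sum>j<r. coeff (F i j) (k j) * c $ j) = 0" if i: "i < m" for i
    proof -
      have "(\<Sum>j<r. coeff (F i j) (k j) * c $ j) = (\<Sum>j<r. lead_mat P k $$ (i, j) * c $ j)"
        by (intro sum.cong) (auto simp: Li i)
      also have "\<dots> = (lead_mat P k *\<^sub>v c) $ i" by (rule mult_mat_vec_index[OF L c i, symmetric])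
      finally show ?thesis unfolding z using i by simp
    qed
    show "c = 0\<^sub>v r"
    proof (rule ccontr)
      assume "c \<noteq> 0\<^sub>v r"
      then obtain p where p: "p < r" "c $ p \<noteq> 0" "\<And>j. j < r \<Longrightarrow> c $ j \<noteq> 0 \<Longrightarrow> j \<le> p"
        by (rule exists_max_support[OF c, of "\<lambda>j. j"]) (rule that, assumption, assumption, blast)
      define i where "i = (if r < m then Suc p else p)"
      have i: "i < m" using p(1) r by (auto simp: i_def)
      have "coeff (F i j) (k j) * c $ j = (if j = p then c $ p else 0)" if j: "j < r" for j
      proof (cases "j \<le> p")
        case True
        thus ?thesis using p(1) r k0 by (auto simp: F_def i_def)
      next
        case False
        hence "c $ j = 0" using p(3)[OF j] by blast
        thus ?thesis using False by simp
      qed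
      hence "(\<Sum>j<r. coeff (F i j) (k j) * c $ j) = (\<Sum>j<r. if j = p then c $ p else 0)"
        by (intro sum.cong) auto
      also have "\<dots> = c $ p" using p(1) by simp
      finally show False using row[OF i] p(2) by simp
    qed
  qed
  have vd: "vec_degree (col P j) = k j" if j: "j < r" for j
  proof (rule antisym)
    have cj: "col P j \<in> carrier_vec m" using P j by simp
    have ci: "col P j $ i = F i j" if "i < m" for i using that j P Pi by simp
    show "vec_degree (col P j) \<le> k j" by (rule vec_degree_leI[OF cj m]) (simp add: ci dF)
    show "k j \<le> vec_degree (col P j)"
    proof (cases "r < m")
      case True
      hence "Suc j < m" using j by simp
      hence "degree (F (Suc j) j) \<le> vec_degree (col P j)" using degree_le_vec_degree[OF cj, of "Suc j"] ci by simp
      thus ?thesis using True j by (simp add: F_def degree_monom_eq)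
    next
      case False
      thus ?thesis using r k0 j by simp
    qed
  qed
  show ?thesis
    by (rule exI[of _ P], rule exI[of _ "top_rows r W"]) (use P G GP inj vd dF Pi in auto)
qed

section \<open>A square core with prescribed structure\<close>

lemma poly_moebius: "poly (moebius n A B p) x = (\<Sum>i\<le>n. coeff p i * poly A x ^ i * poly B x ^ (n - i))"
  by (simp add: moebius_def poly_sum mult.assoc)

text \<open>For \<open>p\<close> of positive degree a root of \<open>p + 1\<close> is not a root of \<open>p\<close>.\<close>

lemma exists_nonroot:
  fixes p :: "'a::field poly"
  assumes ac: "is_alg_closed TYPE('a)" and p: "p \<noteq> 0"
  shows "\<exists>x. poly p x \<noteq> 0"
proof (cases "degree p = 0")
  case True
  then obtain c where "p = [:c:]" by (rule degree_eq_zeroE)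
  thus ?thesis using p by auto
next
  case False
  hence "degree (p + 1) > 0" using degree_add_eq_left[of 1 p] by simp
  then obtain x where "poly (p + 1) x = 0" using ac unfolding is_alg_closed_def by blast
  hence "poly p x = - 1" by (simp add: eq_neg_iff_add_eq_0)
  thus ?thesis by (intro exI[of _ x]) simp
qed

lemma moebius_chain:
  assumes dv: "p dvd q" and "q \<noteq> 0" and d: "degree p \<le> a" "degree q + a \<le> b + degree p" "a \<le> b"
  shows "moebius a A B p dvd moebius b A B q"
proof -
  obtain s where s: "q = p * s" using dv by blast
  have "degree q = degree p + degree s" using assms(2) unfolding s by (intro degree_mult_eq) auto
  hence "degree s \<le> b - a" using d by linarith
  from moebius_mult[OF d(1) this, of A B] show ?thesis using d(3) unfolding s by simp
qed

text \<open>The coefficient in degree \<open>h\<close> is \<open>p(s)\<close>.\<close>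

lemma degree_moebius_at_nonroot:
  assumes d: "degree p \<le> h" and nz: "poly p s \<noteq> 0"
  shows "degree (moebius h [:1, s:] [:0, 1:] p) = h"
proof (rule antisym)
  let ?q = "moebius h [:1, s:] [:0, 1:] p"
  show "degree ?q \<le> h" by (rule degree_moebius_le) auto
  have e: "moebius 1 1 [:0, 1:] [:1, s:] = [:s, 1:]" "moebius 1 1 [:0, 1:] [:0, 1:] = (1 :: 'a poly)"
    unfolding moebius_linear by (simp_all add: one_pCons)
  have "rev_poly h ?q = moebius h [:s, 1:] 1 p"
    unfolding rev_poly_moebius by (subst moebius_moebius) (simp_all only: e, simp_all)
  hence "coeff ?q h = poly (moebius h [:s, 1:] 1 p) 0" using poly_rev_poly_0[of h ?q] by simp
  also have "\<dots> = (\<Sum>i\<le>h. coeff p i * s ^ i)" by (simp add: poly_moebius)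
  also have "\<dots> = (\<Sum>i\<le>degree p. coeff p i * s ^ i)"
    using d by (intro sum.mono_neutral_right) (auto simp: coeff_eq_0)
  also have "\<dots> = poly p s" by (rule poly_altdef[symmetric])
  finally show "h \<le> degree ?q" using nz by (intro le_degree) simp
qed

lemma det_moebius_triangular:
  fixes M :: "nat \<Rightarrow> nat \<Rightarrow> 'a::field poly"
  assumes "\<And>i j. i < j \<Longrightarrow> j < r \<Longrightarrow> M i j = 0" and "\<And>i. i < r \<Longrightarrow> degree (M i i) \<le> e i i"
    and "\<And>i. i < r \<Longrightarrow> degree (\<phi> i) \<le> h i"
    and "(\<Prod>i<r. M i i) = (\<Prod>i<r. \<phi> i)" and "(\<Sum>i<r. e i i) = (\<Sum>i<r. h i)"
  shows "det (mat r r (\<lambda>(i, j). moebius (e i j) A B (M i j))) = (\<Prod>i<r. moebius (h i) A B (\<phi> i))"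
proof -
  let ?E = "mat r r (\<lambda>(i, j). moebius (e i j) A B (M i j))"
  have "det ?E = prod_list (diag_mat ?E)" by (rule det_lower_triangular[of r]) (auto simp: assms(1))
  also have "\<dots> = (\<Prod>i<r. moebius (e i i) A B (M i i))"
    by (auto simp: diag_mat_def prod.list_conv_set_nth lessThan_atLeast0 intro!: prod.cong)
  also have "\<dots> = moebius (\<Sum>i<r. e i i) A B (\<Prod>i<r. M i i)"
    by (rule moebius_prod[symmetric]) (simp add: assms(2))
  also have "\<dots> = (\<Prod>i<r. moebius (h i) A B (\<phi> i))"
    unfolding assms(4,5) by (rule moebius_prod) (simp add: assms(3))
  finally show ?thesis .
qed

text \<open>
  A projective change of variable \<open>s' = s + 1 / u\<close> moves infinity to \<open>u = 0\<close> and moves \<open>s\<close>, chosen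
  outside the roots of all \<open>\<alpha> i\<close>, to infinity. The finite structure and the structure at infinity
  become the structure of the single chain \<open>\<phi> i = u\<^bsup>h i\<^esup> \<alpha> i (s + 1 / u)\<close> of polynomials of degree exactly
  \<open>h i = deg (\<alpha> i) + f i\<close>. A triangular matrix with this chain is transported back to the original
  variable and to the variable at infinity.
\<close>

lemma exists_core:
  fixes \<alpha> :: "nat \<Rightarrow> 'a::field poly" and f k l :: "nat \<Rightarrow> nat"
  assumes ac: "is_alg_closed TYPE('a)"
    and nz: "\<And>i. i < r \<Longrightarrow> \<alpha> i \<noteq> 0" and ch: "\<And>i j. i \<le> j \<Longrightarrow> j < r \<Longrightarrow> \<alpha> i dvd \<alpha> j"
    and fm: "\<And>i j. i \<le> j \<Longrightarrow> j < r \<Longrightarrow> f i \<le> f j"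
    and km: "\<And>i j. i \<le> j \<Longrightarrow> j < r \<Longrightarrow> k j \<le> k i" and lm: "\<And>i j. i \<le> j \<Longrightarrow> j < r \<Longrightarrow> l i \<le> l j"
    and sub: "\<And>J. J \<subseteq> {..<r} \<Longrightarrow> (\<Sum>i<card J. degree (\<alpha> i) + f i) + (\<Sum>i\<in>J. k i + l i) \<le> card J * d"
    and tot: "(\<Sum>i<r. degree (\<alpha> i) + f i) + (\<Sum>i<r. k i + l i) = r * d"
  shows "\<exists>E s. E \<in> carrier_mat r r \<and>
    (\<forall>a<r. \<forall>b<r. E $$ (a, b) \<noteq> 0 \<longrightarrow> k a + l b \<le> d \<and> degree (E $$ (a, b)) \<le> d - k a - l b) \<and>
    (\<forall>i<r. poly (\<alpha> i) s \<noteq> 0) \<and> det E = (\<Prod>i<r. \<alpha> i) \<and>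
    det (core_rev r d k l E) = (\<Prod>i<r. rev_poly (degree (\<alpha> i) + f i) (\<alpha> i)) \<and>
    (\<exists>N X Y. X \<in> carrier_mat r r \<and> Y \<in> carrier_mat r r \<and>
      [:- s, 1:] ^ N \<cdot>\<^sub>m E = X * mat_diag r \<alpha> * Y) \<and>
    (\<exists>N X Y. X \<in> carrier_mat r r \<and> Y \<in> carrier_mat r r \<and>
      [:1, - s:] ^ N \<cdot>\<^sub>m core_rev r d k l E = X * mat_diag r (\<lambda>i. rev_poly (degree (\<alpha> i) + f i) (\<alpha> i)) * Y)"
proof -
  define h where "h = (\<lambda>i. degree (\<alpha> i) + f i)"
  define c where "c = (\<lambda>i. d - k i - l i)"
  have dh: "degree (\<alpha> i) \<le> h i" for i by (simp add: h_def)
  have kl: "k i + l i \<le> d" if "i < r" for i using sub[of "{i}"] that by simp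
  have "(\<Prod>i<r. \<alpha> i) \<noteq> 0" using nz by simp
  then obtain s where "poly (\<Prod>i<r. \<alpha> i) s \<noteq> 0" using exists_nonroot[OF ac] by blast
  hence s: "poly (\<alpha> i) s \<noteq> 0" if "i < r" for i using that by (simp add: poly_prod)
  define \<phi> where "\<phi> = (\<lambda>i. moebius (h i) [:1, s:] [:0, 1:] (\<alpha> i))"
  have deg\<phi>: "degree (\<phi> i) = h i" if "i < r" for i
    unfolding \<phi>_def by (rule degree_moebius_at_nonroot[OF dh s[OF that]])
  have \<alpha>\<phi>: "moebius (h i) 1 [:- s, 1:] (\<phi> i) = \<alpha> i" for i
  proof -
    have e: "moebius 1 1 [:- s, 1:] [:1, s:] = [:0, 1:]" "moebius 1 1 [:- s, 1:] [:0, 1:] = (1 :: 'a poly)"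
      unfolding moebius_linear by (simp_all add: one_pCons)
    show ?thesis unfolding \<phi>_def by (subst moebius_moebius) (simp_all only: e moebius_identity[OF dh], simp_all)
  qed
  have rev_moebius: "rev_poly e (moebius e 1 [:- s, 1:] p) = moebius e [:0, 1:] [:1, - s:] p" for e p
  proof -
    have e: "moebius 1 1 [:0, 1:] 1 = ([:0, 1:] :: 'a poly)" "moebius 1 1 [:0, 1:] [:- s, 1:] = [:1, - s:]"
      unfolding moebius_linear moebius_1 by (simp_all add: one_pCons)
    show ?thesis unfolding rev_poly_moebius by (subst moebius_moebius) (simp_all only: e, simp_all)
  qed
  have rev\<alpha>: "moebius (h i) [:0, 1:] [:1, - s:] (\<phi> i) = rev_poly (h i) (\<alpha> i)" for i
    using rev_moebius[of "h i" "\<phi> i"] unfolding \<alpha>\<phi> ..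
  have ckl: "c i + (k i + l i) = d" if "i < r" for i using kl[OF that] by (simp add: c_def)
  have cJ: "(\<Sum>i\<in>J. c i) + (\<Sum>i\<in>J. k i + l i) = card J * d" if "J \<subseteq> {..<r}" for J
  proof -
    have "(\<Sum>i\<in>J. c i) + (\<Sum>i\<in>J. k i + l i) = (\<Sum>i\<in>J. d)"
      unfolding sum.distrib[symmetric] using that ckl by (intro sum.cong) auto
    thus ?thesis by simp
  qed
  have hJ: "(\<Sum>i<j. degree (\<phi> i)) = (\<Sum>i<j. h i)" if "j \<le> r" for j using that deg\<phi> by (intro sum.cong) auto
  have toth: "(\<Sum>i<r. h i) = (\<Sum>i<r. c i)" using tot cJ[of "{..<r}"] unfolding h_def by simp
  have "\<exists>M U V. (\<forall>i<r. \<forall>j<r. M i j = (\<Sum>l<r. U i l * \<phi> l * V l j)) \<and>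
    (\<forall>i j. i < j \<longrightarrow> j < r \<longrightarrow> M i j = 0) \<and> (\<Prod>i<r. M i i) = (\<Prod>i<r. \<phi> i) \<and>
    (\<forall>i<r. \<forall>j\<le>i. degree (M i j) \<le> max (c i) (c j)) \<and>
    (\<forall>i<r. \<forall>j<r. degree (V i j) \<le> c j - degree (\<phi> i))"
  proof (rule triangular_realization[OF ac])
    fix i assume i: "i < r"
    show "\<phi> i \<noteq> 0" using \<alpha>\<phi>[of i] nz[OF i] by auto
  next
    fix i j assume ij: "i \<le> j" "j < r"
    show "\<phi> i dvd \<phi> j"
      unfolding \<phi>_def
      using fm[OF ij] dvd_imp_degree_le[OF ch[OF ij] nz[OF ij(2)]]
      by (intro moebius_chain[OF ch[OF ij] nz[OF ij(2)] dh]) (auto simp: h_def)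
  next
    fix J assume J: "J \<subseteq> {..<r}"
    have cj: "card J \<le> r" using card_mono[OF _ J] by simp
    show "(\<Sum>i<card J. degree (\<phi> i)) \<le> (\<Sum>i\<in>J. c i)"
      unfolding hJ[OF cj] using sub[OF J] cJ[OF J] unfolding h_def by linarith
  next
    show "(\<Sum>i<r. degree (\<phi> i)) = (\<Sum>i<r. c i)" using hJ[of r] toth by simp
  qed
  then obtain M U V where M: "\<forall>i<r. \<forall>j<r. M i j = (\<Sum>l<r. U i l * \<phi> l * V l j)"
    "\<forall>i j. i < j \<longrightarrow> j < r \<longrightarrow> M i j = 0" "(\<Prod>i<r. M i i) = (\<Prod>i<r. \<phi> i)"
    "\<forall>i<r. \<forall>j\<le>i. degree (M i j) \<le> max (c i) (c j)"
    by (elim exE conjE) (rule that)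
  have bd: "k i + l j \<le> d \<and> degree (M i j) \<le> d - k i - l j" if ij: "i < r" "j < r" "M i j \<noteq> 0" for i j
  proof -
    have le: "j \<le> i" using M(2) ij by (meson not_le)
    have b: "k i \<le> k j" "l j \<le> l i" using km[OF le ij(1)] lm[OF le ij(1)] by auto
    have "degree (M i j) \<le> max (c i) (c j)" using M(4) ij(1) le by blast
    moreover have "c i \<le> d - k i - l j" "c j \<le> d - k i - l j" using b by (auto simp: c_def)
    ultimately show ?thesis using b kl[OF ij(1)] by auto
  qed
  have Msum: "M i j = (\<Sum>l<r. U i l * \<phi> l * V l j)" if "i < r" "j < r" for i j using M(1) that by blast
  have hb: "degree (\<phi> i) \<le> h i" if "i < r" for i using deg\<phi>[OF that] by simp
  have tr: "\<exists>N X Y. X \<in> carrier_mat r r \<and> Y \<in> carrier_mat r r \<and>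
    B ^ N \<cdot>\<^sub>m mat r r (\<lambda>(i, j). moebius (d - k i - l j) A B (M i j))
      = X * mat_diag r (\<lambda>i. moebius (h i) A B (\<phi> i)) * Y" for A B
    by (rule moebius_transfer[where U = U and V = V]) (rule Msum bd hb, assumption+)+
  have Mii: "degree (M i i) \<le> c i" if "i < r" for i using M(4)[rule_format, OF that, of i] by simp
  have dt: "det (mat r r (\<lambda>(i, j). moebius (d - k i - l j) A B (M i j))) = (\<Prod>i<r. moebius (h i) A B (\<phi> i))" for A B
  proof (rule det_moebius_triangular)
    show "M i j = 0" if "i < j" "j < r" for i j using M(2) that by blast
    show "degree (M i i) \<le> d - k i - l i" if "i < r" for i using Mii[OF that] unfolding c_def .
    show "(\<Sum>i<r. d - k i - l i) = (\<Sum>i<r. h i)" using toth unfolding c_def by simp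
  qed (rule hb M(3), assumption?)+
  define E where "E = mat r r (\<lambda>(i, j). moebius (d - k i - l j) 1 [:- s, 1:] (M i j))"
  have E: "E \<in> carrier_mat r r" by (simp add: E_def)
  have Er: "core_rev r d k l E = mat r r (\<lambda>(i, j). moebius (d - k i - l j) [:0, 1:] [:1, - s:] (M i j))"
    by (rule eq_matI) (auto simp: core_rev_def E_def rev_moebius)
  have Eb: "k a + l b \<le> d \<and> degree (E $$ (a, b)) \<le> d - k a - l b" if "a < r" "b < r" "E $$ (a, b) \<noteq> 0" for a b
  proof -
    have e: "E $$ (a, b) = moebius (d - k a - l b) 1 [:- s, 1:] (M a b)" using that by (simp add: E_def)
    hence "M a b \<noteq> 0" using that(3) by auto
    moreover have "degree (E $$ (a, b)) \<le> d - k a - l b" unfolding e by (rule degree_moebius_le) auto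
    ultimately show ?thesis using bd[OF that(1,2)] by simp
  qed
  have d1: "det E = (\<Prod>i<r. \<alpha> i)" unfolding E_def dt \<alpha>\<phi> ..
  have d2: "det (core_rev r d k l E) = (\<Prod>i<r. rev_poly (h i) (\<alpha> i))" unfolding Er dt rev\<alpha> ..
  have t1: "\<exists>N X Y. X \<in> carrier_mat r r \<and> Y \<in> carrier_mat r r \<and> [:- s, 1:] ^ N \<cdot>\<^sub>m E = X * mat_diag r \<alpha> * Y"
    using tr[of "[:- s, 1:]" 1] unfolding \<alpha>\<phi> E_def .
  have t2: "\<exists>N X Y. X \<in> carrier_mat r r \<and> Y \<in> carrier_mat r r \<and>
      [:1, - s:] ^ N \<cdot>\<^sub>m core_rev r d k l E = X * mat_diag r (\<lambda>i. rev_poly (h i) (\<alpha> i)) * Y"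
    using tr[of "[:1, - s:]" "[:0, 1:]"] unfolding rev\<alpha> Er .
  show ?thesis
    by (rule exI[of _ E], rule exI[of _ s], intro conjI)
      (use E Eb s in blast, use Eb in blast, use s in blast, rule d1, rule d2[unfolded h_def], rule t1, rule t2[unfolded h_def])
qed

section \<open>Assembling a matrix with prescribed data\<close>

lemma monic_dvd_antisym:
  fixes p q :: "'a::field poly"
  assumes "p dvd q" "q dvd p" "lead_coeff p = lead_coeff q"
  shows "p = q"
proof (cases "p = 0")
  case False
  from assms(1) obtain c where c: "q = p * c" by blast
  have q0: "q \<noteq> 0" using False assms(2) by auto
  have "degree q = degree p"
    using dvd_imp_degree_le[OF assms(1) q0] dvd_imp_degree_le[OF assms(2) False] by simp
  hence "degree c = 0" using c False q0 degree_mult_eq[of p c] by auto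
  then obtain x where x: "c = [:x:]" by (rule degree_eq_zeroE)
  have "lead_coeff q = lead_coeff p * lead_coeff c" unfolding c by (rule lead_coeff_mult)
  hence "lead_coeff p * x = lead_coeff p * 1" unfolding x assms(3) by simp
  moreover have "lead_coeff p \<noteq> 0" using False by simp
  ultimately have "x = 1" using mult_left_cancel by blast
  thus ?thesis using c x by simp
qed (use assms in simp)

text \<open>
  The core is multiplied by two explicit minimal bases. Their reversals and values are
  injective at every relevant point, so invariant factors and multiplicities are those of the
  core; these are recognized by their orders at each point of the algebraically closed field. That
  the degree \<open>d\<close> is attained follows from \<open>f\<^sub>1 = 0\<close>.
\<close>

lemma sufficient_conditions:
  fixes \<alpha>s :: "'a::field poly list" and fs ks ls :: "nat list"
  assumes ac: "is_alg_closed TYPE('a)" and pos: "0 < m" "0 < n" "0 < r" and r: "r \<le> m" "r \<le> n"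
    and len: "length \<alpha>s = r" "length fs = r" "length ks = r" "length ls = r"
    and monic: "\<forall>\<alpha>\<in>set \<alpha>s. lead_coeff \<alpha> = 1" and chain: "sorted_wrt (dvd) \<alpha>s"
    and sf: "sorted fs" and sk: "sorted_wrt (\<ge>) ks" and sl: "sorted_wrt (\<ge>) ls"
    and f0: "fs ! 0 = 0"
    and sub: "\<And>J. J \<subseteq> {..<r} \<Longrightarrow>
      (\<Sum>i<card J. degree (\<alpha>s ! i) + fs ! i) + (\<Sum>i\<in>J. ks ! i + rev ls ! i) \<le> card J * d"
    and tot: "(\<Sum>i<r. degree (\<alpha>s ! i) + fs ! i) + (\<Sum>i<r. ks ! i + rev ls ! i) = r * d"
    and l0: "r = n \<longrightarrow> (\<forall>l\<in>set ls. l = 0)" and k0: "r = m \<longrightarrow> (\<forall>k\<in>set ks. k = 0)"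
  shows "\<exists>A\<in>carrier_mat m n. has_data r d \<alpha>s fs ks ls A"
proof -
  define k where "k = (\<lambda>i. ks ! i)"
  define l where "l = (\<lambda>i. rev ls ! i)"
  define h where "h = (\<lambda>i. degree (\<alpha>s ! i) + fs ! i)"
  have monic': "lead_coeff (\<alpha>s ! i) = 1" if "i < r" for i using monic len that by auto
  have nz: "\<alpha>s ! i \<noteq> 0" if "i < r" for i using monic'[OF that] by auto
  have ch: "\<alpha>s ! i dvd \<alpha>s ! j" if "i \<le> j" "j < r" for i j
    using sorted_wrt_nth_less[OF chain, of i j] that len by (cases "i = j") auto
  have fm: "fs ! i \<le> fs ! j" if "i \<le> j" "j < r" for i j using sorted_nth_mono[OF sf that(1)] that len by simp
  have sk': "sorted (rev ks)" and sl': "sorted (rev ls)" using sk sl by (simp_all add: sorted_wrt_rev)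
  have km: "k j \<le> k i" if "i \<le> j" "j < r" for i j
    using sorted_wrt_nth_less[OF sk, of i j] that len unfolding k_def by (cases "i = j") auto
  have lm: "l i \<le> l j" if "i \<le> j" "j < r" for i j
    unfolding l_def using sorted_nth_mono[OF sl' that(1)] that len by simp
  have dh: "degree (\<alpha>s ! i) \<le> h i" for i by (simp add: h_def)
  have k0': "r = m \<longrightarrow> (\<forall>j<r. k j = 0)" using k0 len unfolding k_def by auto
  have l0': "r = n \<longrightarrow> (\<forall>j<r. l j = 0)"
  proof (intro impI allI)
    fix j assume "r = n" "j < r"
    moreover have "rev ls ! j \<in> set (rev ls)" using \<open>j < r\<close> len by (intro nth_mem) simp
    ultimately show "l j = 0" using l0 unfolding l_def by simp
  qed
  obtain P G :: "'a poly mat" where P: "P \<in> carrier_mat m r" and G: "G \<in> carrier_mat r m" "G * P = 1\<^sub>m r"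
    and Pd': "\<forall>i<m. \<forall>j<r. degree (P $$ (i, j)) \<le> k j" and leadP: "col_injective (lead_mat P k)"
    and vP: "\<forall>j<r. vec_degree (col P j) = k j"
    using exists_frame[where 'a = 'a, OF pos(1) r(1) k0'] by (elim exE conjE) (rule that)
  obtain Q H :: "'a poly mat" where Q: "Q \<in> carrier_mat n r" and H: "H \<in> carrier_mat r n" "H * Q = 1\<^sub>m r"
    and Qd': "\<forall>i<n. \<forall>j<r. degree (Q $$ (i, j)) \<le> l j" and leadQ: "col_injective (lead_mat Q l)"
    and vQ: "\<forall>j<r. vec_degree (col Q j) = l j"
    using exists_frame[where 'a = 'a, OF pos(2) r(2) l0'] by (elim exE conjE) (rule that)
  have Pd: "degree (P $$ (i, j)) \<le> k j" if "i < m" "j < r" for i j using Pd' that by blast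
  have Qd: "degree (Q $$ (i, j)) \<le> l j" if "i < n" "j < r" for i j using Qd' that by blast
  have subk: "(\<Sum>i<card J. degree (\<alpha>s ! i) + fs ! i) + (\<Sum>i\<in>J. k i + l i) \<le> card J * d" if "J \<subseteq> {..<r}" for J
    unfolding k_def l_def by (rule sub[OF that])
  have totk: "(\<Sum>i<r. degree (\<alpha>s ! i) + fs ! i) + (\<Sum>i<r. k i + l i) = r * d"
    unfolding k_def l_def by (rule tot)
  define Fin where "Fin = (\<lambda>E s. \<exists>N X Y. X \<in> carrier_mat r r \<and> Y \<in> carrier_mat r r \<and>
      [:- s, 1:] ^ N \<cdot>\<^sub>m E = X * mat_diag r (\<lambda>i. \<alpha>s ! i) * Y)"
  define Inf' where "Inf' = (\<lambda>E s. \<exists>N X Y. X \<in> carrier_mat r r \<and> Y \<in> carrier_mat r r \<and>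
      [:1, - s:] ^ N \<cdot>\<^sub>m core_rev r d k l E = X * mat_diag r (\<lambda>i. rev_poly (h i) (\<alpha>s ! i)) * Y)"
  have "\<exists>E s. E \<in> carrier_mat r r \<and>
    (\<forall>a<r. \<forall>b<r. E $$ (a, b) \<noteq> 0 \<longrightarrow> k a + l b \<le> d \<and> degree (E $$ (a, b)) \<le> d - k a - l b) \<and>
    (\<forall>i<r. poly (\<alpha>s ! i) s \<noteq> 0) \<and> det E = (\<Prod>i<r. \<alpha>s ! i) \<and>
    det (core_rev r d k l E) = (\<Prod>i<r. rev_poly (h i) (\<alpha>s ! i)) \<and>
    Fin E s \<and>
    Inf' E s"
    unfolding Fin_def Inf'_def h_def
    by (rule exists_core[OF ac, where \<alpha> = "\<lambda>i. \<alpha>s ! i" and f = "\<lambda>i. fs ! i"]) (rule totk | (rule nz ch fm km lm subk, assumption+))+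
  then obtain E s where E: "E \<in> carrier_mat r r"
    and Eb': "\<forall>a<r. \<forall>b<r. E $$ (a, b) \<noteq> 0 \<longrightarrow> k a + l b \<le> d \<and> degree (E $$ (a, b)) \<le> d - k a - l b"
    and s: "\<forall>i<r. poly (\<alpha>s ! i) s \<noteq> 0" and dE: "det E = (\<Prod>i<r. \<alpha>s ! i)"
    and dEr: "det (core_rev r d k l E) = (\<Prod>i<r. rev_poly (h i) (\<alpha>s ! i))"
    and fin': "Fin E s" and infty': "Inf' E s"
    by (elim exE conjE) (rule that)
  note fin = fin'[unfolded Fin_def] and infty = infty'[unfolded Inf'_def]
  have Eb: "k a + l b \<le> d \<and> degree (E $$ (a, b)) \<le> d - k a - l b" if "a < r" "b < r" "E $$ (a, b) \<noteq> 0" for a b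
    using Eb' that by blast
  have Qt: "Q\<^sup>T \<in> carrier_mat r n" and Pt: "P\<^sup>T \<in> carrier_mat r m" and Et: "E\<^sup>T \<in> carrier_mat r r" using P Q E by auto
  have detE: "det E \<noteq> 0" unfolding dE using nz by simp
  have atP: "col_injective (map_mat (\<lambda>p. poly p a) P)" for a by (rule left_inverse_imp_injective_at[OF P G])
  have atQ: "col_injective (map_mat (\<lambda>p. poly p a) Q)" for a by (rule left_inverse_imp_injective_at[OF Q H])
  have injP: "col_injective P" by (rule injective_of_injective_at[OF P r(1) atP])
  have injQ: "col_injective Q" by (rule injective_of_injective_at[OF Q r(2) atQ])
  define A where "A = P * E * Q\<^sup>T"
  have A: "A \<in> carrier_mat m n" unfolding A_def by (rule mult_carrier_mat[OF mult_carrier_mat[OF P E] Qt])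
  have At: "A\<^sup>T \<in> carrier_mat n m" using A by simp
  have AtQ: "A\<^sup>T = Q * E\<^sup>T * P\<^sup>T"
    unfolding A_def transpose_mult[OF mult_carrier_mat[OF P E] Qt] transpose_mult[OF P E]
    by (simp add: assoc_mult_mat[OF Q Et Pt])
  have cb: "column_basis A P" unfolding A_def by (rule column_basis_of_factorization[OF P E Q detE injP injQ r(2)])
  have detEt: "det E\<^sup>T \<noteq> 0" using det_transpose[OF E] detE by simp
  have cbt: "column_basis A\<^sup>T Q" unfolding AtQ by (rule column_basis_of_factorization[OF Q Et P detEt injQ injP r(1)])
  have rk: "pm_rank A = r" using column_basis_cols(2)[OF A cb] P by simp
  have col: "col_span_minimal_indices A ks"
  proof (rule indices_of_minimal_columns[OF A _ _ sk'])
    show "minimal_columns A P" by (rule minimal_columns_criterion[OF A pos(1) P cb G leadP]) (rule Pd)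
    have "map (\<lambda>j. vec_degree (col P j)) [0..<dim_col P] = ks"
      using P vP len by (intro nth_equalityI) (auto simp: k_def)
    thus "mset ks = mset (map (\<lambda>j. vec_degree (col P j)) [0..<dim_col P])" by simp
  qed
  have row: "row_span_minimal_indices A ls"
    unfolding row_span_minimal_indices_def
  proof (rule indices_of_minimal_columns[OF At _ _ sl'])
    show "minimal_columns A\<^sup>T Q" by (rule minimal_columns_criterion[OF At pos(2) Q cbt H leadQ]) (rule Qd)
    have "map (\<lambda>j. vec_degree (col Q j)) [0..<dim_col Q] = rev ls"
      using Q vQ len by (intro nth_equalityI) (auto simp: l_def)
    thus "mset ls = mset (map (\<lambda>j. vec_degree (col Q j)) [0..<dim_col Q])" by simp
  qed
  have inv: "invariant_factors A \<alpha>s"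
  proof -
    obtain \<gamma>s where g: "invariant_factors A \<gamma>s" using invariant_factors_exist[OF A] by blast
    obtain U V where "unimodular m U" "unimodular n V" "U * A * V = diag_rect_mat m n \<gamma>s"
      and lg: "length \<gamma>s = r"
      and gnz: "\<forall>i<r. \<gamma>s ! i \<noteq> 0" and gch: "\<forall>i k. i \<le> k \<longrightarrow> k < r \<longrightarrow> \<gamma>s ! i dvd \<gamma>s ! k"
      by (rule invariant_factorsE[OF A g rk])
    have os: "(\<Sum>i<r. order a (\<alpha>s ! i)) = order a (det E)" for a
      unfolding dE by (rule order_prod[symmetric]) (auto simp: nz)
    note of = orders_of_factorization[OF P E Q r detE atP atQ g[unfolded A_def]]
    have oe: "order a (\<gamma>s ! i) = order a (\<alpha>s ! i)" if i: "i < r" for a i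
    proof (cases "a = s")
      case True
      \<comment> \<open>The factorization of the core says nothing here, but the determinant does not vanish at \<open>s\<close>.\<close>
      have z: "order s (\<alpha>s ! j) = 0" if "j < r" for j using s that by (intro order_0I) blast
      hence "(\<Sum>j<r. order s (\<alpha>s ! j)) = 0" by simp
      hence "(\<Sum>j<r. order s (\<gamma>s ! j)) = 0" using of(1)[of s] os[of s] by simp
      hence "order s (\<gamma>s ! i) = 0" using i by simp
      thus ?thesis using z[OF i] True by simp
    next
      case False
      from fin obtain N X Y where X: "X \<in> carrier_mat r r" "Y \<in> carrier_mat r r"
        "[:- s, 1:] ^ N \<cdot>\<^sub>m E = X * mat_diag r (\<lambda>i. \<alpha>s ! i) * Y" by blast
      have w: "[:- s, 1:] ^ N \<noteq> 0" by simp
      have w0: "order a ([:- s, 1:] ^ N) = 0"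
        using False order_power_eq[of "[:- s, 1:]" a N] order_0I[of "[:- s, 1:]" a] by simp
      show ?thesis
        by (rule of(2)[OF X w w0 _ _ os i]) (use nz ch in blast)+
    qed
    have "\<gamma>s = \<alpha>s"
    proof (rule nth_equalityI)
      fix i assume "i < length \<gamma>s"
      hence i: "i < r" using lg by simp
      have gi: "\<gamma>s ! i \<noteq> 0" using gnz i by blast
      have "\<gamma>s ! i dvd \<alpha>s ! i" by (rule dvd_of_order_le[OF ac gi nz[OF i]]) (simp add: oe[OF i])
      moreover have "\<alpha>s ! i dvd \<gamma>s ! i" by (rule dvd_of_order_le[OF ac nz[OF i] gi]) (simp add: oe[OF i])
      moreover have "lead_coeff (\<gamma>s ! i) = lead_coeff (\<alpha>s ! i)"
        using g lg i monic'[OF i] unfolding invariant_factors_def by simp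
      ultimately show "\<gamma>s ! i = \<alpha>s ! i" by (intro monic_dvd_antisym)
    qed (simp add: lg len)
    thus ?thesis using g by simp
  qed
  \<comment> \<open>The reversal of \<open>A\<close> in formal degree \<open>d\<close> is studied before \<open>d\<close> is known to be the degree.\<close>
  let ?E = "core_rev r d k l E" and ?P = "rev_cols k P" and ?Q = "rev_cols l Q"
  define R where "R = ?P * ?E * ?Q\<^sup>T"
  have Er: "?E \<in> carrier_mat r r" by (simp add: core_rev_def)
  have Pr: "?P \<in> carrier_mat m r" and Qr: "?Q \<in> carrier_mat n r" using P Q by (auto intro: rev_cols_carrier)
  have Qrt: "?Q\<^sup>T \<in> carrier_mat r n" using Qr by simp
  have R: "R \<in> carrier_mat m n" unfolding R_def by (rule mult_carrier_mat[OF mult_carrier_mat[OF Pr Er] Qrt])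
  have Ad: "degree (A $$ (i, j)) \<le> d" if "i < m" "j < n" for i j
    unfolding A_def by (rule reversed_factorization(1)[OF P E Q _ _ _ that]) (rule Pd Qd Eb, assumption+)+
  have RA: "rev_poly d (A $$ (i, j)) = R $$ (i, j)" if "i < m" "j < n" for i j
    unfolding A_def R_def by (rule reversed_factorization(2)[OF P E Q _ _ _ that]) (rule Pd Qd Eb, assumption+)+
  have rnz: "rev_poly (h i) (\<alpha>s ! i) \<noteq> 0" if "i < r" for i using rev_poly_eq_0_iff[OF dh] nz[OF that] by blast
  have detEr: "det ?E \<noteq> 0" unfolding dEr using rnz by simp
  have atPr: "col_injective (map_mat (\<lambda>p. poly p 0) ?P)" unfolding rev_cols_at_0 by (rule leadP)
  have atQr: "col_injective (map_mat (\<lambda>p. poly p 0) ?Q)" unfolding rev_cols_at_0 by (rule leadQ)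
  have "column_basis R ?P"
    unfolding R_def by (rule column_basis_of_factorization[OF Pr Er Qr detEr injective_of_injective_at[OF Pr r(1) atPr]
      injective_of_injective_at[OF Qr r(2) atQr] r(2)])
  hence rkR: "pm_rank R = r" using column_basis_cols(2)[OF R] Pr by simp
  obtain \<beta>s where b: "invariant_factors R \<beta>s" using invariant_factors_exist[OF R] by blast
  obtain U V where UV: "unimodular m U" "unimodular n V" "U * R * V = diag_rect_mat m n \<beta>s"
    and lb: "length \<beta>s = r"
    and bnz: "\<forall>i<r. \<beta>s ! i \<noteq> 0" and bch: "\<forall>i k. i \<le> k \<longrightarrow> k < r \<longrightarrow> \<beta>s ! i dvd \<beta>s ! k"
    by (rule invariant_factorsE[OF R b rkR])
  have ob: "order 0 (\<beta>s ! i) = fs ! i" if i: "i < r" for i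
  proof -
    from infty obtain N X Y where X: "X \<in> carrier_mat r r" "Y \<in> carrier_mat r r"
      "[:1, - s:] ^ N \<cdot>\<^sub>m ?E = X * mat_diag r (\<lambda>i. rev_poly (h i) (\<alpha>s ! i)) * Y" by blast
    have w: "[:1, - s:] ^ N \<noteq> 0" by simp
    have w0: "order 0 ([:1, - s:] ^ N) = 0"
      using order_power_eq[of "[:1, - s:]" 0 N] order_0I[of "[:1, - s:]" 0] by simp
    have os: "(\<Sum>i<r. order 0 (rev_poly (h i) (\<alpha>s ! i))) = order 0 (det ?E)"
      unfolding dEr by (rule order_prod[symmetric]) (auto simp: rnz)
    have rch: "rev_poly (h i) (\<alpha>s ! i) dvd rev_poly (h j) (\<alpha>s ! j)" if ij: "i \<le> j" "j < r" for i j
      unfolding rev_poly_moebius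
      using fm[OF ij] dvd_imp_degree_le[OF ch[OF ij] nz[OF ij(2)]]
      by (intro moebius_chain[OF ch[OF ij] nz[OF ij(2)] dh]) (auto simp: h_def)
    have "order 0 (\<beta>s ! i) = order 0 (rev_poly (h i) (\<alpha>s ! i))"
      by (rule orders_of_factorization(2)[OF Pr Er Qr r detEr atPr atQr b[unfolded R_def] X w w0 _ _ os i])
        (use rnz rch in blast)+
    also have "\<dots> = fs ! i" using order_0_rev_poly[OF nz[OF i] dh] by (simp add: h_def)
    finally show ?thesis .
  qed
  have dA: "mat_degree A = d"
  proof (rule antisym)
    show "mat_degree A \<le> d"
    proof -
      obtain i j where "i < m" "j < n" "degree (A $$ (i, j)) = mat_degree A" by (rule mat_degree_attained[OF A pos(1,2)])
      thus ?thesis using Ad[of i j] by simp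
    qed
    show "d \<le> mat_degree A"
    proof (rule ccontr)
      assume "\<not> d \<le> mat_degree A"
      hence small: "degree (A $$ (i, j)) < d" if "i < m" "j < n" for i j
        using degree_le_mat_degree[OF A that] by simp
      let ?t = "[:0, 1:] :: 'a poly"
      have tR: "?t dvd R $$ (i, j)" if ij: "i < m" "j < n" for i j
      proof -
        have "poly (R $$ (i, j)) 0 = coeff (A $$ (i, j)) d" unfolding RA[OF ij, symmetric] by (rule poly_rev_poly_0)
        also have "\<dots> = 0" by (rule coeff_eq_0[OF small[OF ij]])
        finally show ?thesis using poly_eq_0_iff_dvd[of "R $$ (i, j)" 0] by simp
      qed
      have c: "U \<in> carrier_mat m m" "V \<in> carrier_mat n n" using UV by (auto simp: unimodular_def)
      have "?t dvd (U * R * V) $$ (0, 0)"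
      proof (rule dvd_entries_mult[OF mult_carrier_mat[OF c(1) R] c(2) disjI1 pos(1,2)], intro allI impI)
        fix a b assume ab: "a < m" "b < n"
        show "?t dvd (U * R) $$ (a, b)"
          by (rule dvd_entries_mult[OF c(1) R disjI2 ab]) (use tR in blast)
      qed
      hence "?t dvd \<beta>s ! 0" unfolding UV(3) using pos lb by (simp add: diag_rect_mat_def)
      hence "poly (\<beta>s ! 0) 0 = 0" using poly_eq_0_iff_dvd[of "\<beta>s ! 0" 0] by simp
      hence "order 0 (\<beta>s ! 0) \<noteq> 0" using bnz pos by (simp add: order_root)
      thus False using ob[OF pos(3)] f0 by simp
    qed
  qed
  have rA: "rev_mat A = R"
  proof (rule mat_eq_by_entries[OF rev_mat_carrier[OF A] R])
    fix i j assume ij: "i < m" "j < n"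
    have "rev_mat A $$ (i, j) = rev_poly d (A $$ (i, j))" using A ij by (simp add: rev_mat_def dA)
    thus "rev_mat A $$ (i, j) = R $$ (i, j)" unfolding RA[OF ij] .
  qed
  have "fs = map (order 0) \<beta>s" by (rule nth_equalityI) (simp_all add: len lb ob)
  hence "partial_multiplicities_inf A fs" unfolding partial_multiplicities_inf_def rA using b by blast
  hence "has_data r d \<alpha>s fs ks ls A" unfolding has_data_def using rk dA inv col row by blast
  thus ?thesis using A by blast
qed

section \<open>Minimal indices of full spaces\<close>

text \<open>The unit vectors form a basis of order zero.\<close>

lemma indices_zero_of_full_rank:
  fixes A :: "'a::field poly mat"
  assumes A: "A \<in> carrier_mat m n" and m: "0 < m" and ks: "col_span_minimal_indices A ks"
    and len: "length ks = m" and sk: "sorted_wrt (\<ge>) ks" and x: "x \<in> set ks"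
  shows "x = 0"
proof -
  have sk': "sorted ks \<or> sorted (rev ks)" using sk by (simp add: sorted_wrt_rev)
  obtain P where "P \<in> carrier_mat m (length ks)" and M: "minimal_columns A P"
    and v: "\<And>j. j < length ks \<Longrightarrow> vec_degree (col P j) = ks ! j"
    by (rule minimal_columns_of_indices[OF A ks refl sk']) (rule that, assumption, assumption, blast)
  hence P: "P \<in> carrier_mat m m" using len by simp
  obtain G where G: "G \<in> carrier_mat m m" "G * P = 1\<^sub>m m" by (rule minimal_columns_left_inverse[OF A P M order_refl])
  have PG: "P * G = 1\<^sub>m m" by (rule right_inverse_imp_left_inverse[OF G(1) P G(2)])
  have one: "1\<^sub>m m \<in> carrier_mat m m" by simp
  have sub: "rational_span B \<subseteq> carrier_vec m" if "B \<in> carrier_mat m p" for B :: "'a poly mat" and p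
    using that by (auto simp: rational_span_def)
  have full: "carrier_vec m \<subseteq> rational_span P"
  proof
    fix u :: "'a poly vec" assume u: "u \<in> carrier_vec m"
    have gu: "G *\<^sub>v u \<in> carrier_vec m" using G u by simp
    have "P *\<^sub>v (G *\<^sub>v u) = u" unfolding assoc_mult_mat_vec[OF P G(1) u, symmetric] PG using u by simp
    thus "u \<in> rational_span P" using mult_in_rational_span[OF P gu] by simp
  qed
  have full1: "carrier_vec m \<subseteq> rational_span (1\<^sub>m m :: 'a poly mat)"
  proof
    fix u :: "'a poly vec" assume u: "u \<in> carrier_vec m"
    show "u \<in> rational_span (1\<^sub>m m :: 'a poly mat)" using mult_in_rational_span[OF one u] u by simp
  qed
  have "rational_span P = rational_span A" using M by (simp add: minimal_columns_def column_basis_def)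
  hence "rational_span (1\<^sub>m m) = rational_span A" using full full1 sub[OF P] sub[OF one] by blast
  moreover have "col_injective (1\<^sub>m m :: 'a poly mat)" by (rule left_inverse_imp_injective[OF one one, of 1]) auto
  ultimately have "column_basis A (1\<^sub>m m)" using A by (simp add: column_basis_def)
  hence "(\<Sum>j<m. vec_degree (col P j)) \<le> (\<Sum>j<m. vec_degree (col (1\<^sub>m m :: 'a poly mat) j))"
    using M P unfolding minimal_columns_def by fastforce
  moreover have "vec_degree (col (1\<^sub>m m :: 'a poly mat) j) = 0" if j: "j < m" for j
  proof -
    have "col (1\<^sub>m m :: 'a poly mat) j \<in> carrier_vec m" by (rule carrier_vecI) simp
    hence "vec_degree (col (1\<^sub>m m :: 'a poly mat) j) \<le> 0" by (rule vec_degree_leI[OF _ m]) (use j in auto)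
    thus ?thesis by simp
  qed
  ultimately have "(\<Sum>j<m. vec_degree (col P j)) = 0" by simp
  hence "vec_degree (col P j) = 0" if "j < m" for j using that by simp
  hence "ks ! j = 0" if "j < m" for j using v[of j] that len by simp
  moreover obtain j where "j < length ks" "ks ! j = x" using x by (auto simp: in_set_conv_nth)
  ultimately show ?thesis using len by simp
qed

section \<open>Majorization by partial sums\<close>

text \<open>An initial sum of a reversed list is the total minus an initial sum of the list.\<close>

lemma majorized_rev_iff:
  assumes "length xs = length ys"
  shows "rev xs \<prec>\<^sub>m rev ys \<longleftrightarrow>
    sum_list xs = sum_list ys \<and> (\<forall>j\<le>length xs. sum_list (take j ys) \<le> sum_list (take j xs))"
proof -
  let ?n = "length xs"
  have t: "sum_list (take k (rev zs)) = sum_list zs - sum_list (take (length zs - k) zs)" for k and zs :: "int list"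
  proof -
    have "sum_list (take k (rev zs)) = sum_list (drop (length zs - k) zs)" by (simp add: take_rev)
    moreover have "sum_list zs = sum_list (take (length zs - k) zs) + sum_list (drop (length zs - k) zs)"
      using sum_list_append[of "take (length zs - k) zs" "drop (length zs - k) zs"] unfolding append_take_drop_id .
    ultimately show ?thesis by simp
  qed
  show ?thesis
  proof (cases "sum_list xs = sum_list ys")
    case True
    have "(\<forall>k. 1 \<le> k \<and> k \<le> ?n - 1 \<longrightarrow> sum_list (take k (rev xs)) \<le> sum_list (take k (rev ys))) \<longleftrightarrow>
      (\<forall>j\<le>?n. sum_list (take j ys) \<le> sum_list (take j xs))" (is "?L \<longleftrightarrow> ?R")
    proof
      assume L: ?L
      show ?R
      proof (intro allI impI)
        fix j assume j: "j \<le> ?n"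
        consider "j = 0" | "j = ?n" | "1 \<le> j" "j \<le> ?n - 1" using j by linarith
        thus "sum_list (take j ys) \<le> sum_list (take j xs)"
        proof cases
          case 3
          hence "1 \<le> ?n - j \<and> ?n - j \<le> ?n - 1" using j by linarith
          hence "sum_list (take (?n - j) (rev xs)) \<le> sum_list (take (?n - j) (rev ys))" using L by blast
          thus ?thesis unfolding t using True assms j by simp
        qed (use True assms in simp_all)
      qed
    next
      assume R: ?R
      show ?L
      proof (intro allI impI)
        fix k
        have "sum_list (take (?n - k) ys) \<le> sum_list (take (?n - k) xs)" using R by simp
        thus "sum_list (take k (rev xs)) \<le> sum_list (take k (rev ys))" unfolding t using True assms by simp
      qed
    qed
    thus ?thesis using True assms by (simp add: majorized_def)
  qed (simp add: majorized_def)
qed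

lemma majorized_iff_partial_sums:
  fixes \<alpha>s :: "'a::field poly list"
  assumes len: "length \<alpha>s = r" "length fs = r" "length gs = r"
  shows "map (\<lambda>g. int d - int g) (rev gs) \<prec>\<^sub>m rev (map2 (\<lambda>\<alpha> f. int (degree \<alpha>) + int f) \<alpha>s fs) \<longleftrightarrow>
    (\<Sum>i<r. degree (\<alpha>s ! i) + fs ! i) + (\<Sum>i<r. gs ! i) = r * d \<and>
    (\<forall>j\<le>r. (\<Sum>i<j. degree (\<alpha>s ! i) + fs ! i) + (\<Sum>i<j. gs ! i) \<le> j * d)"
proof -
  let ?X = "map (\<lambda>g. int d - int g) gs" and ?Y = "map2 (\<lambda>\<alpha> f. int (degree \<alpha>) + int f) \<alpha>s fs"
  have nth_sum: "sum_list (take j zs) = (\<Sum>i<j. zs ! i)" if "j \<le> length zs" for j and zs :: "int list"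
    using that by (auto simp: sum_list_sum_nth lessThan_atLeast0 min_def intro!: sum.cong)
  have X: "sum_list (take j ?X) = int (j * d) - int (\<Sum>i<j. gs ! i)" if "j \<le> r" for j
  proof -
    have "sum_list (take j ?X) = (\<Sum>i<j. int d - int (gs ! i))"
      using that len by (subst nth_sum) (auto intro!: sum.cong)
    thus ?thesis by (simp add: sum_subtractf)
  qed
  have Y: "sum_list (take j ?Y) = int (\<Sum>i<j. degree (\<alpha>s ! i) + fs ! i)" if "j \<le> r" for j
  proof -
    have "sum_list (take j ?Y) = (\<Sum>i<j. int (degree (\<alpha>s ! i) + fs ! i))"
      using that len by (subst nth_sum) (auto intro!: sum.cong)
    thus ?thesis by simp
  qed
  have tX: "sum_list ?X = int (r * d) - int (\<Sum>i<r. gs ! i)" using X[of r] len by simp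
  have tY: "sum_list ?Y = int (\<Sum>i<r. degree (\<alpha>s ! i) + fs ! i)" using Y[of r] len by simp
  have lX: "length ?X = length ?Y" "length ?X = r" using len by simp_all
  have "map (\<lambda>g. int d - int g) (rev gs) \<prec>\<^sub>m rev ?Y \<longleftrightarrow>
    sum_list ?X = sum_list ?Y \<and> (\<forall>j\<le>r. sum_list (take j ?Y) \<le> sum_list (take j ?X))"
    using majorized_rev_iff[OF lX(1)] unfolding lX(2) by (simp add: rev_map)
  also have "\<dots> \<longleftrightarrow> (\<Sum>i<r. degree (\<alpha>s ! i) + fs ! i) + (\<Sum>i<r. gs ! i) = r * d \<and>
    (\<forall>j\<le>r. (\<Sum>i<j. degree (\<alpha>s ! i) + fs ! i) + (\<Sum>i<j. gs ! i) \<le> j * d)"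
  proof (rule conj_cong)
    show "sum_list ?X = sum_list ?Y \<longleftrightarrow> (\<Sum>i<r. degree (\<alpha>s ! i) + fs ! i) + (\<Sum>i<r. gs ! i) = r * d"
      unfolding tX tY by linarith
    show "(\<forall>j\<le>r. sum_list (take j ?Y) \<le> sum_list (take j ?X)) \<longleftrightarrow>
      (\<forall>j\<le>r. (\<Sum>i<j. degree (\<alpha>s ! i) + fs ! i) + (\<Sum>i<j. gs ! i) \<le> j * d)"
    proof (intro all_cong1 imp_cong refl)
      fix j assume j: "j \<le> r"
      show "sum_list (take j ?Y) \<le> sum_list (take j ?X) \<longleftrightarrow>
        (\<Sum>i<j. degree (\<alpha>s ! i) + fs ! i) + (\<Sum>i<j. gs ! i) \<le> j * d"
        unfolding X[OF j] Y[OF j] by linarith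
    qed
  qed
  finally show ?thesis .
qed

text \<open>The largest element of a set of \<open>j\<close> positions is at least \<open>j - 1\<close>.\<close>

lemma sum_le_initial_sum:
  fixes b :: "nat \<Rightarrow> nat"
  assumes anti: "\<And>i j. i \<le> j \<Longrightarrow> j < r \<Longrightarrow> b j \<le> b i" and "S \<subseteq> {..<r}"
  shows "(\<Sum>i\<in>S. b i) \<le> (\<Sum>i<card S. b i)"
  using assms(2)
proof (induction "card S" arbitrary: S)
  case 0
  hence "finite S" using finite_subset by blast
  hence "S = {}" using 0 by simp
  thus ?case by simp
next
  case (Suc k)
  have fin: "finite S" using Suc.prems finite_subset by blast
  have ne: "S \<noteq> {}" using Suc.hyps(2) by auto
  let ?x = "Max S"
  have x: "?x \<in> S" by (rule Max_in[OF fin ne])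
  have "S \<subseteq> {..?x}" using fin by auto
  hence "card S \<le> Suc ?x" using card_mono[of "{..?x}" S] by simp
  hence kx: "k \<le> ?x" using Suc.hyps(2) by simp
  have ck: "card (S - {?x}) = k" using Suc.hyps(2) x fin by simp
  have "(\<Sum>i\<in>S. b i) = b ?x + (\<Sum>i\<in>S - {?x}. b i)" by (rule sum.remove[OF fin x])
  also have "\<dots> \<le> b k + (\<Sum>i<k. b i)"
  proof (rule add_mono)
    show "b ?x \<le> b k" using anti[OF kx] x Suc.prems by blast
    show "(\<Sum>i\<in>S - {?x}. b i) \<le> (\<Sum>i<k. b i)"
      using Suc.hyps(1)[of "S - {?x}"] ck Suc.prems by auto
  qed
  finally show ?case unfolding Suc.hyps(2)[symmetric] by simp
qed

lemma sorted_pairing: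
  fixes ks ls :: "nat list"
  assumes len: "length ks = r" "length ls = r" and gs: "gs = rev (sort (map2 (+) (rev ks) ls))"
  shows "length gs = r" and "\<And>i j. i \<le> j \<Longrightarrow> j < r \<Longrightarrow> gs ! j \<le> gs ! i"
    and "\<exists>\<pi>. \<pi> permutes {..<r} \<and> (\<forall>i<r. gs ! i = ks ! \<pi> i + rev ls ! \<pi> i)"
proof -
  let ?X = "map (\<lambda>i. ks ! i + rev ls ! i) [0..<r]"
  show lg: "length gs = r" using gs len by simp
  have "sorted (rev gs)" using gs by simp
  hence sg: "sorted_wrt (\<ge>) gs" by (simp add: sorted_wrt_rev)
  show "gs ! j \<le> gs ! i" if "i \<le> j" "j < r" for i j
    using sorted_wrt_nth_less[OF sg, of i j] that lg by (cases "i = j") auto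
  have "map2 (+) (rev ks) ls = rev ?X"
    by (rule nth_equalityI) (use len in \<open>auto simp: rev_nth\<close>)
  hence "mset gs = mset ?X" using gs by simp
  then obtain \<pi> where \<pi>: "\<pi> permutes {..<length ?X}" "permute_list \<pi> ?X = gs" by (rule mset_eq_permutation)
  have p: "\<pi> permutes {..<r}" using \<pi>(1) by simp
  have "gs ! i = ks ! \<pi> i + rev ls ! \<pi> i" if i: "i < r" for i
  proof -
    have "gs ! i = ?X ! \<pi> i" unfolding \<pi>(2)[symmetric] using i by (intro permute_list_nth[OF \<pi>(1)]) simp
    moreover have "\<pi> i < r" using permutes_in_image[OF p, of i] i by simp
    ultimately show ?thesis by simp
  qed
  thus "\<exists>\<pi>. \<pi> permutes {..<r} \<and> (\<forall>i<r. gs ! i = ks ! \<pi> i + rev ls ! \<pi> i)" using p by blast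
qed

section \<open>The structural data of polynomial matrices\<close>

theorem theorem5p3:
  fixes m n r d :: nat
    and \<alpha>s :: "'a::field poly list"
    and fs ks ls gs :: "nat list"
  assumes "0 < m" and "0 < n" and "0 < r" and "r \<le> min m n"
    and "length \<alpha>s = r" and "\<forall>\<alpha>\<in>set \<alpha>s. lead_coeff \<alpha> = 1" and "sorted_wrt (dvd) \<alpha>s"
    and "length fs = r" and "sorted_wrt (\<ge>) (rev fs)"
    and "length ks = r" and "sorted_wrt (\<ge>) ks"
    and "length ls = r" and "sorted_wrt (\<ge>) ls"
    and gs: "gs = rev (sort (map2 (+) (rev ks) ls))"
  shows
    "(\<forall>A\<in>carrier_mat m n. has_data r d \<alpha>s fs ks ls A \<longrightarrow>
        fs ! 0 = 0 \<and>
        map (\<lambda>g. int d - int g) (rev gs)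
          \<prec>\<^sub>m rev (map2 (\<lambda>\<alpha> f. int (Polynomial.degree \<alpha>) + int f) \<alpha>s fs) \<and>
        (r = n \<longrightarrow> (\<forall>l\<in>set ls. l = 0)) \<and>
        (r = m \<longrightarrow> (\<forall>k\<in>set ks. k = 0))) \<and>
     (is_alg_closed TYPE('a) \<longrightarrow>
        fs ! 0 = 0 \<and>
        map (\<lambda>g. int d - int g) (rev gs)
          \<prec>\<^sub>m rev (map2 (\<lambda>\<alpha> f. int (Polynomial.degree \<alpha>) + int f) \<alpha>s fs) \<and>
        (r = n \<longrightarrow> (\<forall>l\<in>set ls. l = 0)) \<and>
        (r = m \<longrightarrow> (\<forall>k\<in>set ks. k = 0)) \<longrightarrow>
        (\<exists>A\<in>carrier_mat m n. has_data r d \<alpha>s fs ks ls A))"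
proof -
  have r: "r \<le> m" "r \<le> n" using assms(4) by auto
  note lg = sorted_pairing(1)[OF assms(10,12) gs] and gm = sorted_pairing(2)[OF assms(10,12) gs]
  obtain \<pi> where p: "\<pi> permutes {..<r}" and g: "\<forall>i<r. gs ! i = ks ! \<pi> i + rev ls ! \<pi> i"
    using sorted_pairing(3)[OF assms(10,12) gs] by blast
  note maj = majorized_iff_partial_sums[OF assms(5,8) lg, of d]
  have gsum: "(\<Sum>i<r. gs ! i) = (\<Sum>i<r. ks ! i + rev ls ! i)"
  proof -
    have "(\<Sum>i<r. gs ! i) = (\<Sum>i<r. ks ! \<pi> i + rev ls ! \<pi> i)" using g by (intro sum.cong) auto
    also have "\<dots> = (\<Sum>i<r. ks ! i + rev ls ! i)" using sum.permute[OF p, of "\<lambda>i. ks ! i + rev ls ! i"] by (simp add: comp_def)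
    finally show ?thesis .
  qed
  show ?thesis
  proof (intro conjI ballI impI, goal_cases)
    case (1 A)
    note d = 1(2)
    have "partial_multiplicities_inf A fs" using d by (simp add: has_data_def)
    moreover from this obtain \<beta>s where "invariant_factors (rev_mat A) \<beta>s" "fs = map (order 0) \<beta>s"
      unfolding partial_multiplicities_inf_def by blast
    hence "pm_rank (rev_mat A) = r" using assms(8) unfolding invariant_factors_def by simp
    ultimately show ?case by (intro smallest_multiplicity_zero[OF 1(1) assms(1,2,3)]) (rule assms(8) | assumption)+
  next
    case (2 A)
    note nec = necessary_inequalities[OF 2(1) assms(1,2) r 2(2) assms(10,12,11,13)]
    show ?case
      unfolding maj
    proof (intro conjI allI impI)
      show "(\<Sum>i<r. degree (\<alpha>s ! i) + fs ! i) + (\<Sum>i<r. gs ! i) = r * d" unfolding gsum by (rule nec(2))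
      fix j assume j: "j \<le> r"
      have "(\<Sum>i<j. gs ! i) = (\<Sum>i<j. ks ! \<pi> i + rev ls ! \<pi> i)" using g j by (intro sum.cong) auto
      moreover have "(\<Sum>i<j. degree (\<alpha>s ! i) + fs ! i) + (\<Sum>i<j. ks ! \<pi> i + rev ls ! \<pi> i) \<le> j * d"
      proof (rule nec(1))
        show "inj_on \<pi> {..<j}" using permutes_inj[OF p] by (rule inj_on_subset) simp
        show "\<pi> i < r" if "i < j" for i using permutes_in_image[OF p, of i] that j by simp
      qed
      ultimately show "(\<Sum>i<j. degree (\<alpha>s ! i) + fs ! i) + (\<Sum>i<j. gs ! i) \<le> j * d" by simp
    qed
  next
    case (3 A l)
    have At: "A\<^sup>T \<in> carrier_mat n m" using 3(1) by simp
    have "col_span_minimal_indices A\<^sup>T ls" using 3(2) by (simp add: has_data_def row_span_minimal_indices_def)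
    thus ?case by (rule indices_zero_of_full_rank[OF At assms(2) _ _ assms(13) 3(4)]) (use assms 3 in simp)
  next
    case (4 A k)
    have "col_span_minimal_indices A ks" using 4(2) by (simp add: has_data_def)
    thus ?case by (rule indices_zero_of_full_rank[OF 4(1) assms(1) _ _ assms(11) 4(4)]) (use assms 4 in simp)
  next
    case 5
    hence f0: "fs ! 0 = 0" and M: "(\<Sum>i<r. degree (\<alpha>s ! i) + fs ! i) + (\<Sum>i<r. gs ! i) = r * d"
        "\<forall>j\<le>r. (\<Sum>i<j. degree (\<alpha>s ! i) + fs ! i) + (\<Sum>i<j. gs ! i) \<le> j * d"
      and z: "r = n \<longrightarrow> (\<forall>l\<in>set ls. l = 0)" "r = m \<longrightarrow> (\<forall>k\<in>set ks. k = 0)"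
      unfolding maj by blast+
    have sf: "sorted fs" using assms(9) by (simp add: sorted_wrt_rev)
    show ?case
    proof (rule sufficient_conditions[OF 5(1) assms(1,2,3) r assms(5,8,10,12,6,7) sf assms(11,13) f0 _ _ z])
      show "(\<Sum>i<r. degree (\<alpha>s ! i) + fs ! i) + (\<Sum>i<r. ks ! i + rev ls ! i) = r * d" using M(1) unfolding gsum .
      fix J assume J: "J \<subseteq> {..<r}"
      let ?J = "{i. i < r \<and> \<pi> i \<in> J}"
      have inj: "inj_on \<pi> ?J" using permutes_inj[OF p] by (rule inj_on_subset) simp
      have im: "\<pi> ` ?J = J"
      proof
        show "J \<subseteq> \<pi> ` ?J"
        proof
          fix x assume x: "x \<in> J"
          obtain i where i: "x = \<pi> i" using permutes_surj[OF p] by (meson surjD)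
          moreover have "i < r" using permutes_in_image[OF p, of i] x J i by auto
          ultimately show "x \<in> \<pi> ` ?J" using x by blast
        qed
      qed auto
      have card: "card ?J = card J" using card_image[OF inj] im by simp
      have "(\<Sum>i\<in>J. ks ! i + rev ls ! i) = (\<Sum>i\<in>\<pi> ` ?J. ks ! i + rev ls ! i)" unfolding im ..
      also have "\<dots> = (\<Sum>i\<in>?J. gs ! i)"
        unfolding sum.reindex[OF inj] using g by (intro sum.cong) auto
      also have "\<dots> \<le> (\<Sum>i<card ?J. gs ! i)"
        by (rule sum_le_initial_sum[of r]) (rule gm, assumption+, blast)
      also have "\<dots> = (\<Sum>i<card J. gs ! i)" unfolding card ..
      finally have "(\<Sum>i\<in>J. ks ! i + rev ls ! i) \<le> (\<Sum>i<card J. gs ! i)" .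
      moreover have "card J \<le> r" using card_mono[OF _ J] by simp
      hence "(\<Sum>i<card J. degree (\<alpha>s ! i) + fs ! i) + (\<Sum>i<card J. gs ! i) \<le> card J * d" using M(2) by blast
      ultimately show "(\<Sum>i<card J. degree (\<alpha>s ! i) + fs ! i) + (\<Sum>i\<in>J. ks ! i + rev ls ! i) \<le> card J * d"
        by linarith
    qed
  qed
qed

end
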